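(* In the two-sample semiparametric model with censored data described in the context, with parameter dimension $q\in\{1,2\}$, assume the following. (0) There are functions $h_1:\Theta\to(0,\infty)$, twice differentiable on $\Theta$, and $h_2:[0,\infty)\to[0,\infty)$, monotone, such that $\nabla_\theta\varphi(x;\theta)=\varphi(x;\theta)h_1(\theta)(1,h_2(x))^\top$. If $q=1$, then $h_2\equiv 0$ and only the first component of this identity is meant. If $q=2$, then $h_2$ is strictly monotone on the support of $F_0$. (1) (a) $\varphi(x;\theta)$ is monotone in $x$ for each fixed $\theta\in\Theta$, where $\Theta=\{\theta_1: a_1<\theta_1<\infty\}$ if $q=1$ and $\Theta=\{(\theta_1,\theta_2): a_i<\theta_i<\infty,\ i=1,2\}$ if $q=2$ (with constants $-\infty\le a_i<\infty$); (b) for each fixed $x>0$, $\varphi(x;\theta)$ is increasing in $\theta_1$ (and in $\theta_2$ if $q=2$); (c) for each fixed $x>0$ (and fixed $\theta_2$ if $q=2$), $\varphi(x;\theta)\to\infty$ as $\theta_1\to\infty$ and $\varphi(x;\theta)\to0$ as $\theta_1\to a_1$; (d) if $q=2$, then for fixed $x>0$, when $-\theta_1/\theta_2\to\gamma$ with $0\le\gamma\le\infty$: as $\theta_2\to\infty$, $\varphi(x;\theta)\to0$ if $x<\gamma$ and $\varphi(x;\theta)\to\infty$ if $x>\gamma$; as $\theta_2\to a_2$, $\varphi(x;\theta)\to0$ if $x>\gamma$ and $\varphi(x;\theta)\to\infty$ if $x<\gamma$. (2) $\rho_0=n_0/n$ and $\rho_1=n_1/n$ remain the same as $n\to\infty$.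 (3) For $k=0,1$ (with $[h_2(x)]^0\equiv1$), as $n\to\infty$, $$\sqrt{n_0}\int_0^\infty\frac{[h_2(x)]^k\varphi(x;\theta_0)}{\rho_0+\rho_1\varphi(x;\theta_0)}\,d[\hat F(x)-F_0(x)]\xrightarrow{D}N(0,\sigma_{F,k}^2),\qquad \sqrt{n_1}\int_0^\infty\frac{[h_2(x)]^k}{\rho_0+\rho_1\varphi(x;\theta_0)}\,d[\hat G(x)-G_0(x)]\xrightarrow{D}N(0,\sigma_{G,k}^2).$$ (4) $\|\hat F-F_0\|\to0$ and $\|\hat G-G_0\|\to0$ almost surely as $n\to\infty$. (5) For $k=1,2,3$, the integrals $\int_0^\infty[h_2(x)]^k\,dF_0(x)$ and $\int_0^\infty[h_2(x)]^k\,dG_0(x)$ are finite, and $\int_0^\infty[h_2(x)]^k\,d[\hat F(x)-F_0(x)]\to0$ and $\int_0^\infty[h_2(x)]^k\,d[\hat G(x)-G_0(x)]\to0$ almost surely as $n\to\infty$. Then: (i) $\tilde\theta_n\to\theta_0$ almost surely as $n\to\infty$; (ii) $\sqrt n(\tilde\theta_n-\theta_0)\xrightarrow{D}N(0,\Sigma_0)$ as $n\to\infty$, for some ($q\times q$) covariance matrix $\Sigma_0$; (iii) $\|\tilde F_n-F_0\|\to0$ almost surely as $n\to\infty$.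
   Context: Model. $X_1,\dots,X_{n_0}$ is a random sample with density $f_0(x)$ and $Y_1,\dots,Y_{n_1}$ is a random sample with density $g_0(x)=\varphi(x;\theta_0)f_0(x)$. The two samples are independent, $\varphi(x;\theta)$ is a known function ($x\in\mathbb R$), and $\theta_0\in\Theta\subset\mathbb R^q$ is a unique unknown parameter. $F_0,G_0$ are the unknown distribution functions, of nonnegative random variables, with densities $f_0,g_0$. Put $n=n_0+n_1$, $\rho_0=n_0/n$, $\rho_1=n_1/n$. $\|\cdot\|$ denotes the supremum norm over $[0,\infty)$. Observed data. Independent observed samples $\boldsymbol O^X_1,\dots,\boldsymbol O^X_{n_0}$ and $\boldsymbol O^Y_1,\dots,\boldsymbol O^Y_{n_1}$ are available for the $X$- and $Y$-samples; at least one of them is censored, in one of the following ways (described for the $X$-sample, the censoring variables being independent of $X_i$). - Right censored: $(V_i,\delta_i)$ with $V_i=X_i,\delta_i=1$ if $X_i\le C_i$; $V_i=C_i,\delta_i=0$ if $X_i>C_i$. - Doubly censored: $(V_i,\delta_i)$ with $V_i=X_i,\delta_i=1$ if $D_i<X_i\le C_i$; $V_i=C_i,\delta_i=2$ if $X_i>C_i$; $V_i=D_i,\delta_i=3$ if $X_i\le D_i$; $P\{D_i<C_i\}=1$. - Interval censored Case 1: $(C_i,\delta_i)$, $\delta_i=I\{X_i\le C_i\}$. - Interval censored Case 2: $(C_i,D_i,\delta_i)$ with $\delta_i=1$ if $D_i<X_i\le C_i$, $2$ if $X_i>C_i$, $3$ if $X_i\le D_i$; $P\{D_i<C_i\}=1$.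 - "Case 1" partly interval-censored: $X_i$ is observed for $1\le i\le k_0$, and $(C_i,I\{X_i\le C_i\})$ for $k_0<i\le n_0$. - General partly interval-censored: $X_i$ is observed for $1\le i\le k_0$, and for $k_0<i\le n_0$ one observes which of the intervals $(0,C_1],(C_1,C_2],\dots,(C_N,\infty)$ contains $X_i$, for potential examination times $C_1<\dots<C_N$. NPMLE. $\hat F$ and $\hat G$ are the nonparametric maximum likelihood estimators of $F_0$ and $G_0$ based on $\boldsymbol O^X_1,\dots,\boldsymbol O^X_{n_0}$ and on $\boldsymbol O^Y_1,\dots,\boldsymbol O^Y_{n_1}$, respectively, i.e. maximizers of the usual likelihood for the relevant type of data (the product over observations of the jump of $F$ at an exactly observed value, or of the $F$-mass of the interval in which the variable is known to lie); for uncensored data it is the empirical distribution function. They are step functions $\hat F(x)=\sum_{i=1}^{m_0}\hat p_i^X I\{W_i^X\le x\}$ and $\hat G(x)=\sum_{i=1}^{m_1}\hat p_i^Y I\{W_i^Y\le x\}$ with distinct points $W_1^X<\dots<W_{m_0}^X$, $W_1^Y<\dots<W_{m_1}^Y$ and positive weights; they need not be proper distribution functions (total mass may be less than 1). Semiparametric maximum likelihood estimator (SPMLE). $\tilde\theta_n\in\Theta$ denotes the solution $\theta$ of $$\int_0^\infty\frac{\varphi(x;\theta)}{\rho_0+\rho_1\varphi(x;\theta)}\,d\hat F(x)-\int_0^\infty\frac{1}{\rho_0+\rho_1\varphi(x;\theta)}\,d\hat G(x)=0,$$ $$\int_0^\infty\frac{\varphi(x;\theta)h_2(x)}{\rho_0+\rho_1\varphi(x;\theta)}\,d\hat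 F(x)-\int_0^\infty\frac{h_2(x)}{\rho_0+\rho_1\varphi(x;\theta)}\,d\hat G(x)=0,$$ where only the first equation is used when $q=1$ ($h_2\equiv0$). The estimator of $F_0$ is $$\tilde F_n(t)=\int_0^t\frac{1}{\rho_0+\rho_1\varphi(x;\tilde\theta_n)}\,d[\rho_0\hat F(x)+\rho_1\hat G(x)].$$
   Formalization: For q=2, assumption (3) is taken as joint convergence in distribution of the k=0 and k=1 components to a bivariate normal law (separately for the F- and G-parts); with only the separate limits for each k, conclusion (ii) can fail. *)

theory Defs
  imports "HOL-Probability.Probability"
begin

section \<open>Stieltjes integrals\<close>

text \<open>All distribution functions below vanish on the nonpositive half-line, so
  \<open>\<integral>\<^sub>0\<^sup>\<infinity>\<close> is the integral over the open half-line.\<close>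

definition stieltjes :: "(real \<Rightarrow> real) \<Rightarrow> (real \<Rightarrow> real) \<Rightarrow> real" where
  "stieltjes F f = (LINT x:{0<..}|interval_measure F. f x)"

definition df_support :: "(real \<Rightarrow> real) \<Rightarrow> real set" where
  "df_support F = {x. \<forall>e>0. F (x - e) < F (x + e)}"

definition sup_norm0 :: "(real \<Rightarrow> real) \<Rightarrow> real" where
  "sup_norm0 f = (SUP x\<in>{0..}. \<bar>f x\<bar>)"

section \<open>Censored observations and nonparametric maximum likelihood\<close>

text \<open>In the two partly censored schemes \<open>k0\<close> gives the number of exactly observed subjects as a
  function of the sample size, and \<open>N\<close> is the number of potential examination times.\<close>

datatype scheme =
    Uncensored
  | Right_Censored
  | Doubly_Censored
  | Interval_Case1
  | Interval_Case2
  | Partly_Case1 "nat \<Rightarrow> nat"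
  | Partly_General "nat \<Rightarrow> nat" nat

datatype obs =
    Exact_Obs real
  | Right_Obs real nat
  | Double_Obs real nat
  | Case1_Obs real nat
  | Case2_Obs real real nat
  | Exam_Obs "real list" nat

text \<open>The censoring variables of a subject are the coordinates of \<open>c\<close>: \<open>C = c 0\<close> and \<open>D = c 1\<close>,
  except that in the general partly interval-censored scheme the examination times are
  \<open>c 0 < \<dots> < c (N - 1)\<close>. Subjects are numbered from 0 and \<open>n\<close> is the sample size. The second
  component of an \<open>Exam_Obs\<close> is the number of examination times strictly before the event.\<close>

fun observe :: "scheme \<Rightarrow> nat \<Rightarrow> nat \<Rightarrow> real \<Rightarrow> (nat \<Rightarrow> real) \<Rightarrow> obs" where
  "observe Uncensored n i x c = Exact_Obs x"
| "observe Right_Censored n i x c =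
     (if x \<le> c 0 then Right_Obs x 1 else Right_Obs (c 0) 0)"
| "observe Doubly_Censored n i x c =
     (if c 1 < x \<and> x \<le> c 0 then Double_Obs x 1
      else if c 0 < x then Double_Obs (c 0) 2 else Double_Obs (c 1) 3)"
| "observe Interval_Case1 n i x c = Case1_Obs (c 0) (if x \<le> c 0 then 1 else 0)"
| "observe Interval_Case2 n i x c =
     Case2_Obs (c 0) (c 1) (if c 1 < x \<and> x \<le> c 0 then 1 else if c 0 < x then 2 else 3)"
| "observe (Partly_Case1 k0) n i x c =
     (if i < k0 n then Exact_Obs x else Case1_Obs (c 0) (if x \<le> c 0 then 1 else 0))"
| "observe (Partly_General k0 N) n i x c =
     (if i < k0 n then Exact_Obs x else Exam_Obs (map c [0..<N]) (card {j. j < N \<and> c j < x}))"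

fun censoring_ok :: "scheme \<Rightarrow> (nat \<Rightarrow> real) \<Rightarrow> bool" where
  "censoring_ok Doubly_Censored c \<longleftrightarrow> c 1 < c 0"
| "censoring_ok Interval_Case2 c \<longleftrightarrow> c 1 < c 0"
| "censoring_ok (Partly_General k0 N) c \<longleftrightarrow> 0 < N \<and> strict_mono_on {..<N} c"
| "censoring_ok _ c \<longleftrightarrow> True"

definition observed_sample ::
  "scheme \<Rightarrow> nat \<Rightarrow> (nat \<Rightarrow> real) \<Rightarrow> (nat \<Rightarrow> nat \<Rightarrow> real) \<Rightarrow> obs list" where
  "observed_sample s n x c = map (\<lambda>i. observe s n i (x i) (c i)) [0..<n]"

text \<open>Distribution functions on the open half-line, possibly of total mass less than 1; the missing
  mass is regarded as sitting at \<open>\<infinity>\<close>, so that the interval from \<open>c\<close> to \<open>\<infinity>\<close> has mass \<open>1 - F c\<close>.\<close>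

definition sub_df :: "(real \<Rightarrow> real) \<Rightarrow> bool" where
  "sub_df F \<longleftrightarrow> mono F \<and> (\<forall>x. continuous (at_right x) F) \<and> (\<forall>x\<le>0. F x = 0) \<and> (\<forall>x. F x \<le> 1)"

definition step_df :: "(real \<Rightarrow> real) \<Rightarrow> bool" where
  "step_df F \<longleftrightarrow> (\<exists>W p. finite W \<and> W \<subseteq> {0<..} \<and> (\<forall>w\<in>W. 0 < p w) \<and>
     (\<forall>x. F x = (\<Sum>w\<in>{w\<in>W. w \<le> x}. p w)))"

definition jump :: "(real \<Rightarrow> real) \<Rightarrow> real \<Rightarrow> real" where
  "jump F x = measure (interval_measure F) {x}"

fun lik_term :: "(real \<Rightarrow> real) \<Rightarrow> obs \<Rightarrow> real" where
  "lik_term F (Exact_Obs x) = jump F x"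
| "lik_term F (Right_Obs v d) = (if d = 1 then jump F v else 1 - F v)"
| "lik_term F (Double_Obs v d) = (if d = 1 then jump F v else if d = 2 then 1 - F v else F v)"
| "lik_term F (Case1_Obs c d) = (if d = 1 then F c else 1 - F c)"
| "lik_term F (Case2_Obs c d' d) =
     (if d = 1 then F c - F d' else if d = 2 then 1 - F c else F d')"
| "lik_term F (Exam_Obs cs j) =
     (if j < length cs then F (cs ! j) else 1) - (if j = 0 then 0 else F (cs ! (j - 1)))"

definition likelihood :: "(real \<Rightarrow> real) \<Rightarrow> obs list \<Rightarrow> real" where
  "likelihood F os = (\<Prod>ob\<leftarrow>os. lik_term F ob)"

text \<open>For a list of exact positive observations the only such maximizer is the empirical
  distribution function.\<close>

definition is_npmle :: "obs list \<Rightarrow> (real \<Rightarrow> real) \<Rightarrow> bool" where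
  "is_npmle os F \<longleftrightarrow> sub_df F \<and> step_df F \<and> (\<forall>H. sub_df H \<longrightarrow> likelihood H os \<le> likelihood F os)"

section \<open>Samples and estimators as random objects\<close>

definition latent :: "(nat \<Rightarrow> 'w \<Rightarrow> real) \<Rightarrow> (nat \<Rightarrow> 'w \<Rightarrow> nat \<Rightarrow> real) \<Rightarrow> 'w \<Rightarrow> nat \<Rightarrow> real \<times> (nat \<Rightarrow> real)"
  where "latent X C \<omega> = (\<lambda>i. (X i \<omega>, C i \<omega>))"

text \<open>Independence of two random elements of different types.\<close>

definition indep_elements ::
  "'w measure \<Rightarrow> ('w \<Rightarrow> 'u::topological_space) \<Rightarrow> ('w \<Rightarrow> 'v::topological_space) \<Rightarrow> bool" where
  "indep_elements M U V \<longleftrightarrow>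
     U \<in> borel_measurable M \<and> V \<in> borel_measurable M \<and>
     prob_space.indep_set M {U -` A \<inter> space M |A. A \<in> sets borel}
                            {V -` B \<inter> space M |B. B \<in> sets borel}"

definition censored_sample ::
  "'w measure \<Rightarrow> (real \<Rightarrow> real) \<Rightarrow> scheme \<Rightarrow> (nat \<Rightarrow> 'w \<Rightarrow> real) \<Rightarrow> (nat \<Rightarrow> 'w \<Rightarrow> nat \<Rightarrow> real) \<Rightarrow> bool" where
  "censored_sample M f s X C \<longleftrightarrow>
     prob_space.indep_vars M (\<lambda>_. borel) X UNIV \<and>
     (\<forall>i. distributed M lborel (X i) (\<lambda>x. ennreal (f x))) \<and>
     (\<forall>i. AE \<omega> in M. 0 \<le> X i \<omega>) \<and>
     (\<forall>i. indep_elements M (X i) (C i)) \<and>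
     (\<forall>i. AE \<omega> in M. censoring_ok s (C i \<omega>))"

text \<open>\<open>ns m\<close> is the sample size at stage \<open>m\<close>. Since maximizers of the likelihood need not be unique,
  the estimator is any choice of maximizer that is a function of the observed data and is
  measurable with respect to the sigma-algebra of the sample it is based on.\<close>

definition npmle_sequence ::
  "'w measure \<Rightarrow> scheme \<Rightarrow> (nat \<Rightarrow> 'w \<Rightarrow> real) \<Rightarrow> (nat \<Rightarrow> 'w \<Rightarrow> nat \<Rightarrow> real) \<Rightarrow> (nat \<Rightarrow> nat) \<Rightarrow>
   (nat \<Rightarrow> 'w \<Rightarrow> real \<Rightarrow> real) \<Rightarrow> bool" where
  "npmle_sequence M s X C ns Fhat \<longleftrightarrow>
     (\<exists>est. \<forall>m. \<forall>\<omega>\<in>space M.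
        Fhat m \<omega> = est m (observed_sample s (ns m) (\<lambda>i. X i \<omega>) (\<lambda>i. C i \<omega>))) \<and>
     (\<forall>m x. (\<lambda>\<omega>. Fhat m \<omega> x) \<in> borel_measurable (vimage_algebra (space M) (latent X C) borel)) \<and>
     (AE \<omega> in M. \<forall>m.
        is_npmle (observed_sample s (ns m) (\<lambda>i. X i \<omega>) (\<lambda>i. C i \<omega>)) (Fhat m \<omega>))"

section \<open>Convergence in distribution to a normal law\<close>

definition converges_in_law ::
  "'w measure \<Rightarrow> (nat \<Rightarrow> 'w \<Rightarrow> 'v::euclidean_space) \<Rightarrow> 'v measure \<Rightarrow> bool" where
  "converges_in_law M A \<nu> \<longleftrightarrow>
     (\<forall>m. A m \<in> borel_measurable M) \<and>
     (\<forall>f::'v \<Rightarrow> real. continuous_on UNIV f \<and> bounded (range f) \<longrightarrow>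
        (\<lambda>m. LINT \<omega>|M. f (A m \<omega>)) \<longlonglongrightarrow> (LINT x|\<nu>. f x))"

definition covariance_matrix :: "real ^ 'q ^ 'q \<Rightarrow> bool" where
  "covariance_matrix \<Sigma> \<longleftrightarrow> transpose \<Sigma> = \<Sigma> \<and> (\<forall>t. 0 \<le> t \<bullet> (\<Sigma> *v t))"

definition centered_normal1 :: "real \<Rightarrow> real measure" where
  "centered_normal1 v =
     (if v = 0 then return borel 0 else density lborel (\<lambda>x. ennreal (normal_density 0 (sqrt v) x)))"

text \<open>\<open>\<nu>\<close> is the law \<open>N(0, \<Sigma>)\<close>: every linear functional is univariate normal. Degenerate
  \<open>\<Sigma>\<close> is allowed.\<close>

definition is_centered_normal :: "real ^ 'q ^ 'q \<Rightarrow> (real ^ 'q) measure \<Rightarrow> bool" where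
  "is_centered_normal \<Sigma> \<nu> \<longleftrightarrow>
     prob_space \<nu> \<and> sets \<nu> = sets borel \<and>
     (\<forall>t. distr \<nu> borel (\<lambda>x. t \<bullet> x) = centered_normal1 (t \<bullet> (\<Sigma> *v t)))"

definition asymptotically_normal ::
  "'w measure \<Rightarrow> (nat \<Rightarrow> 'w \<Rightarrow> real ^ 'q) \<Rightarrow> real ^ 'q ^ 'q \<Rightarrow> bool" where
  "asymptotically_normal M A \<Sigma> \<longleftrightarrow>
     covariance_matrix \<Sigma> \<and> (\<exists>\<nu>. is_centered_normal \<Sigma> \<nu> \<and> converges_in_law M A \<nu>)"

section \<open>The parametric density ratio and the semiparametric estimator\<close>

text \<open>The parameter lives in \<open>real ^ 'q\<close> with one or two coordinates; \<open>i1\<close> is the index of the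
  first coordinate \<open>\<theta>\<^sub>1\<close>, and any other index is that of \<open>\<theta>\<^sub>2\<close>.\<close>

definition param_space :: "('q \<Rightarrow> ereal) \<Rightarrow> (real ^ 'q) set" where
  "param_space a = {\<theta>. \<forall>j. a j < ereal (\<theta> $ j)}"

definition to_lower_end :: "ereal \<Rightarrow> real filter" where
  "to_lower_end a = (if a = -\<infinity> then at_bot else at_right (real_of_ereal a))"

definition twice_differentiable_on :: "('v::euclidean_space \<Rightarrow> real) \<Rightarrow> 'v set \<Rightarrow> bool" where
  "twice_differentiable_on f S \<longleftrightarrow>
     (\<exists>D. (\<forall>x\<in>S. GDERIV f x :> D x) \<and> (\<forall>x\<in>S. D differentiable (at x)))"

text \<open>The vector \<open>(1, h\<^sub>2(x))\<close>, truncated to its first component if there is only one coordinate.\<close>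

definition weight :: "'q::finite \<Rightarrow> (real \<Rightarrow> real) \<Rightarrow> real \<Rightarrow> real ^ 'q" where
  "weight i1 h2 x = (\<chi> j. if j = i1 then 1 else h2 x)"

definition update_coord :: "real ^ 'q \<Rightarrow> 'q::finite \<Rightarrow> real \<Rightarrow> real ^ 'q" where
  "update_coord \<theta> i s = (\<chi> j. if j = i then s else \<theta> $ j)"

definition is_spmle ::
  "('q \<Rightarrow> ereal) \<Rightarrow> (real \<Rightarrow> real ^ 'q \<Rightarrow> real) \<Rightarrow> 'q::finite \<Rightarrow> (real \<Rightarrow> real) \<Rightarrow> real \<Rightarrow> real \<Rightarrow>
   (real \<Rightarrow> real) \<Rightarrow> (real \<Rightarrow> real) \<Rightarrow> real ^ 'q \<Rightarrow> bool" where
  "is_spmle a \<phi> i1 h2 \<rho>0 \<rho>1 F G \<theta> \<longleftrightarrow>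
     \<theta> \<in> param_space a \<and>
     (\<forall>j. stieltjes F (\<lambda>x. \<phi> x \<theta> * weight i1 h2 x $ j / (\<rho>0 + \<rho>1 * \<phi> x \<theta>))
        - stieltjes G (\<lambda>x. weight i1 h2 x $ j / (\<rho>0 + \<rho>1 * \<phi> x \<theta>)) = 0)"

definition semiparametric_df ::
  "(real \<Rightarrow> 'p \<Rightarrow> real) \<Rightarrow> real \<Rightarrow> real \<Rightarrow> (real \<Rightarrow> real) \<Rightarrow> (real \<Rightarrow> real) \<Rightarrow> 'p \<Rightarrow> real \<Rightarrow> real" where
  "semiparametric_df \<phi> \<rho>0 \<rho>1 F G \<theta> t =
     (LINT x:{0<..t}|interval_measure (\<lambda>x. \<rho>0 * F x + \<rho>1 * G x). 1 / (\<rho>0 + \<rho>1 * \<phi> x \<theta>))"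

end

theory Submission
  imports Defs
begin

text \<open>
The semiparametric two-sample model is a logistic regression in disguise, and logistic regression is a
convex problem; this is why all roots of the estimating equations are under control.

For \<open>x > 0\<close> the gradient identity forces the density ratio to be an exponential tilt,
\<open>\<phi>(x; \<theta>) = \<phi>(x; \<theta>0) exp (\<eta>(\<theta>) \<bullet> w(x))\<close> with \<open>w = (1, h2)\<close>: the gradients of \<open>ln \<phi>\<close> at different \<open>x\<close> share
the factor \<open>h1\<close>, and with two parameters integrability makes \<open>h1\<close> constant. The map \<open>\<eta>\<close> vanishes
at \<open>\<theta>0\<close>, has the derivative \<open>h1(\<theta>0)\<close> times the identity there, and small \<open>\<eta>(\<theta>)\<close> means that \<open>\<theta>\<close> is near \<open>\<theta>0\<close>
(\<open>tilt_structure\<close>). With \<open>b = ln (\<rho>1 \<phi>(\<cdot>; \<theta>0) / \<rho>0)\<close> the fraction \<open>\<rho>1 \<phi> / (\<rho>0 + \<rho>1 \<phi>)\<close> is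
\<open>logistic (b + \<eta> \<bullet> w)\<close>, the probability that a pooled observation comes from the second sample. The
estimating equations therefore say that the score \<open>U\<close> of this regression, formed with the estimated
distribution functions, vanishes at \<open>\<eta>(\<theta>\<^sub>n)\<close> (\<open>score_eq_estimating_function\<close>).

The score is a monotone vector field. A lower bound for increments of the logistic function that
holds for all arguments (\<open>logistic_increment_lower_global\<close>) gives \<open>c * min 1 (norm \<eta>) \<le> norm (U 0)\<close>
at every root \<open>\<eta>\<close>, with \<open>c > 0\<close> that does not depend on \<open>n\<close> (\<open>coercive\<close>). Since the model is correct at \<open>\<theta>0\<close>, \<open>U 0\<close> tends to zero
(\<open>score0_tendsto\<close>). Hence the root tends to 0, which is consistency, and it is even of the order of \<open>U 0\<close>. The
quadratic Taylor remainder is controlled by third moments, so that \<open>J \<eta> + U 0 = o(norm (U 0))\<close> with a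
positive definite information matrix \<open>J\<close> (\<open>score_root_expansion\<close>). Everything so far is pathwise.

For the limit law, \<open>sqrt n\<close> times \<open>U 0\<close> is a linear combination of the two errors whose
asymptotic normality is assumed. They are independent, because each is almost surely a measurable
function of its own sample (\<open>rc_version\<close>), so the sum converges to the convolution of two normal laws
(\<open>converges_in_law_indep_add\<close>). The expansion, the derivative of \<open>\<eta>\<close> (\<open>delta_method\<close>) and a form of
Slutsky's theorem (\<open>converges_in_law_perturb\<close>) carry the limit over to \<open>sqrt n (\<theta>\<^sub>n - \<theta>0)\<close>.

The estimator of \<open>F0\<close> depends on \<open>\<eta>\<close> smoothly: replacing \<open>\<eta>(\<theta>\<^sub>n)\<close> by 0 costs at most \<open>norm \<eta>\<close> times a
moment, uniformly in \<open>t\<close>, and at \<open>\<eta> = 0\<close> Polya's theorem turns pointwise into uniform convergence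
(\<open>baseline_df_uniform\<close>).

All limits of integrals come from the Helly--Bray theorem for integrands with countably many
discontinuities. An unbounded weight is truncated, and the error is paid for by the next
moment (\<open>stieltjes_tendsto_weighted\<close>).\<close>

section \<open>Finitely supported distribution functions\<close>

text \<open>A point outside the support has a rational interval around it on which \<open>F\<close> does not increase. Such
an interval is null, and there are only countably many of them.\<close>

lemma AE_interval_measure_df_support:
  fixes F :: "real \<Rightarrow> real"
  assumes "mono F" and rc: "\<And>x. continuous (at_right x) F"
  shows "AE x in interval_measure F. x \<in> df_support F"
proof -
  let ?R = "{(a, b). a \<in> \<rat> \<and> b \<in> \<rat> \<and> a \<le> b \<and> F a = F b} :: (real \<times> real) set"
  have "countable ?R"
    by (rule countable_subset[of _ "\<rat> \<times> \<rat>"]) (auto simp: countable_rat)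
  then have "(\<Union>(a, b)\<in>?R. {a<..b}) \<in> null_sets (interval_measure F)"
    using monoD[OF \<open>mono F\<close>]
    by (intro null_sets_UN') (auto simp: null_sets_def emeasure_interval_measure_Ioc rc)
  moreover have "{x \<in> space (interval_measure F). x \<notin> df_support F} \<subseteq> (\<Union>(a, b)\<in>?R. {a<..b})"
  proof
    fix x assume "x \<in> {x \<in> space (interval_measure F). x \<notin> df_support F}"
    then obtain e where e: "e > 0" "F (x - e) \<ge> F (x + e)"
      by (auto simp: df_support_def not_less)
    obtain a where a: "a \<in> \<rat>" "x - e < a" "a < x" using Rats_dense_in_real[of "x - e" x] e by auto
    obtain b where b: "b \<in> \<rat>" "x < b" "b < x + e" using Rats_dense_in_real[of x "x + e"] e by auto
    have "F (x - e) \<le> F a" "F a \<le> F b" "F b \<le> F (x + e)"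
      using a b by (auto intro!: monoD[OF \<open>mono F\<close>])
    with e a b show "x \<in> (\<Union>(a, b)\<in>?R. {a<..b})"
      by (intro UN_I[of "(a, b)"]) auto
  qed
  ultimately show ?thesis by (rule AE_I')
qed

lemma step_df_finite_support:
  assumes "step_df F"
  shows "finite (df_support F)" "df_support F \<subseteq> {0<..}"
proof -
  obtain W p where W: "finite W" "W \<subseteq> {0<..}" "\<And>x. F x = (\<Sum>w\<in>{w\<in>W. w \<le> x}. p w)"
    using assms unfolding step_df_def by metis
  have "df_support F \<subseteq> W"
  proof
    fix x assume x: "x \<in> df_support F"
    show "x \<in> W"
    proof (rule ccontr)
      assume "x \<notin> W"
      then obtain e where e: "e > 0" "\<And>w. w \<in> W \<Longrightarrow> e \<le> dist x w"
        using finite_set_avoid[OF W(1), of x] by metis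
      then have "{w\<in>W. w \<le> x - e/2} = {w\<in>W. w \<le> x + e/2}"
        by (force simp: dist_real_def)
      then have "F (x - e/2) = F (x + e/2)" by (simp add: W)
      moreover have "F (x - e/2) < F (x + e/2)" using x e by (simp add: df_support_def)
      ultimately show False by simp
    qed
  qed
  then show "finite (df_support F)" "df_support F \<subseteq> {0<..}"
    using W finite_subset by auto
qed

lemma step_df_eventually_const:
  assumes "step_df F"
  shows "\<exists>c m. \<forall>x\<ge>c. F x = m"
proof -
  obtain W p where W: "finite W" "W \<subseteq> {0<..}" "\<And>x. F x = (\<Sum>w\<in>{w\<in>W. w \<le> x}. p w)"
    using assms unfolding step_df_def by metis
  define c where "c = Max (insert 0 W)"
  have "w \<le> c" if "w \<in> W" for w using W that by (simp add: c_def)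
  then have "{w\<in>W. w \<le> x} = W" if "x \<ge> c" for x using that by force
  then have "\<forall>x\<ge>c. F x = sum p W" by (simp add: W(3))
  then show ?thesis by blast
qed

text \<open>The properties of a maximum likelihood estimator on which all integration against it rests: its
measure sits on finitely many points of the open half-line, so every measurable function is
integrable and integrals are finite sums over jumps. The eventual value is the total mass, which may
be less than 1.\<close>

definition fin_df :: "(real \<Rightarrow> real) \<Rightarrow> bool" where
  "fin_df F \<longleftrightarrow> mono F \<and> (\<forall>x. continuous (at_right x) F) \<and> (\<forall>x\<le>0. F x = 0) \<and>
     finite (df_support F) \<and> df_support F \<subseteq> {0<..} \<and> (\<exists>c m. \<forall>x\<ge>c. F x = m)"

lemma npmle_fin_df: "is_npmle os F \<Longrightarrow> fin_df F"
  unfolding is_npmle_def fin_df_def sub_df_def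
  using step_df_finite_support[of F] step_df_eventually_const[of F] by blast

lemma fin_df_finite_borel_measure:
  assumes "fin_df F"
  shows "finite_borel_measure (interval_measure F)"
proof -
  obtain c m where c: "\<And>x. x \<ge> c \<Longrightarrow> F x = m" using assms unfolding fin_df_def by blast
  have mono: "mono F" using assms unfolding fin_df_def by blast
  have "(F \<longlongrightarrow> 0) at_bot"
    by (rule tendsto_eventually) (use assms in \<open>auto simp: eventually_at_bot_linorder fin_df_def\<close>)
  moreover have "(F \<longlongrightarrow> m) at_top"
    by (rule tendsto_eventually) (use c in \<open>auto simp: eventually_at_top_linorder\<close>)
  moreover have "F (min c 0) = 0" using assms unfolding fin_df_def by simp
  then have "0 \<le> m" using monoD[OF mono, of "min c 0" c] c[of c] by simp
  ultimately show ?thesis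
    using assms by (intro finite_borel_measure_interval_measure) (auto simp: fin_df_def dest: monoD)
qed

lemma fin_df_AE: "fin_df F \<Longrightarrow> AE x in interval_measure F. x \<in> df_support F"
  by (rule AE_interval_measure_df_support) (auto simp: fin_df_def)

lemma fin_df_integrable:
  fixes f :: "real \<Rightarrow> real"
  assumes F: "fin_df F" and f: "f \<in> borel_measurable borel"
  shows "integrable (interval_measure F) f"
proof -
  interpret finite_borel_measure "interval_measure F" by (rule fin_df_finite_borel_measure[OF F])
  have "finite (df_support F)" using F by (simp add: fin_df_def)
  then have "\<exists>B. \<forall>x\<in>df_support F. norm (f x) \<le> B"
    using finite_imp_bounded[of "f ` df_support F"] by (auto simp: bounded_iff)
  then obtain B where B: "\<And>x. x \<in> df_support F \<Longrightarrow> norm (f x) \<le> B" by blast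
  show ?thesis
    by (rule integrable_const_bound[of _ B]) (use fin_df_AE[OF F] B f in auto)
qed

lemma fin_df_integral:
  fixes f :: "real \<Rightarrow> real"
  assumes F: "fin_df F" and f: "f \<in> borel_measurable borel"
    and W: "finite W" "df_support F \<subseteq> W"
  shows "(LINT x|interval_measure F. f x) = (\<Sum>w\<in>W. jump F w * f w)"
proof -
  interpret finite_borel_measure "interval_measure F" by (rule fin_df_finite_borel_measure[OF F])
  have "(LINT x|interval_measure F. f x) = (LINT x|interval_measure F. (\<Sum>w\<in>W. indicator {w} x * f w))"
  proof (rule integral_cong_AE)
    show "AE x in interval_measure F. f x = (\<Sum>w\<in>W. indicator {w} x * f w)"
      using fin_df_AE[OF F]
    proof eventually_elim
      case (elim x)
      have "(\<Sum>w\<in>W. indicator {w} x * f w) = (\<Sum>w\<in>W. if w = x then f w else 0)"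
        by (rule sum.cong) auto
      then show ?case using elim W by (auto simp: sum.delta)
    qed
  qed (use f in auto)
  also have "\<dots> = (\<Sum>w\<in>W. jump F w * f w)"
    by (subst Bochner_Integration.integral_sum)
       (auto simp: jump_def intro!: integrable_mult_left integrable_real_indicator emeasure_finite less_top[THEN iffD1])
  finally show ?thesis .
qed

text \<open>Written as a limit of increments, a jump is visibly linear in the distribution function; this is how
the linearity of the Stieltjes integral in its integrator is obtained.\<close>

lemma jump_limit:
  assumes F: "fin_df F"
  shows "(\<lambda>n. F x - F (x - 1 / real (Suc n))) \<longlonglongrightarrow> jump F x"
proof -
  interpret finite_borel_measure "interval_measure F" by (rule fin_df_finite_borel_measure[OF F])
  have "(\<lambda>n. measure (interval_measure F) {x - 1 / real (Suc n)<..x}) \<longlonglongrightarrow>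
      measure (interval_measure F) (\<Inter>n. {x - 1 / real (Suc n)<..x})"
  proof (rule finite_Lim_measure_decseq)
    have "1 / real (Suc n) \<le> 1 / real (Suc m)" if "m \<le> n" for m n
      using that by (intro divide_left_mono) auto
    then show "decseq (\<lambda>n. {x - 1 / real (Suc n)<..x})"
      unfolding decseq_def by (force simp del: of_nat_Suc)
  qed auto
  also have "(\<Inter>n. {x - 1 / real (Suc n)<..x}) = {x}"
  proof -
    have "y = x" if y: "\<And>n. x - 1 / real (Suc n) < y" "y \<le> x" for y
    proof (rule ccontr)
      assume "y \<noteq> x"
      then have "0 < x - y" using y(2) by simp
      then obtain n where "1 / real (Suc n) < x - y"
        using reals_Archimedean[of "x - y"] by (auto simp: inverse_eq_divide)
      with y(1)[of n] show False by simp
    qed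
    then show ?thesis by auto
  qed
  also have "(\<lambda>n. measure (interval_measure F) {x - 1 / real (Suc n)<..x}) = (\<lambda>n. F x - F (x - 1 / real (Suc n)))"
    using F by (intro ext measure_interval_measure_Ioc) (auto simp: fin_df_def dest: monoD)
  finally show ?thesis by (simp add: jump_def)
qed

lemma fin_df_comb:
  assumes F: "fin_df F" and G: "fin_df G" and ab: "0 \<le> a" "0 \<le> b"
  shows "fin_df (\<lambda>x. a * F x + b * G x)"
    and "df_support (\<lambda>x. a * F x + b * G x) \<subseteq> df_support F \<union> df_support G"
proof -
  have mF: "mono F" and mG: "mono G" using F G by (auto simp: fin_df_def)
  show s: "df_support (\<lambda>x. a * F x + b * G x) \<subseteq> df_support F \<union> df_support G"
  proof (rule subsetI, rule ccontr)
    fix x assume x: "x \<in> df_support (\<lambda>x. a * F x + b * G x)" "x \<notin> df_support F \<union> df_support G"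
    then obtain d e where de: "d > 0" "F (x - d) \<ge> F (x + d)" "e > 0" "G (x - e) \<ge> G (x + e)"
      by (auto simp: df_support_def not_less)
    define m where "m = min d e"
    have m: "m > 0" "m \<le> d" "m \<le> e" using de by (auto simp: m_def)
    have "F (x + m) \<le> F (x + d)" "F (x - d) \<le> F (x - m)" "G (x + m) \<le> G (x + e)" "G (x - e) \<le> G (x - m)"
      using m by (auto intro!: monoD[OF mF] monoD[OF mG])
    then have "F (x + m) \<le> F (x - m)" "G (x + m) \<le> G (x - m)" using de by linarith+
    then have "a * F (x + m) + b * G (x + m) \<le> a * F (x - m) + b * G (x - m)"
      using ab by (intro add_mono mult_left_mono) auto
    with x(1) m(1) show False by (force simp: df_support_def)
  qed
  obtain c d m k where cd: "\<forall>x\<ge>c. F x = m" "\<forall>x\<ge>d. G x = k"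
    using F G unfolding fin_df_def by metis
  then have "\<forall>x\<ge>max c d. a * F x + b * G x = a * m + b * k" by simp
  then have "\<exists>c m. \<forall>x\<ge>c. a * F x + b * G x = m" by blast
  moreover have "finite (df_support (\<lambda>x. a * F x + b * G x))"
    by (rule finite_subset[OF s]) (use F G in \<open>auto simp: fin_df_def\<close>)
  moreover have "df_support (\<lambda>x. a * F x + b * G x) \<subseteq> {0<..}"
    using s F G by (auto simp: fin_df_def)
  moreover have "mono (\<lambda>x. a * F x + b * G x)"
    using mF mG ab by (intro monoI add_mono mult_left_mono) (auto dest: monoD)
  ultimately show "fin_df (\<lambda>x. a * F x + b * G x)"
    using F G by (auto simp: fin_df_def intro!: continuous_intros)
qed

text \<open>Each side is a finite sum over the union of the two supports, and the jumps add up. The estimator of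
the baseline distribution integrates against such a combination, and rescaling a defective
distribution function to mass 1 is the case \<open>b = 0\<close>.\<close>

lemma integral_fin_df_comb:
  fixes f :: "real \<Rightarrow> real"
  assumes F: "fin_df F" and G: "fin_df G" and ab: "0 \<le> a" "0 \<le> b"
    and f: "f \<in> borel_measurable borel"
  shows "(LINT x|interval_measure (\<lambda>x. a * F x + b * G x). f x)
       = a * (LINT x|interval_measure F. f x) + b * (LINT x|interval_measure G. f x)"
proof -
  let ?H = "\<lambda>x. a * F x + b * G x" and ?W = "df_support F \<union> df_support G"
  note H = fin_df_comb[OF F G ab]
  have W: "finite ?W" using F G by (simp add: fin_df_def)
  have j: "jump ?H x = a * jump F x + b * jump G x" for x
  proof (rule LIMSEQ_unique[OF jump_limit[OF H(1)]])
    have "(\<lambda>n. a * (F x - F (x - 1 / real (Suc n))) + b * (G x - G (x - 1 / real (Suc n)))) \<longlonglongrightarrow> a * jump F x + b * jump G x"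
      by (intro tendsto_intros jump_limit F G)
    then show "(\<lambda>n. a * F x + b * G x - (a * F (x - 1 / real (Suc n)) + b * G (x - 1 / real (Suc n)))) \<longlonglongrightarrow> a * jump F x + b * jump G x"
      by (simp add: algebra_simps)
  qed
  show ?thesis
    using fin_df_integral[OF H(1) f W H(2)] fin_df_integral[OF F f W] fin_df_integral[OF G f W]
    by (simp add: j sum.distrib sum_distrib_left algebra_simps)
qed

section \<open>Convergence of Stieltjes integrals\<close>

text \<open>The integrands of this development are built from monotone functions by arithmetic and by
composition with continuous functions. Having at most countably many discontinuities is
preserved by these operations, implies measurability, and makes the set of discontinuities null for
every continuous limit distribution, as the Helly--Bray theorem demands. Only the open half-line,
on which the integrals live, matters.\<close>

definition ctble_disc :: "(real \<Rightarrow> real) \<Rightarrow> bool" where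
  "ctble_disc f \<longleftrightarrow> countable {x. 0 < x \<and> \<not> isCont f x}"

lemma ctble_disc_const [simp]: "ctble_disc (\<lambda>x. c)"
  by (simp add: ctble_disc_def)

lemma ctble_disc_combine:
  assumes "ctble_disc f" "ctble_disc g"
    and "\<And>x. 0 < x \<Longrightarrow> isCont f x \<Longrightarrow> isCont g x \<Longrightarrow> isCont h x"
  shows "ctble_disc h"
  unfolding ctble_disc_def
  by (rule countable_subset[of _ "{x. 0 < x \<and> \<not> isCont f x} \<union> {x. 0 < x \<and> \<not> isCont g x}"])
     (use assms in \<open>auto simp: ctble_disc_def\<close>)

lemma ctble_disc_add: "ctble_disc f \<Longrightarrow> ctble_disc g \<Longrightarrow> ctble_disc (\<lambda>x. f x + g x)"
  and ctble_disc_mult: "ctble_disc f \<Longrightarrow> ctble_disc g \<Longrightarrow> ctble_disc (\<lambda>x. f x * g x)"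
  and ctble_disc_diff: "ctble_disc f \<Longrightarrow> ctble_disc g \<Longrightarrow> ctble_disc (\<lambda>x. f x - g x)"
  and ctble_disc_min: "ctble_disc f \<Longrightarrow> ctble_disc g \<Longrightarrow> ctble_disc (\<lambda>x. min (f x) (g x))"
  by (erule (1) ctble_disc_combine, intro continuous_intros; simp)+

lemma ctble_disc_power: "ctble_disc f \<Longrightarrow> ctble_disc (\<lambda>x. f x ^ k)"
  by (rule ctble_disc_combine[of f f]) (auto intro!: continuous_intros)

lemma ctble_disc_compose:
  assumes "ctble_disc f" "\<And>x. 0 < x \<Longrightarrow> isCont g (f x)"
  shows "ctble_disc (\<lambda>x. g (f x))"
  by (rule ctble_disc_combine[OF assms(1,1)]) (use assms in \<open>auto intro: isCont_o2\<close>)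

lemmas ctble_disc_intros = ctble_disc_const ctble_disc_add ctble_disc_mult ctble_disc_diff
  ctble_disc_min ctble_disc_power

lemma ctble_disc_monotone:
  assumes "mono_on {0..} f \<or> antimono_on {0..} f"
  shows "ctble_disc f"
  using assms
proof
  assume "mono_on {0..} f"
  then have "mono_on {0<..} f" by (rule mono_on_subset) auto
  from mono_on_ctble_discont_open[OF _ this] show ?thesis by (simp add: ctble_disc_def)
next
  assume f: "antimono_on {0..} f"
  have "mono_on {0<..} (\<lambda>x. - f x)"
    by (rule mono_onI) (use f in \<open>auto simp: monotone_on_def\<close>)
  then have "countable {x. 0 < x \<and> \<not> isCont (\<lambda>x. - f x) x}"
    using mono_on_ctble_discont_open[of "{0<..}" "\<lambda>x. - f x"] by simp
  moreover have "isCont f x" if "isCont (\<lambda>x. - f x) x" for x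
    using continuous_minus[OF that] by simp
  ultimately show ?thesis
    unfolding ctble_disc_def by (auto intro: countable_subset[rotated])
qed

lemma ctble_disc_sum: "(\<And>i. i \<in> A \<Longrightarrow> ctble_disc (f i)) \<Longrightarrow> ctble_disc (\<lambda>x. \<Sum>i\<in>A. f i x)"
  by (induction A rule: infinite_finite_induct) (auto intro!: ctble_disc_add)

lemma ctble_disc_atMost: "ctble_disc (indicator {..t})"
  unfolding ctble_disc_def by (rule countable_subset[of _ "{t}"]) (auto simp: isCont_indicator)

lemma ctble_disc_indicator:
  "ctble_disc f \<Longrightarrow> countable {x. \<not> isCont (\<lambda>x. indicator {0<..} x * f x) x}"
proof -
  assume f: "ctble_disc f"
  have "isCont (\<lambda>x. indicator {0<..} x * f x) x" if "x \<noteq> 0" "\<not> (0 < x \<and> \<not> isCont f x)" for x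
  proof (cases "0 < x")
    case True
    with that have "isCont f x" by simp
    moreover have "\<forall>\<^sub>F y in nhds x. 0 < y"
      using eventually_nhds_in_open[of "{0<..}" x] True by simp
    then have "\<forall>\<^sub>F y in nhds x. indicator {0<..} y * f y = f y" by eventually_elim auto
    ultimately show ?thesis by (subst isCont_cong[where g = f]) auto
  next
    case False
    then have "x < 0" using that by simp
    then have "\<forall>\<^sub>F y in nhds x. y < 0" using eventually_nhds_in_open[of "{..<0}" x] by simp
    then have "\<forall>\<^sub>F y in nhds x. indicator {0<..} y * f y = 0" by eventually_elim auto
    then show ?thesis by (subst isCont_cong[where g = "\<lambda>_. 0"]) auto
  qed
  then have "{x. \<not> isCont (\<lambda>x. indicator {0<..} x * f x) x} \<subseteq> {0} \<union> {x. 0 < x \<and> \<not> isCont f x}"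
    by blast
  then show ?thesis using f by (auto simp: ctble_disc_def intro: countable_subset)
qed

lemma ctble_disc_measurable:
  assumes "ctble_disc f" shows "(\<lambda>x. indicator {0<..} x * f x) \<in> borel_measurable borel"
  by (rule borel_measurable_continuous_countable_exceptions[OF ctble_disc_indicator[OF assms]])
     (auto simp: continuous_on_eq_continuous_within intro: continuous_at_imp_continuous_at_within)

abbreviation sintegrable :: "(real \<Rightarrow> real) \<Rightarrow> (real \<Rightarrow> real) \<Rightarrow> bool" where
  "sintegrable F f \<equiv> set_integrable (interval_measure F) {0<..} f"

lemma stieltjes_eq: "stieltjes F f = (LINT x|interval_measure F. indicator {0<..} x * f x)"
  by (simp add: stieltjes_def set_lebesgue_integral_def)

lemma fin_df_sintegrable: "fin_df F \<Longrightarrow> ctble_disc f \<Longrightarrow> sintegrable F f"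
  using fin_df_integrable[OF _ ctble_disc_measurable] by (simp add: set_integrable_def)

lemma stieltjes_mono:
  assumes "sintegrable F f" "sintegrable F g" "\<And>x. 0 < x \<Longrightarrow> f x \<le> g x"
  shows "stieltjes F f \<le> stieltjes F g"
  unfolding stieltjes_def by (rule set_integral_mono) (use assms in auto)

lemma stieltjes_add:
  "sintegrable F f \<Longrightarrow> sintegrable F g \<Longrightarrow> stieltjes F (\<lambda>x. f x + g x) = stieltjes F f + stieltjes F g"
  unfolding stieltjes_def by (rule set_integral_add)

lemma stieltjes_diff:
  "sintegrable F f \<Longrightarrow> sintegrable F g \<Longrightarrow> stieltjes F (\<lambda>x. f x - g x) = stieltjes F f - stieltjes F g"
  unfolding stieltjes_def by (rule set_integral_diff)

lemma stieltjes_mult: "stieltjes F (\<lambda>x. c * f x) = c * stieltjes F f"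
  unfolding stieltjes_def by simp

lemma stieltjes_cong: "(\<And>x. 0 < x \<Longrightarrow> f x = g x) \<Longrightarrow> stieltjes F f = stieltjes F g"
  unfolding stieltjes_def by (rule set_lebesgue_integral_cong) auto

lemma stieltjes_nonneg: "(\<And>x. 0 < x \<Longrightarrow> 0 \<le> f x) \<Longrightarrow> 0 \<le> stieltjes F f"
  unfolding stieltjes_eq by (rule Bochner_Integration.integral_nonneg) (simp split: split_indicator)

lemma stieltjes_sum:
  "(\<And>i. i \<in> A \<Longrightarrow> sintegrable H (f i)) \<Longrightarrow>
    sintegrable H (\<lambda>x. \<Sum>i\<in>A. f i x) \<and> stieltjes H (\<lambda>x. \<Sum>i\<in>A. f i x) = (\<Sum>i\<in>A. stieltjes H (f i))"
proof (induction A rule: infinite_finite_induct)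
  case (insert a A)
  then show ?case using stieltjes_add[of H "f a" "\<lambda>x. \<Sum>i\<in>A. f i x"] set_integral_add(1)[of _ _ "f a" "\<lambda>x. \<Sum>i\<in>A. f i x"]
    by simp
qed (auto simp: stieltjes_eq set_integrable_def)

lemma stieltjes_diff_bound:
  assumes "sintegrable F f" "sintegrable F g" "sintegrable F e"
    and "\<And>x. 0 < x \<Longrightarrow> \<bar>f x - g x\<bar> \<le> e x"
  shows "\<bar>stieltjes F f - stieltjes F g\<bar> \<le> stieltjes F e"
proof -
  have d: "sintegrable F (\<lambda>x. f x - g x)" "sintegrable F (\<lambda>x. g x - f x)"
    using assms by (auto intro: set_integral_diff)
  have "stieltjes F (\<lambda>x. f x - g x) \<le> stieltjes F e" "stieltjes F (\<lambda>x. g x - f x) \<le> stieltjes F e"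
    by (rule stieltjes_mono; use assms d in \<open>force simp: abs_le_iff\<close>)+
  then show ?thesis using assms by (simp add: stieltjes_diff abs_le_iff)
qed

lemma sintegrable_bound:
  assumes "sintegrable F e" "ctble_disc f" "\<And>x. 0 < x \<Longrightarrow> \<bar>f x\<bar> \<le> e x"
  shows "sintegrable F f"
proof -
  have "integrable (interval_measure F) (\<lambda>x. indicator {0<..} x * f x)"
    by (rule Bochner_Integration.integrable_bound[of _ "\<lambda>x. indicator {0<..} x * e x"])
       (use assms ctble_disc_measurable[OF assms(2)] in \<open>auto simp: set_integrable_def indicator_def intro!: order_trans[OF _ abs_ge_self]\<close>)
  then show ?thesis by (simp add: set_integrable_def)
qed

text \<open>A realization of the estimators along which they converge to a continuous distribution function.
The total mass of \<open>Fs m\<close> is only known to be at most 1.\<close>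

locale df_limit =
  fixes Fs :: "nat \<Rightarrow> real \<Rightarrow> real" and F0 :: "real \<Rightarrow> real"
  assumes fin: "\<And>m. fin_df (Fs m)"
    and le1: "\<And>m x. Fs m x \<le> 1"
    and F0_mono: "mono F0"
    and F0_cont: "\<And>x. isCont F0 x"
    and F0_zero: "\<And>x. x \<le> 0 \<Longrightarrow> F0 x = 0"
    and F0_one: "(F0 \<longlongrightarrow> 1) at_top"
    and conv: "\<And>x. (\<lambda>m. Fs m x) \<longlonglongrightarrow> F0 x"
begin

lemma F0_real_distribution: "real_distribution (interval_measure F0)"
  and cdf_F0: "cdf (interval_measure F0) = F0"
proof -
  have z: "(F0 \<longlongrightarrow> 0) at_bot"
    by (rule tendsto_eventually) (use F0_zero in \<open>auto simp: eventually_at_bot_linorder\<close>)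
  have c: "continuous (at_right a) F0" for a
    using F0_cont by (rule continuous_at_imp_continuous_at_within)
  show "real_distribution (interval_measure F0)"
    using monoD[OF F0_mono] c z F0_one by (rule real_distribution_interval_measure)
  show "cdf (interval_measure F0) = F0"
    using monoD[OF F0_mono] c z by (rule cdf_interval_measure)
qed

lemma F0_countable_null:
  assumes "countable A" shows "emeasure (interval_measure F0) A = 0"
proof -
  interpret real_distribution "interval_measure F0" by (rule F0_real_distribution)
  have "{x} \<in> null_sets (interval_measure F0)" for x
    using isCont_cdf[of x] F0_cont[of x]
    by (simp add: cdf_F0 null_sets_def emeasure_eq_measure)
  then have "(\<Union>x\<in>A. {x}) \<in> null_sets (interval_measure F0)"
    using assms by (intro null_sets_UN') auto
  then show ?thesis by (simp add: null_sets_def)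
qed

lemma F0_AE_pos: "AE x in interval_measure F0. 0 < x"
proof -
  interpret real_distribution "interval_measure F0" by (rule F0_real_distribution)
  have "measure (interval_measure F0) {..0} = 0"
    using F0_zero[of 0] cdf_def2[of "interval_measure F0" 0] by (simp add: cdf_F0)
  then have "{..0} \<in> null_sets (interval_measure F0)"
    by (simp add: null_sets_def emeasure_eq_measure)
  from AE_not_in[OF this] show ?thesis by eventually_elim auto
qed

lemma stieltjes_F0_one: "stieltjes F0 (\<lambda>_. 1) = 1"
proof -
  interpret real_distribution "interval_measure F0" by (rule F0_real_distribution)
  have "stieltjes F0 (\<lambda>_. 1) = (LINT x|interval_measure F0. 1)"
    unfolding stieltjes_eq by (rule integral_cong_AE) (use F0_AE_pos in auto)
  then show ?thesis using prob_space by simp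
qed

text \<open>This is the Helly--Bray theorem. Since \<open>F0\<close> has mass 1, the masses \<open>L m\<close> of the estimators tend to 1,
so the normalized estimators are probability distributions that converge weakly.\<close>

lemma stieltjes_tendsto_bounded:
  assumes b: "ctble_disc b" and B: "\<And>x. 0 < x \<Longrightarrow> \<bar>b x\<bar> \<le> B"
  shows "(\<lambda>m. stieltjes (Fs m) b) \<longlonglongrightarrow> stieltjes F0 b"
proof -
  define f where "f x = indicator {0<..} x * b x" for x
  have f[measurable]: "f \<in> borel_measurable borel"
    unfolding f_def by (rule ctble_disc_measurable[OF b])
  have "\<exists>L. \<exists>c. \<forall>x\<ge>c. Fs m x = L" for m using fin[of m] unfolding fin_df_def by blast
  then obtain L where L: "\<And>m. \<exists>c. \<forall>x\<ge>c. Fs m x = L m" by metis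
  have Fm: "mono (Fs m)" for m using fin by (simp add: fin_df_def)
  have Lge: "Fs m x \<le> L m" for m x
  proof -
    obtain c where "\<forall>x\<ge>c. Fs m x = L m" using L by blast
    then show ?thesis using monoD[OF Fm, of x "max x c" m] by simp
  qed
  have L1: "L m \<le> 1" for m using L[of m] le1[of m] by (metis order_refl)
  have Llim: "L \<longlonglongrightarrow> 1"
  proof (rule LIMSEQ_I)
    fix r :: real assume "0 < r"
    then obtain x where x: "F0 x > 1 - r"
      using order_tendstoD(1)[OF F0_one, of "1 - r"] by (auto simp: eventually_at_top_linorder)
    then have "\<forall>\<^sub>F m in sequentially. Fs m x > 1 - r" by (rule order_tendstoD(1)[OF conv])
    then have "\<forall>\<^sub>F m in sequentially. norm (L m - 1) < r"
    proof eventually_elim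
      case (elim m)
      then show ?case using Lge[of m x] L1[of m] by simp
    qed
    then show "\<exists>no. \<forall>n\<ge>no. norm (L n - 1) < r" by (simp add: eventually_sequentially)
  qed
  then have "\<forall>\<^sub>F m in sequentially. L m > 0" by (rule order_tendstoD(1)) simp
  then obtain N where N: "\<And>m. m \<ge> N \<Longrightarrow> L m > 0" by (auto simp: eventually_sequentially)
  \<comment> \<open>The second summand vanishes; it casts the rescaling as a combination
    of two distribution functions.\<close>
  define H where "H m = (\<lambda>x. (1 / L (m + N)) * Fs (m + N) x + 0 * Fs (m + N) x)" for m
  have Lp: "L (m + N) > 0" for m using N by simp
  have Hfin: "fin_df (H m)" for m
    unfolding H_def by (rule fin_df_comb) (use fin Lp[of m] in \<open>auto simp: less_imp_le\<close>)
  have H0: "(H m \<longlongrightarrow> 0) at_bot" for m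
    by (rule tendsto_eventually)
       (use Hfin[of m] in \<open>auto simp: eventually_at_bot_linorder fin_df_def intro!: exI[of _ 0]\<close>)
  have H1: "(H m \<longlongrightarrow> 1) at_top" for m
  proof (rule tendsto_eventually)
    obtain c where "\<forall>x\<ge>c. Fs (m + N) x = L (m + N)" using L by blast
    then show "\<forall>\<^sub>F x in at_top. H m x = 1"
      using Lp[of m] unfolding eventually_at_top_linorder H_def by (intro exI[of _ c]) auto
  qed
  have Hm: "\<And>x y. x \<le> y \<Longrightarrow> H m x \<le> H m y" and Hrc: "\<And>a. continuous (at_right a) (H m)" for m
    using Hfin[of m] by (auto simp: fin_df_def dest: monoD)
  have "(\<lambda>m. integral\<^sup>L (interval_measure (H m)) f) \<longlonglongrightarrow> integral\<^sup>L (interval_measure F0) f"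
  proof (rule weak_conv_imp_bdd_ae_continuous_conv[where B = "\<bar>B\<bar>"])
    show "real_distribution (interval_measure (H m))" for m
      using Hm Hrc H0 H1 by (rule real_distribution_interval_measure)
    show "real_distribution (interval_measure F0)" by (rule F0_real_distribution)
    have cH: "cdf (interval_measure (H m)) = H m" for m
      using Hm Hrc H0 by (rule cdf_interval_measure)
    have "(\<lambda>m. H m x) \<longlonglongrightarrow> F0 x" for x
    proof -
      have "(\<lambda>m. (1 / L (m + N)) * Fs (m + N) x + 0 * Fs (m + N) x) \<longlonglongrightarrow> (1/1) * F0 x + 0 * F0 x"
        by (intro tendsto_intros LIMSEQ_ignore_initial_segment Llim conv) simp
      then show ?thesis by (simp add: H_def)
    qed
    then show "weak_conv_m (\<lambda>m. interval_measure (H m)) (interval_measure F0)"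
      by (simp add: weak_conv_m_def weak_conv_def cH cdf_F0)
    show "emeasure (interval_measure F0) {x. \<not> isCont f x} = 0"
      by (rule F0_countable_null) (use ctble_disc_indicator[OF b] in \<open>simp add: f_def[abs_def]\<close>)
    show "norm (f x) \<le> \<bar>B\<bar>" for x using B[of x] by (auto simp: f_def indicator_def)
  qed (rule f)
  moreover have "integral\<^sup>L (interval_measure (H m)) f = stieltjes (Fs (m + N)) b / L (m + N)" for m
    unfolding H_def
    by (subst integral_fin_df_comb) (use fin Lp[of m] in \<open>auto simp: stieltjes_eq f_def[abs_def] less_imp_le ctble_disc_measurable[OF b]\<close>)
  ultimately have "(\<lambda>m. stieltjes (Fs (m + N)) b / L (m + N)) \<longlonglongrightarrow> stieltjes F0 b"
    by (simp add: stieltjes_eq f_def[abs_def])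
  from tendsto_mult[OF this LIMSEQ_ignore_initial_segment[OF Llim, of N]]
  have "(\<lambda>m. stieltjes (Fs (m + N)) b) \<longlonglongrightarrow> stieltjes F0 b" using Lp by (simp add: less_imp_neq[symmetric])
  then show ?thesis by (rule LIMSEQ_offset)
qed

end

locale df_limit_moments = df_limit +
  fixes h :: "real \<Rightarrow> real"
  assumes h_nonneg: "\<And>x. 0 < x \<Longrightarrow> 0 \<le> h x"
    and h_disc: "ctble_disc h"
    and h_int: "\<And>k. k \<in> {1,2,3::nat} \<Longrightarrow> sintegrable F0 (\<lambda>x. h x ^ k)"
    and h_conv: "\<And>k. k \<in> {1,2,3::nat} \<Longrightarrow>
      (\<lambda>m. stieltjes (Fs m) (\<lambda>x. h x ^ k) - stieltjes F0 (\<lambda>x. h x ^ k)) \<longlonglongrightarrow> 0"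
begin

lemma h_power_sintegrable: "k \<le> 3 \<Longrightarrow> sintegrable F0 (\<lambda>x. h x ^ k)"
proof (cases "k = 0")
  case True
  interpret real_distribution "interval_measure F0" by (rule F0_real_distribution)
  show ?thesis using True by (simp add: set_integrable_def emeasure_eq_measure)
next
  case False
  moreover assume "k \<le> 3"
  ultimately show ?thesis by (intro h_int) auto
qed

lemma sintegrable_weighted:
  assumes b: "ctble_disc b" and B: "\<And>x. 0 < x \<Longrightarrow> \<bar>b x\<bar> \<le> B" and "k \<le> 3"
  shows "sintegrable F0 (\<lambda>x. h x ^ k * b x)"
proof (rule sintegrable_bound[of _ "\<lambda>x. B * h x ^ k"])
  show "sintegrable F0 (\<lambda>x. B * h x ^ k)" using h_power_sintegrable[OF \<open>k \<le> 3\<close>] by simp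
  show "ctble_disc (\<lambda>x. h x ^ k * b x)" by (intro ctble_disc_intros h_disc b)
  show "\<bar>h x ^ k * b x\<bar> \<le> B * h x ^ k" if "0 < x" for x
    using mult_right_mono[OF B[OF that], of "h x ^ k"] h_nonneg[OF that] by (simp add: abs_mult ac_simps)
qed

lemma h_power_tendsto: "k \<le> 3 \<Longrightarrow> (\<lambda>m. stieltjes (Fs m) (\<lambda>x. h x ^ k)) \<longlonglongrightarrow> stieltjes F0 (\<lambda>x. h x ^ k)"
proof (cases "k = 0")
  case True
  then show ?thesis using stieltjes_tendsto_bounded[of "\<lambda>_. 1" 1] by simp
next
  case False
  moreover assume "k \<le> 3"
  ultimately have "k \<in> {1,2,3}" by auto
  from h_conv[OF this] show ?thesis by (rule LIM_zero_cancel)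
qed

text \<open>Truncating \<open>h\<close> at \<open>T\<close> turns the integrand into a bounded one. The error is supported where \<open>T < h x\<close>,
hence at most \<open>B / T\<close> times the moment of order \<open>k + 1\<close>, and these moments stay bounded because they
converge. This is why a weight of order \<open>k \<le> 2\<close> needs three moments.\<close>

lemma stieltjes_tendsto_weighted:
  assumes b: "ctble_disc b" and B: "\<And>x. 0 < x \<Longrightarrow> \<bar>b x\<bar> \<le> B" and k: "k \<le> 2"
  shows "(\<lambda>m. stieltjes (Fs m) (\<lambda>x. h x ^ k * b x)) \<longlonglongrightarrow> stieltjes F0 (\<lambda>x. h x ^ k * b x)"
proof -
  let ?f = "\<lambda>x. h x ^ k * b x"
  let ?K = "stieltjes F0 (\<lambda>x. h x ^ Suc k)"
  have B0: "B \<ge> 0" using B[of 1] by simp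
  have K0: "?K \<ge> 0"
    using stieltjes_mono[of F0 "\<lambda>_. 0" "\<lambda>x. h x ^ Suc k"] h_power_sintegrable[of "Suc k"] k h_nonneg
    by (simp add: stieltjes_eq set_integrable_def)
  show ?thesis
  proof (rule LIMSEQ_I)
    fix r :: real assume r: "0 < r"
    \<comment> \<open>Chosen so that the truncation error stays below \<open>r / 3\<close>, for \<open>F0\<close> and, as soon as the
      moment of order \<open>k + 1\<close> is below \<open>?K + 1\<close>, for \<open>Fs m\<close>.\<close>
    define T where "T = 3 * (B + 1) * (?K + 1) / r"
    have T: "T > 0" unfolding T_def using B0 K0 r by (intro divide_pos_pos mult_pos_pos) auto
    have TB: "(B / T) * (?K + 1) < r / 3"
    proof -
      have "(B / T) * (?K + 1) = (r / 3) * (B / (B + 1))"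
      proof -
        have "?K + 1 \<noteq> 0" "B + 1 \<noteq> 0" "r \<noteq> 0" using B0 K0 r by auto
        then show ?thesis unfolding T_def by (simp del: power_Suc)
      qed
      also have "\<dots> < (r / 3) * 1" using B0 r by (intro mult_strict_left_mono) auto
      finally show ?thesis by simp
    qed
    let ?g = "\<lambda>x. min (h x) T ^ k * b x"
    have cf: "ctble_disc ?f" and cg: "ctble_disc ?g" and ce: "ctble_disc (\<lambda>x. (B / T) * h x ^ Suc k)"
      by (intro ctble_disc_intros h_disc b)+
    have gb: "\<bar>?g x\<bar> \<le> T ^ k * B" if "0 < x" for x
      using B[OF that] h_nonneg[OF that] T by (simp add: abs_mult mult_mono power_mono)
    have fg: "\<bar>?f x - ?g x\<bar> \<le> (B / T) * h x ^ Suc k" if x: "0 < x" for x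
    proof (cases "h x \<le> T")
      case True then show ?thesis using B0 T h_nonneg[OF x] by simp
    next
      case False
      have "0 \<le> h x ^ k - T ^ k" "h x ^ k - T ^ k \<le> h x ^ k"
        using False T by (auto intro: power_mono)
      then have "\<bar>?f x - ?g x\<bar> \<le> h x ^ k * B"
        using False B[OF x] h_nonneg[OF x] B0
        by (auto simp: min_def left_diff_distrib[symmetric] abs_mult intro!: mult_mono)
      also have "\<dots> \<le> h x ^ k * B * (h x / T)"
        using False T B0 h_nonneg[OF x] mult_left_mono[of 1 "h x / T" "h x ^ k * B"] by simp
      also have "\<dots> = (B / T) * h x ^ Suc k" by simp
      finally show ?thesis .
    qed
    have if0: "sintegrable F0 ?f" by (rule sintegrable_weighted[OF b B]) (use k in auto)
    have ie0: "sintegrable F0 (\<lambda>x. (B / T) * h x ^ Suc k)"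
      using h_power_sintegrable[of "Suc k"] k by (simp del: power_Suc)
    have ig0: "sintegrable F0 ?g"
      by (rule sintegrable_bound[OF _ cg gb]) (use h_power_sintegrable[of 0] set_integrable_mult_right[of "T ^ k * B" _ _ "\<lambda>_. 1"] in auto)
    note m_int = fin_df_sintegrable[OF fin cf] fin_df_sintegrable[OF fin cg] fin_df_sintegrable[OF fin ce]
    have 0: "\<bar>stieltjes F0 ?f - stieltjes F0 ?g\<bar> \<le> (B / T) * ?K"
      using stieltjes_diff_bound[OF if0 ig0 ie0 fg] unfolding stieltjes_mult by simp
    have 1: "\<bar>stieltjes (Fs m) ?f - stieltjes (Fs m) ?g\<bar> \<le> (B / T) * stieltjes (Fs m) (\<lambda>x. h x ^ Suc k)" for m
      using stieltjes_diff_bound[OF m_int fg] unfolding stieltjes_mult by simp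
    have "(\<lambda>m. stieltjes (Fs m) (\<lambda>x. h x ^ Suc k)) \<longlonglongrightarrow> ?K" by (rule h_power_tendsto) (use k in auto)
    then have ev1: "\<forall>\<^sub>F m in sequentially. stieltjes (Fs m) (\<lambda>x. h x ^ Suc k) < ?K + 1"
      by (rule order_tendstoD(2)) simp
    have ev2: "\<forall>\<^sub>F m in sequentially. dist (stieltjes (Fs m) ?g) (stieltjes F0 ?g) < r / 3"
      by (rule tendstoD[OF stieltjes_tendsto_bounded[OF cg gb]]) (use r in auto)
    have "\<forall>\<^sub>F m in sequentially. norm (stieltjes (Fs m) ?f - stieltjes F0 ?f) < r"
      using ev1 ev2
    proof eventually_elim
      case (elim m)
      have "(B / T) * stieltjes (Fs m) (\<lambda>x. h x ^ Suc k) \<le> (B / T) * (?K + 1)"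
        by (rule mult_left_mono) (use elim B0 T in auto)
      moreover have "(B / T) * ?K \<le> (B / T) * (?K + 1)"
        by (rule mult_left_mono) (use B0 T in auto)
      ultimately show ?case using 0 1[of m] TB elim(2) by (simp only: dist_real_def real_norm_def)
    qed
    then show "\<exists>no. \<forall>n\<ge>no. norm (stieltjes (Fs n) ?f - stieltjes F0 ?f) < r"
      by (simp add: eventually_sequentially)
  qed
qed

end

section \<open>Increments of the logistic function\<close>

definition logistic :: "real \<Rightarrow> real" where
  "logistic x = 1 / (1 + exp (- x))"

definition logistic' :: "real \<Rightarrow> real" where
  "logistic' x = logistic x * (1 - logistic x)"

lemma exp_add_one_nz [simp]: "1 + exp (x::real) \<noteq> 0"
  by (metis add_pos_pos exp_gt_zero less_irrefl zero_less_one)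

lemma logistic_pos: "0 < logistic x" and logistic_less_1: "logistic x < 1"
  by (auto simp: logistic_def add_pos_pos divide_simps)

lemma logistic'_pos: "0 < logistic' x" and logistic'_le_1: "logistic' x \<le> 1"
  using logistic_pos[of x] logistic_less_1[of x] by (auto simp: logistic'_def intro: mult_le_one)

lemma logistic_mono: "x \<le> y \<Longrightarrow> logistic x \<le> logistic y"
  by (auto simp: logistic_def add_pos_pos intro!: divide_left_mono mult_pos_pos)

lemma DERIV_logistic: "(logistic has_real_derivative logistic' x) (at x)"
  unfolding logistic_def[abs_def] logistic'_def
  by (auto intro!: derivative_eq_intros simp: field_simps power2_eq_square)

lemma DERIV_logistic':
  "(logistic' has_real_derivative logistic' x * (1 - 2 * logistic x)) (at x)"
  unfolding logistic'_def[abs_def]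
  by (auto intro!: derivative_eq_intros DERIV_logistic simp: logistic'_def algebra_simps)

lemma isCont_logistic: "isCont logistic x" and isCont_logistic': "isCont logistic' x"
  using DERIV_logistic DERIV_logistic' DERIV_isCont by blast+

lemma logistic_lipschitz: "\<bar>logistic y - logistic x\<bar> \<le> \<bar>y - x\<bar>"
proof -
  have "norm (logistic y - logistic x) \<le> 1 * norm (y - x)"
    by (rule field_differentiable_bound[of UNIV _ logistic'])
       (use DERIV_logistic logistic'_le_1 less_imp_le[OF logistic'_pos] in simp_all)
  then show ?thesis by simp
qed

lemma logistic'_lipschitz: "\<bar>logistic' y - logistic' x\<bar> \<le> \<bar>y - x\<bar>"
proof -
  have "\<bar>logistic' z * (1 - 2 * logistic z)\<bar> \<le> 1" for z
    unfolding abs_mult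
    using logistic'_le_1[of z] logistic'_pos[of z] logistic_pos[of z] logistic_less_1[of z]
    by (intro mult_le_one) auto
  then have "norm (logistic' y - logistic' x) \<le> 1 * norm (y - x)"
    by (intro field_differentiable_bound[of UNIV _ "\<lambda>z. logistic' z * (1 - 2 * logistic z)"])
       (use DERIV_logistic' in auto)
  then show ?thesis by simp
qed

lemma logistic_second_order: "\<bar>logistic (x + s) - logistic x - s * logistic' x\<bar> \<le> s\<^sup>2"
proof -
  have d: "((\<lambda>u. logistic (x + u) - u * logistic' x) has_real_derivative (logistic' (x + u) - logistic' x)) (at u within A)" for u A
  proof -
    have "((\<lambda>u. logistic (x + u)) has_real_derivative logistic' (x + u) * (0 + 1)) (at u)"
      by (rule DERIV_chain2[OF DERIV_logistic]) (auto intro!: derivative_eq_intros)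
    then have "((\<lambda>u. logistic (x + u) - u * logistic' x) has_real_derivative (logistic' (x + u) * (0 + 1) - 1 * logistic' x)) (at u)"
      by (intro DERIV_diff DERIV_cmult_right DERIV_ident)
    then show ?thesis by (simp add: has_field_derivative_at_within)
  qed
  have "norm ((logistic (x + s) - s * logistic' x) - (logistic (x + 0) - 0 * logistic' x)) \<le> \<bar>s\<bar> * norm (s - 0)"
  proof (rule field_differentiable_bound[of "{-\<bar>s\<bar>..\<bar>s\<bar>}" "\<lambda>u. logistic (x + u) - u * logistic' x" "\<lambda>u. logistic' (x + u) - logistic' x"])
    show "norm (logistic' (x + u) - logistic' x) \<le> \<bar>s\<bar>" if "u \<in> {-\<bar>s\<bar>..\<bar>s\<bar>}" for u
      using logistic'_lipschitz[of "x + u" x] that by auto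
    show "((\<lambda>u. logistic (x + u) - u * logistic' x) has_real_derivative logistic' (x + u) - logistic' x)
        (at u within {-\<bar>s\<bar>..\<bar>s\<bar>})" for u by (rule d)
    show "s \<in> {-\<bar>s\<bar>..\<bar>s\<bar>}" "0 \<in> {-\<bar>s\<bar>..\<bar>s\<bar>}" by auto
  qed (rule convex_real_interval)
  then show ?thesis by (simp add: power2_eq_square abs_mult_self_eq algebra_simps)
qed

text \<open>With \<open>p = logistic x\<close>, adding \<open>s\<close> to the log-odds multiplies the odds \<open>p / (1 - p)\<close> by \<open>exp s\<close>; the
factor \<open>logistic' x = p * (1 - p)\<close> splits off exactly, not just to first order.\<close>

lemma logistic_shift:
  "logistic (x + s) - logistic x = logistic' x * ((exp s - 1) / (1 + logistic x * (exp s - 1)))"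
proof -
  have nz: "1 + exp (- x) > 0" "1 + exp (-x) * exp (-s) > 0" "exp s > 0" "exp s + exp (-x) > 0"
    by (auto simp: add_pos_pos)
  have 1: "1 + logistic x * (exp s - 1) = (exp s + exp (-x)) / (1 + exp (-x))"
    using nz by (simp add: logistic_def field_simps)
  have 2: "logistic (x + s) = exp s / (exp s + exp (-x))"
    using nz by (simp add: logistic_def exp_minus exp_add field_simps exp_diff)
  have 3: "logistic' x = exp (-x) / (1 + exp (-x))^2"
    using nz by (simp add: logistic_def logistic'_def field_simps power2_eq_square)
  define e d where "e = exp s" and "d = exp (-x)"
  have ed: "e > 0" "d > 0" by (auto simp: e_def d_def)
  have "e / (e + d) - 1 / (1 + d) = d * (e - 1) / ((1 + d) * (e + d))"
    using ed by (simp add: divide_simps add_pos_pos) (simp add: algebra_simps)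
  also have "\<dots> = d / (1 + d)^2 * ((e - 1) / ((e + d) / (1 + d)))"
    using ed by (simp add: power2_eq_square)
  finally show ?thesis unfolding 1 2 3 by (simp add: e_def d_def logistic_def)
qed

text \<open>By the exact increment formula it remains to bound \<open>(exp s - 1) / (1 + p * (exp s - 1))\<close>. For
\<open>0 \<le> s\<close> the denominator is at most \<open>exp s\<close> and the numerator at least \<open>s\<close>; for \<open>s = - t < 0\<close> the
denominator is at most 1 and \<open>t * exp (- t) \<le> 1 - exp (- t)\<close>.\<close>

lemma logistic_increment_lower:
  "s * (logistic (x + s) - logistic x) \<ge> s\<^sup>2 * (logistic' x * exp (- \<bar>s\<bar>))"
proof -
  let ?p = "logistic x"
  have p: "0 < ?p" "?p < 1" by (auto simp: logistic_pos logistic_less_1)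
  have key: "s * ((exp s - 1) / (1 + ?p * (exp s - 1))) \<ge> s\<^sup>2 * exp (- \<bar>s\<bar>)"
  proof (cases "s \<ge> 0")
    case True
    then have e: "exp s \<ge> 1 + s" by (simp add: exp_ge_add_one_self)
    have d0: "1 + ?p * (exp s - 1) > 0" using e True p by (simp add: add_pos_nonneg)
    have d1: "1 + ?p * (exp s - 1) \<le> exp s"
      using mult_right_mono[of ?p 1 "exp s - 1"] p e True by simp
    have "s * exp (- s) = s / exp s" by (simp add: exp_minus field_simps)
    also have "\<dots> \<le> (exp s - 1) / (1 + ?p * (exp s - 1))"
    proof (rule frac_le)
      show "s \<le> exp s - 1" using e by linarith
    qed (use d0 d1 e True in auto)
    finally have "s * exp (- s) \<le> (exp s - 1) / (1 + ?p * (exp s - 1))" .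
    from mult_left_mono[OF this True] True show ?thesis by (simp add: power2_eq_square mult.assoc)
  next
    case False
    define t where "t = - s"
    have t: "t > 0" using False by (simp add: t_def)
    have e: "exp (- t) < 1" using t by simp
    have d0: "1 + ?p * (exp (- t) - 1) > 0"
    proof -
      have "?p * (1 - exp (- t)) < 1 * 1" using p e by (intro mult_strict_mono) auto
      then show ?thesis by (simp add: algebra_simps)
    qed
    have d1: "1 + ?p * (exp (- t) - 1) \<le> 1" using p e by (simp add: mult_le_0_iff)
    have "exp t \<ge> 1 + t" by (simp add: exp_ge_add_one_self)
    then have "exp (- t) * (1 + t) \<le> exp (- t) * exp t" by (intro mult_left_mono) auto
    then have "t * exp (- t) \<le> 1 - exp (- t)" by (simp add: exp_minus algebra_simps)
    also have "1 - exp (- t) \<le> (1 - exp (- t)) / (1 + ?p * (exp (- t) - 1))"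
      using d0 d1 e by (simp add: divide_simps)
    finally have "t * (t * exp (- t)) \<le> t * ((1 - exp (- t)) / (1 + ?p * (exp (- t) - 1)))"
      using t by (intro mult_left_mono) auto
    moreover have "s * ((exp s - 1) / (1 + ?p * (exp s - 1))) = t * ((1 - exp (- t)) / (1 + ?p * (exp (- t) - 1)))"
      by (simp add: t_def minus_divide_left[symmetric] divide_simps)
         (simp add: algebra_simps)
    moreover have "s\<^sup>2 * exp (- \<bar>s\<bar>) = t * (t * exp (- t))" using False by (simp add: t_def power2_eq_square)
    ultimately show ?thesis by linarith
  qed
  have "s * (logistic (x + s) - logistic x) = logistic' x * (s * ((exp s - 1) / (1 + ?p * (exp s - 1))))"
    by (simp add: logistic_shift)
  also have "\<dots> \<ge> logistic' x * (s\<^sup>2 * exp (- \<bar>s\<bar>))"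
    using logistic'_pos[of x] by (intro mult_left_mono key) auto
  finally show ?thesis by (simp add: ac_simps)
qed

text \<open>The local bound decays exponentially in \<open>s\<close>, which is useless for large increments. But the logistic
function is monotone, so an increment \<open>s\<close> may be replaced by the shorter \<open>s / t\<close> with \<open>\<bar>s / t\<bar> \<le> H\<close>.
The resulting bound is linear in \<open>t\<close> as \<open>t\<close> grows; in the application \<open>t\<close> is the norm of the parameter
and \<open>H\<close> depends on the observation alone, which separates the two.\<close>

lemma logistic_increment_lower_global:
  assumes t: "0 \<le> t" and H: "1 \<le> H" and s: "\<bar>s\<bar> \<le> t * H"
  shows "s * (logistic (x + s) - logistic x) \<ge> (s\<^sup>2 * (logistic' x * exp (- H))) / max 1 t"
proof (cases "t \<le> 1")
  case True
  have "t * H \<le> 1 * H" using True H by (intro mult_right_mono) auto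
  then have "\<bar>s\<bar> \<le> H" using s by linarith
  then have "exp (- H) \<le> exp (- \<bar>s\<bar>)" by simp
  then have "s\<^sup>2 * (logistic' x * exp (- H)) \<le> s\<^sup>2 * (logistic' x * exp (- \<bar>s\<bar>))"
    using logistic'_pos[of x] by (intro mult_left_mono) auto
  with logistic_increment_lower[of s x] True show ?thesis by (simp add: max_def)
next
  case False
  define u where "u = s / t"
  have t1: "t > 1" using False by simp
  have su: "s = t * u" using t1 by (simp add: u_def)
  have "\<bar>u\<bar> \<le> H" using s t1 by (simp add: u_def divide_simps mult.commute)
  then have "exp (- H) \<le> exp (- \<bar>u\<bar>)" by simp
  then have "u\<^sup>2 * (logistic' x * exp (- H)) \<le> u\<^sup>2 * (logistic' x * exp (- \<bar>u\<bar>))"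
    using logistic'_pos[of x] by (intro mult_left_mono) auto
  also have "\<dots> \<le> u * (logistic (x + u) - logistic x)" by (rule logistic_increment_lower)
  also have "\<dots> \<le> u * (logistic (x + s) - logistic x)"
  proof (cases "u \<ge> 0")
    case True
    then have "u \<le> s" using su t1 mult_right_mono[of 1 t u] by simp
    then show ?thesis using True logistic_mono[of "x + u" "x + s"] by (intro mult_left_mono) auto
  next
    case False
    then have "s \<le> u" using su t1 mult_right_mono_neg[of 1 t u] by simp
    then show ?thesis using False logistic_mono[of "x + s" "x + u"] by (intro mult_left_mono_neg) auto
  qed
  finally have "t * (u\<^sup>2 * (logistic' x * exp (- H))) \<le> t * (u * (logistic (x + s) - logistic x))"
    using t1 by (intro mult_left_mono) auto
  moreover have "t * (u\<^sup>2 * (logistic' x * exp (- H))) = (s\<^sup>2 * (logistic' x * exp (- H))) / max 1 t"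
    using t1 by (simp add: su power2_eq_square)
  ultimately show ?thesis by (simp add: su mult.assoc)
qed

section \<open>Positive definite limits and uniform convergence of monotone functions\<close>

text \<open>The quadratic form of \<open>Q\<close> attains a positive minimum \<open>c\<close> on the unit sphere, and entrywise convergence
moves the forms of \<open>Qm m\<close> uniformly on the sphere, eventually by less than \<open>c / 2\<close>.\<close>

lemma posdef_limit_lower:
  fixes Q :: "real ^ 'q ^ 'q" and Qm :: "nat \<Rightarrow> real ^ 'q ^ 'q"
  assumes conv: "\<And>i j. (\<lambda>m. Qm m $ i $ j) \<longlonglongrightarrow> Q $ i $ j"
    and pos: "\<And>v. v \<noteq> 0 \<Longrightarrow> 0 < v \<bullet> (Q *v v)"
  shows "\<exists>c>0. \<forall>\<^sub>F m in sequentially. \<forall>v. c * (norm v)\<^sup>2 \<le> v \<bullet> (Qm m *v v)"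
proof -
  let ?S = "sphere 0 1 :: (real^'q) set"
  have "?S \<noteq> {}" using vector_choose_size[of 1] by force
  moreover have "continuous_on ?S (\<lambda>v. v \<bullet> (Q *v v))"
    by (intro continuous_intros matrix_vector_mult_linear_continuous_on)
  ultimately obtain u where u: "u \<in> ?S" "\<And>v. v \<in> ?S \<Longrightarrow> u \<bullet> (Q *v u) \<le> v \<bullet> (Q *v v)"
    using continuous_attains_inf[OF compact_sphere] by blast
  define c where "c = u \<bullet> (Q *v u)"
  have "u \<noteq> 0" using u(1) by auto
  then have c: "c > 0" using pos[of u] by (simp add: c_def)
  have Qlow: "c * (norm v)\<^sup>2 \<le> v \<bullet> (Q *v v)" for v
  proof (cases "v = 0")
    case False
    then have "c \<le> (v /\<^sub>R norm v) \<bullet> (Q *v (v /\<^sub>R norm v))" using u(2)[of "v /\<^sub>R norm v"] by (simp add: c_def)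
    also have "\<dots> = (v \<bullet> (Q *v v)) / (norm v)\<^sup>2"
      by (simp add: matrix_vector_mult_scaleR power2_eq_square divide_simps)
    finally show ?thesis using False by (simp add: divide_simps)
  qed simp
  have "(\<lambda>m. \<Sum>i\<in>UNIV. \<Sum>j\<in>UNIV. \<bar>Qm m $ i $ j - Q $ i $ j\<bar>) \<longlonglongrightarrow> (\<Sum>i\<in>(UNIV::'q set). \<Sum>j\<in>(UNIV::'q set). \<bar>Q $ i $ j - Q $ i $ j\<bar>)"
    by (intro tendsto_intros conv)
  then have "\<forall>\<^sub>F m in sequentially. (\<Sum>i\<in>UNIV. \<Sum>j\<in>UNIV. \<bar>Qm m $ i $ j - Q $ i $ j\<bar>) < c / 2"
    by (rule order_tendstoD(2)) (use c in simp)
  then have "\<forall>\<^sub>F m in sequentially. \<forall>v. (c / 2) * (norm v)\<^sup>2 \<le> v \<bullet> (Qm m *v v)"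
  proof eventually_elim
    case (elim m)
    show ?case
    proof
      fix v :: "real^'q"
      have "v \<bullet> (Q *v v) - v \<bullet> (Qm m *v v) = (\<Sum>i\<in>UNIV. \<Sum>j\<in>UNIV. v $ i * (Q $ i $ j - Qm m $ i $ j) * v $ j)"
        by (simp add: inner_vec_def matrix_vector_mult_def sum_distrib_left sum_subtractf[symmetric] algebra_simps)
      also have "\<dots> \<le> (\<Sum>i\<in>UNIV. \<Sum>j\<in>UNIV. \<bar>Qm m $ i $ j - Q $ i $ j\<bar> * (norm v)\<^sup>2)"
      proof (intro sum_mono)
        fix i j
        have "v $ i * (Q $ i $ j - Qm m $ i $ j) * v $ j \<le> \<bar>v $ i\<bar> * \<bar>Qm m $ i $ j - Q $ i $ j\<bar> * \<bar>v $ j\<bar>"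
          by (metis abs_ge_self abs_minus_commute abs_mult)
        also have "\<dots> \<le> norm v * \<bar>Qm m $ i $ j - Q $ i $ j\<bar> * norm v"
          by (intro mult_mono component_le_norm_cart) auto
        finally show "v $ i * (Q $ i $ j - Qm m $ i $ j) * v $ j \<le> \<bar>Qm m $ i $ j - Q $ i $ j\<bar> * (norm v)\<^sup>2"
          by (simp add: power2_eq_square ac_simps)
      qed
      also have "\<dots> = (\<Sum>i\<in>UNIV. \<Sum>j\<in>UNIV. \<bar>Qm m $ i $ j - Q $ i $ j\<bar>) * (norm v)\<^sup>2"
        by (simp add: sum_distrib_right)
      also have "\<dots> \<le> (c / 2) * (norm v)\<^sup>2" by (intro mult_right_mono) (use elim in auto)
      finally show "(c / 2) * (norm v)\<^sup>2 \<le> v \<bullet> (Qm m *v v)" using Qlow[of v] by (simp add: algebra_simps)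
    qed
  qed
  with c show ?thesis by (intro exI[of _ "c / 2"]) auto
qed

text \<open>Polya's theorem: monotone functions that converge pointwise to a continuous distribution function
converge uniformly, because control at finitely many grid points gives control between
them. The \<open>D m\<close> may have any limit at infinity that is bounded by \<open>c m\<close>.\<close>

lemma Polya_uniform:
  fixes D :: "nat \<Rightarrow> real \<Rightarrow> real" and F :: "real \<Rightarrow> real"
  assumes D_mono: "\<And>m s t. 0 \<le> s \<Longrightarrow> s \<le> t \<Longrightarrow> D m s \<le> D m t"
    and D_le: "\<And>m t. 0 \<le> t \<Longrightarrow> D m t \<le> c m" and c: "c \<longlonglongrightarrow> 1"
    and conv: "\<And>t. 0 \<le> t \<Longrightarrow> (\<lambda>m. D m t) \<longlonglongrightarrow> F t"
    and F_mono: "mono F" and F_cont: "continuous_on UNIV F" and F_one: "(F \<longlongrightarrow> 1) at_top"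
    and e: "0 < (e::real)"
  shows "\<forall>\<^sub>F m in sequentially. \<forall>t\<ge>0. \<bar>D m t - F t\<bar> < e"
proof -
  have F1: "F t \<le> 1" for t
    by (rule tendsto_lowerbound[OF F_one]) (auto simp: eventually_at_top_linorder intro!: exI[of _ t] monoD[OF F_mono])
  obtain T0 where T0: "\<And>t. t \<ge> T0 \<Longrightarrow> F t > 1 - e / 3"
    using order_tendstoD(1)[OF F_one, of "1 - e / 3"] e by (auto simp: eventually_at_top_linorder)
  define T where "T = max T0 1"
  have T: "T > 0" "F T > 1 - e / 3" using T0[of T] by (auto simp: T_def)
  have "uniformly_continuous_on {0..T + 1} F"
    by (rule compact_uniformly_continuous) (auto intro: continuous_on_subset[OF F_cont])
  then obtain d where d: "d > 0" "\<And>x y. x \<in> {0..T+1} \<Longrightarrow> y \<in> {0..T+1} \<Longrightarrow> dist x y < d \<Longrightarrow> dist (F x) (F y) < e / 3"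
    unfolding uniformly_continuous_on_def by (metis e divide_pos_pos zero_less_numeral)
  \<comment> \<open>The grid of mesh \<open>\<delta> \<le> 1\<close> reaches at most \<open>T + 1\<close>, where uniform continuity is still available.\<close>
  define \<delta> where "\<delta> = min (d / 2) 1"
  have \<delta>: "\<delta> > 0" "\<delta> < d" "\<delta> \<le> 1" using d by (auto simp: \<delta>_def)
  define K where "K = nat \<lceil>T / \<delta>\<rceil>"
  have "\<forall>\<^sub>F m in sequentially. \<forall>k\<in>{..K+1}. \<bar>D m (real k * \<delta>) - F (real k * \<delta>)\<bar> < e / 3"
  proof (intro eventually_ball_finite ballI)
    fix k
    show "\<forall>\<^sub>F m in sequentially. \<bar>D m (real k * \<delta>) - F (real k * \<delta>)\<bar> < e / 3"
      using tendstoD[OF conv[of "real k * \<delta>"], of "e / 3"] e \<delta> by (simp add: dist_real_def)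
  qed simp
  moreover have "\<forall>\<^sub>F m in sequentially. \<bar>D m T - F T\<bar> < e / 3"
    using tendstoD[OF conv[of T], of "e / 3"] e T by (simp add: dist_real_def)
  moreover have "\<forall>\<^sub>F m in sequentially. \<bar>c m - 1\<bar> < e / 3"
    using tendstoD[OF c, of "e / 3"] e by (simp add: dist_real_def)
  ultimately show ?thesis
  proof eventually_elim
    case (elim m)
    show ?case
    proof (intro allI impI)
      fix t :: real assume t: "0 \<le> t"
      show "\<bar>D m t - F t\<bar> < e"
      proof (cases "t \<le> T")
        case False
        then have "D m T \<le> D m t" "D m t \<le> c m" "F T \<le> F t" "F t \<le> 1"
          using T t by (auto intro!: D_mono D_le F1 monoD[OF F_mono])
        then show ?thesis using elim T by linarith
      next
        case True
        define k where "k = nat \<lfloor>t / \<delta>\<rfloor>"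
        have "0 \<le> t / \<delta>" using t \<delta> by simp
        then have fl: "real k \<le> t / \<delta>" "t / \<delta> < real k + 1"
          unfolding k_def by linarith+
        then have k: "real k * \<delta> \<le> t" "t < real (Suc k) * \<delta>"
          using \<delta>(1) by (auto simp: field_simps)
        have "t / \<delta> \<le> T / \<delta>" using True \<delta> by (intro divide_right_mono) auto
        then have kK: "k \<le> K" unfolding k_def K_def by (intro nat_mono) linarith
        have s: "real (Suc k) * \<delta> - t < d" "t - real k * \<delta> < d" "real (Suc k) * \<delta> \<le> T + 1"
          using k \<delta> True by (auto simp: algebra_simps)
        have "\<bar>F (real (Suc k) * \<delta>) - F t\<bar> < e / 3" "\<bar>F (real k * \<delta>) - F t\<bar> < e / 3"
          using d(2)[of "real (Suc k) * \<delta>" t] d(2)[of "real k * \<delta>" t] s k t True \<delta>(1)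
          by (auto simp: dist_real_def simp del: of_nat_Suc)
        moreover have "\<bar>D m (real (Suc k) * \<delta>) - F (real (Suc k) * \<delta>)\<bar> < e / 3" "\<bar>D m (real k * \<delta>) - F (real k * \<delta>)\<bar> < e / 3"
          using elim(1) kK by (auto simp del: of_nat_Suc)
        moreover have "D m (real k * \<delta>) \<le> D m t" "D m t \<le> D m (real (Suc k) * \<delta>)"
          using k t \<delta>(1) by (auto intro!: D_mono simp del: of_nat_Suc)
        ultimately show ?thesis using e by linarith
      qed
    qed
  qed
qed

section \<open>Logistic regression on the pooled sample\<close>

lemma abs_indicator_mult_le_1: "0 \<le> y \<Longrightarrow> y \<le> 1 \<Longrightarrow> \<bar>indicator A x * (y::real)\<bar> \<le> 1"
  by (cases "x \<in> A") auto

lemma logistic_bounds: "0 \<le> logistic x" "logistic x \<le> 1" "0 \<le> 1 - logistic x" "1 - logistic x \<le> 1"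
  using logistic_pos[of x] logistic_less_1[of x] by auto

definition pooled :: "real \<Rightarrow> real \<Rightarrow> (real \<Rightarrow> real) \<Rightarrow> (real \<Rightarrow> real) \<Rightarrow> (real \<Rightarrow> real) \<Rightarrow> real" where
  "pooled \<rho>0 \<rho>1 F G f = \<rho>0 * stieltjes F f + \<rho>1 * stieltjes G f"

definition information ::
  "real \<Rightarrow> real \<Rightarrow> (real \<Rightarrow> real) \<Rightarrow> (real \<Rightarrow> real) \<Rightarrow> (real \<Rightarrow> real) \<Rightarrow> 'q::finite \<Rightarrow> (real \<Rightarrow> real) \<Rightarrow> real ^ 'q ^ 'q" where
  "information \<rho>0 \<rho>1 F G h i1 b =
     (\<chi> i j. pooled \<rho>0 \<rho>1 F G (\<lambda>x. logistic' (b x) * (weight i1 h x $ i * weight i1 h x $ j)))"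

text \<open>Regard the two samples as one pooled sample with a label and model the probability that an
observation \<open>x\<close> belongs to the second sample by \<open>logistic (b x + \<eta> \<bullet> w x)\<close>. The normalized derivative
of the log-likelihood is the label mean of \<open>w\<close> minus its fitted mean; with the opposite sign, taken
here, it is a monotone vector field in \<open>\<eta>\<close>, whose derivative at \<open>0\<close> is the information matrix.\<close>

definition score ::
  "real \<Rightarrow> real \<Rightarrow> (real \<Rightarrow> real) \<Rightarrow> (real \<Rightarrow> real) \<Rightarrow> (real \<Rightarrow> real) \<Rightarrow> 'q::finite \<Rightarrow> (real \<Rightarrow> real) \<Rightarrow> real ^ 'q \<Rightarrow> real ^ 'q" where
  "score \<rho>0 \<rho>1 F G h i1 b \<eta> =
     (\<chi> j. pooled \<rho>0 \<rho>1 F G (\<lambda>x. weight i1 h x $ j * logistic (b x + \<eta> \<bullet> weight i1 h x))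
          - \<rho>1 * stieltjes G (\<lambda>x. weight i1 h x $ j))"

text \<open>The assumption \<open>link\<close> states that the model is correct at \<open>\<eta> = 0\<close>: the limiting odds for the second
sample at \<open>x\<close> are \<open>exp (b x)\<close>, that is, \<open>\<rho>1 dG0 = exp (b x) \<rho>0 dF0\<close>. The assumption
\<open>nondegenerate\<close> is identifiability.\<close>

locale two_sample_limit =
  F: df_limit_moments Fs F0 h + G: df_limit_moments Gs G0 h
  for Fs F0 Gs G0 h +
  fixes b :: "real \<Rightarrow> real" and \<rho>0 \<rho>1 :: real and i1 :: "'q::finite"
  assumes q: "CARD('q) = 1 \<or> CARD('q) = 2"
    and b_disc: "ctble_disc b"
    and \<rho>: "0 < \<rho>0" "0 < \<rho>1"
    and link: "\<And>f. ctble_disc f \<Longrightarrow>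
       \<rho>1 * stieltjes G0 (\<lambda>x. (1 - logistic (b x)) * f x) = \<rho>0 * stieltjes F0 (\<lambda>x. logistic (b x) * f x)"
    and nondegenerate: "\<And>v. (AE x in interval_measure F0. v \<bullet> weight i1 h x = 0) \<Longrightarrow> v = 0"
begin

abbreviation w :: "real \<Rightarrow> real ^ 'q" where "w \<equiv> weight i1 h"
abbreviation Em :: "nat \<Rightarrow> (real \<Rightarrow> real) \<Rightarrow> real" where "Em m \<equiv> pooled \<rho>0 \<rho>1 (Fs m) (Gs m)"
abbreviation E :: "(real \<Rightarrow> real) \<Rightarrow> real" where "E \<equiv> pooled \<rho>0 \<rho>1 F0 G0"
abbreviation U :: "nat \<Rightarrow> real ^ 'q \<Rightarrow> real ^ 'q" where "U m \<equiv> score \<rho>0 \<rho>1 (Fs m) (Gs m) h i1 b"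
abbreviation J :: "real ^ 'q ^ 'q" where "J \<equiv> information \<rho>0 \<rho>1 F0 G0 h i1 b"
abbreviation Jm :: "nat \<Rightarrow> real ^ 'q ^ 'q" where "Jm m \<equiv> information \<rho>0 \<rho>1 (Fs m) (Gs m) h i1 b"

text \<open>Every coordinate of the weight, and every product of two coordinates, is a power of \<open>h\<close> of order at
most 2, so the convergence of weighted integrals applies to it.\<close>

definition wexp :: "'q \<Rightarrow> nat" where "wexp j = (if j = i1 then 0 else 1)"

lemma w_power: "w x $ j = h x ^ wexp j"
  by (simp add: weight_def wexp_def)

lemma wexp_le: "wexp j \<le> 1" by (simp add: wexp_def)

lemma w_disc: "ctble_disc (\<lambda>x. w x $ j)"
  unfolding w_power by (intro ctble_disc_intros F.h_disc)

lemma w_inner_disc: "ctble_disc (\<lambda>x. v \<bullet> w x)"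
  unfolding inner_vec_def by (intro ctble_disc_sum) (auto intro!: ctble_disc_intros w_disc)

lemma logistic_disc: "ctble_disc (\<lambda>x. logistic (b x + v \<bullet> w x))"
  by (intro ctble_disc_compose[where g = logistic] ctble_disc_add b_disc w_inner_disc isCont_logistic)

lemma logistic_b_disc: "ctble_disc (\<lambda>x. logistic (b x))"
  by (intro ctble_disc_compose[where g = logistic] b_disc isCont_logistic)

lemma logistic'_disc: "ctble_disc (\<lambda>x. logistic' (b x))"
  by (intro ctble_disc_compose[where g = logistic'] b_disc isCont_logistic')

lemmas disc = ctble_disc_intros w_disc w_inner_disc logistic_disc logistic_b_disc logistic'_disc F.h_disc

lemma norm_w: assumes "0 < x" shows "norm (w x) \<le> 1 + h x"
proof -
  have "norm (w x) \<le> (\<Sum>j\<in>UNIV. \<bar>w x $ j\<bar>)" by (rule norm_le_l1_cart)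
  also have "\<dots> = \<bar>w x $ i1\<bar> + (\<Sum>j\<in>UNIV - {i1}. \<bar>w x $ j\<bar>)"
    by (rule sum.remove) auto
  also have "(\<Sum>j\<in>UNIV - {i1}. \<bar>w x $ j\<bar>) = (\<Sum>j\<in>UNIV - {i1}. h x)"
    using F.h_nonneg[OF assms] by (intro sum.cong) (auto simp: weight_def)
  also have "\<dots> = real (CARD('q) - 1) * h x" by (simp add: card_Diff_singleton)
  also have "\<dots> \<le> 1 * h x" using q F.h_nonneg[OF assms] by (intro mult_right_mono) auto
  finally show ?thesis by (simp add: weight_def)
qed

lemma inner_w: assumes "0 < x" shows "\<bar>v \<bullet> w x\<bar> \<le> norm v * (1 + h x)"
  using Cauchy_Schwarz_ineq2[of v "w x"] mult_left_mono[OF norm_w[OF assms], of "norm v"] by simp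

lemma m_int: "ctble_disc f \<Longrightarrow> sintegrable (Fs m) f" "ctble_disc f \<Longrightarrow> sintegrable (Gs m) f"
  by (auto intro: fin_df_sintegrable F.fin G.fin)

lemma Em_add: "ctble_disc f \<Longrightarrow> ctble_disc g \<Longrightarrow> Em m (\<lambda>x. f x + g x) = Em m f + Em m g"
  by (simp add: pooled_def stieltjes_add m_int algebra_simps)

lemma Em_diff: "ctble_disc f \<Longrightarrow> ctble_disc g \<Longrightarrow> Em m (\<lambda>x. f x - g x) = Em m f - Em m g"
  by (simp add: pooled_def stieltjes_diff m_int algebra_simps)

lemma Em_mult: "Em m (\<lambda>x. c * f x) = c * Em m f"
  by (simp add: pooled_def stieltjes_mult algebra_simps)

lemma Em_zero: "Em m (\<lambda>x. 0) = 0"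
  by (simp add: pooled_def stieltjes_eq)

lemma Em_sum: "(\<And>i. i \<in> A \<Longrightarrow> ctble_disc (f i)) \<Longrightarrow> Em m (\<lambda>x. \<Sum>i\<in>A. f i x) = (\<Sum>i\<in>A. Em m (f i))"
  by (induction A rule: infinite_finite_induct) (auto simp: Em_zero Em_add ctble_disc_sum)

lemma Em_mono:
  assumes "ctble_disc f" "ctble_disc g" "\<And>x. 0 < x \<Longrightarrow> f x \<le> g x"
  shows "Em m f \<le> Em m g"
  unfolding pooled_def
  by (intro add_mono mult_left_mono stieltjes_mono m_int) (use assms \<rho> in auto)

lemma Em_abs_le:
  assumes "ctble_disc f" "ctble_disc g" "\<And>x. 0 < x \<Longrightarrow> \<bar>f x\<bar> \<le> g x"
  shows "\<bar>Em m f\<bar> \<le> Em m g"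
proof -
  have "Em m f \<le> Em m g"
    by (rule Em_mono[OF assms(1,2)]) (rule abs_le_D1[OF assms(3)])
  moreover have "Em m (\<lambda>x. (-1) * f x) \<le> Em m g"
    by (rule Em_mono[OF ctble_disc_mult[OF ctble_disc_const assms(1)] assms(2)])
       (use abs_le_D2[OF assms(3)] in simp)
  ultimately show ?thesis unfolding Em_mult by simp
qed

lemma Em_tendsto:
  assumes "ctble_disc g" "\<And>x. 0 < x \<Longrightarrow> \<bar>g x\<bar> \<le> B" "k \<le> 2"
  shows "(\<lambda>m. Em m (\<lambda>x. h x ^ k * g x)) \<longlonglongrightarrow> E (\<lambda>x. h x ^ k * g x)"
  unfolding pooled_def
  by (intro tendsto_intros F.stieltjes_tendsto_weighted[OF assms] G.stieltjes_tendsto_weighted[OF assms])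

lemma Em_tendsto_quadratic:
  assumes "ctble_disc g" "\<And>x. 0 < x \<Longrightarrow> \<bar>g x\<bar> \<le> B"
  shows "(\<lambda>m. Em m (\<lambda>x. g x * (w x $ i * w x $ j))) \<longlonglongrightarrow> E (\<lambda>x. g x * (w x $ i * w x $ j))"
proof -
  have "(\<lambda>x. g x * (w x $ i * w x $ j)) = (\<lambda>x. h x ^ (wexp i + wexp j) * g x)"
    by (simp add: w_power power_add algebra_simps)
  then show ?thesis using Em_tendsto[OF assms, of "wexp i + wexp j"] wexp_le[of i] wexp_le[of j] by simp
qed

lemma Em_quadratic_form:
  assumes "ctble_disc g"
  shows "Em m (\<lambda>x. (v \<bullet> w x)\<^sup>2 * g x) = v \<bullet> ((\<chi> i j. Em m (\<lambda>x. g x * (w x $ i * w x $ j))) *v v)"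
proof -
  have "(\<lambda>x. (v \<bullet> w x)\<^sup>2 * g x) = (\<lambda>x. \<Sum>i\<in>UNIV. \<Sum>j\<in>UNIV. (v $ i * v $ j) * (g x * (w x $ i * w x $ j)))"
    by (simp add: inner_vec_def power2_eq_square sum_product sum_distrib_right sum_distrib_left algebra_simps)
  then have "Em m (\<lambda>x. (v \<bullet> w x)\<^sup>2 * g x) = (\<Sum>i\<in>UNIV. \<Sum>j\<in>UNIV. Em m (\<lambda>x. (v $ i * v $ j) * (g x * (w x $ i * w x $ j))))"
    by (simp add: Em_sum ctble_disc_sum disc assms)
  also have "\<dots> = (\<Sum>i\<in>UNIV. \<Sum>j\<in>UNIV. (v $ i * v $ j) * Em m (\<lambda>x. g x * (w x $ i * w x $ j)))"
    by (simp only: Em_mult)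
  also have "\<dots> = v \<bullet> ((\<chi> i j. Em m (\<lambda>x. g x * (w x $ i * w x $ j))) *v v)"
    by (simp add: inner_vec_def matrix_vector_mult_def sum_distrib_left algebra_simps)
  finally show ?thesis .
qed

lemma quad_sintegrable:
  assumes "ctble_disc g" "\<And>x. 0 < x \<Longrightarrow> \<bar>g x\<bar> \<le> B"
  shows "sintegrable F0 (\<lambda>x. g x * (w x $ i * w x $ j))" "sintegrable G0 (\<lambda>x. g x * (w x $ i * w x $ j))"
proof -
  have "(\<lambda>x. g x * (w x $ i * w x $ j)) = (\<lambda>x. h x ^ (wexp i + wexp j) * g x)"
    by (simp add: w_power power_add algebra_simps)
  then show "sintegrable F0 (\<lambda>x. g x * (w x $ i * w x $ j))" "sintegrable G0 (\<lambda>x. g x * (w x $ i * w x $ j))"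
    using F.sintegrable_weighted[OF assms, of "wexp i + wexp j"] G.sintegrable_weighted[OF assms, of "wexp i + wexp j"]
      wexp_le[of i] wexp_le[of j] by simp_all
qed

text \<open>A quadratic form that vanishes makes \<open>(v \<bullet> w x)\<^sup>2 * g x\<close> vanish almost everywhere, and then
\<open>v \<bullet> w x = 0\<close> almost everywhere because \<open>g\<close> is positive.\<close>

lemma quadratic_pos:
  assumes g: "ctble_disc g" "\<And>x. 0 < x \<Longrightarrow> \<bar>g x\<bar> \<le> B" and gpos: "\<And>x. 0 < x \<Longrightarrow> 0 < g x" and v: "v \<noteq> 0"
  shows "0 < v \<bullet> ((\<chi> i j. E (\<lambda>x. g x * (w x $ i * w x $ j))) *v v)"
proof -
  have eq: "(\<lambda>x. \<Sum>i\<in>UNIV. \<Sum>j\<in>UNIV. (v $ i * v $ j) * (g x * (w x $ i * w x $ j))) = (\<lambda>x. (v \<bullet> w x)\<^sup>2 * g x)"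
    by (simp add: inner_vec_def power2_eq_square sum_product sum_distrib_right sum_distrib_left algebra_simps)
  have *: "sintegrable H (\<lambda>x. (v \<bullet> w x)\<^sup>2 * g x) \<and> stieltjes H (\<lambda>x. (v \<bullet> w x)\<^sup>2 * g x) =
      (\<Sum>i\<in>UNIV. \<Sum>j\<in>UNIV. (v $ i * v $ j) * stieltjes H (\<lambda>x. g x * (w x $ i * w x $ j)))"
    if H: "\<And>i j. sintegrable H (\<lambda>x. g x * (w x $ i * w x $ j))" for H
  proof -
    have 1: "sintegrable H (\<lambda>x. (v $ i * v $ j) * (g x * (w x $ i * w x $ j)))" for i j
      by (intro set_integrable_mult_right) (simp add: H)
    have 2: "sintegrable H (\<lambda>x. \<Sum>j\<in>UNIV. (v $ i * v $ j) * (g x * (w x $ i * w x $ j)))" for i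
      using stieltjes_sum[of UNIV H "\<lambda>j x. (v $ i * v $ j) * (g x * (w x $ i * w x $ j))"] 1 by blast
    show ?thesis
      using stieltjes_sum[of UNIV H "\<lambda>i x. \<Sum>j\<in>UNIV. (v $ i * v $ j) * (g x * (w x $ i * w x $ j))"]
        stieltjes_sum[of UNIV H "\<lambda>j x. (v $ i * v $ j) * (g x * (w x $ i * w x $ j))" for i] 1 2
      unfolding eq by (simp add: stieltjes_mult)
  qed
  note FF = *[OF quad_sintegrable(1)[OF g]] and GG = *[OF quad_sintegrable(2)[OF g]]
  let ?S = "\<lambda>H. \<Sum>i\<in>UNIV. \<Sum>j\<in>UNIV. (v $ i * v $ j) * stieltjes H (\<lambda>x. g x * (w x $ i * w x $ j))"
  have "v \<bullet> ((\<chi> i j. E (\<lambda>x. g x * (w x $ i * w x $ j))) *v v)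
      = (\<Sum>i\<in>UNIV. \<Sum>j\<in>UNIV. (v $ i * v $ j) * E (\<lambda>x. g x * (w x $ i * w x $ j)))"
    by (simp add: inner_vec_def matrix_vector_mult_def sum_distrib_left algebra_simps)
  also have "\<dots> = \<rho>0 * ?S F0 + \<rho>1 * ?S G0"
    unfolding pooled_def by (simp add: sum_distrib_left sum.distrib[symmetric] algebra_simps)
  also have "?S F0 = stieltjes F0 (\<lambda>x. (v \<bullet> w x)\<^sup>2 * g x)" using FF by simp
  also have "?S G0 = stieltjes G0 (\<lambda>x. (v \<bullet> w x)\<^sup>2 * g x)" using GG by simp
  finally have "v \<bullet> ((\<chi> i j. E (\<lambda>x. g x * (w x $ i * w x $ j))) *v v)
      = \<rho>0 * stieltjes F0 (\<lambda>x. (v \<bullet> w x)\<^sup>2 * g x) + \<rho>1 * stieltjes G0 (\<lambda>x. (v \<bullet> w x)\<^sup>2 * g x)" .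
  moreover have "0 \<le> stieltjes G0 (\<lambda>x. (v \<bullet> w x)\<^sup>2 * g x)"
    by (rule stieltjes_nonneg) (use gpos in \<open>simp add: less_imp_le\<close>)
  moreover have "0 \<le> stieltjes F0 (\<lambda>x. (v \<bullet> w x)\<^sup>2 * g x)"
    by (rule stieltjes_nonneg) (use gpos in \<open>simp add: less_imp_le\<close>)
  moreover have "stieltjes F0 (\<lambda>x. (v \<bullet> w x)\<^sup>2 * g x) \<noteq> 0"
  proof
    assume "stieltjes F0 (\<lambda>x. (v \<bullet> w x)\<^sup>2 * g x) = 0"
    moreover have "integrable (interval_measure F0) (\<lambda>x. indicator {0<..} x * ((v \<bullet> w x)\<^sup>2 * g x))"
      using FF by (simp add: set_integrable_def)
    moreover have "AE x in interval_measure F0. 0 \<le> indicator {0<..} x * ((v \<bullet> w x)\<^sup>2 * g x)"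
      using gpos by (auto simp: indicator_def less_imp_le)
    ultimately have "AE x in interval_measure F0. indicator {0<..} x * ((v \<bullet> w x)\<^sup>2 * g x) = 0"
      using integral_nonneg_eq_0_iff_AE[of "interval_measure F0" "\<lambda>x. indicator {0<..} x * ((v \<bullet> w x)\<^sup>2 * g x)"]
      unfolding stieltjes_eq by blast
    with F.F0_AE_pos have "AE x in interval_measure F0. v \<bullet> w x = 0"
    proof eventually_elim
      case (elim x)
      then show ?case using gpos[of x] by auto
    qed
    then show False using nondegenerate v by blast
  qed
  ultimately show ?thesis using \<rho> by (simp add: add_pos_nonneg)
qed

lemma J_pos: "v \<noteq> 0 \<Longrightarrow> 0 < v \<bullet> (J *v v)"
  unfolding information_def
  by (rule quadratic_pos[where B = 1]) (use logistic'_le_1 logistic'_pos in \<open>auto simp: disc less_imp_le\<close>)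

lemma inner_score_diff:
  "v \<bullet> (U m \<eta> - U m 0) = Em m (\<lambda>x. (v \<bullet> w x) * (logistic (b x + \<eta> \<bullet> w x) - logistic (b x)))"
proof -
  have eq: "(\<lambda>x. (v \<bullet> w x) * (logistic (b x + \<eta> \<bullet> w x) - logistic (b x)))
    = (\<lambda>x. \<Sum>j\<in>UNIV. v $ j * (w x $ j * logistic (b x + \<eta> \<bullet> w x) - w x $ j * logistic (b x)))"
    by (simp only: inner_vec_def[of v] inner_real_def sum_distrib_right)
       (intro ext sum.cong refl, simp add: algebra_simps)
  have "v \<bullet> (U m \<eta> - U m 0) = (\<Sum>j\<in>UNIV. v $ j *
      (Em m (\<lambda>x. w x $ j * logistic (b x + \<eta> \<bullet> w x)) - Em m (\<lambda>x. w x $ j * logistic (b x))))"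
    by (simp add: inner_vec_def[of v] score_def)
  also have "\<dots> = (\<Sum>j\<in>UNIV. Em m (\<lambda>x. v $ j * (w x $ j * logistic (b x + \<eta> \<bullet> w x) - w x $ j * logistic (b x))))"
    unfolding Em_mult by (intro sum.cong refl arg_cong2[of _ _ _ _ times] Em_diff[symmetric] disc)
  also have "\<dots> = Em m (\<lambda>x. \<Sum>j\<in>UNIV. v $ j * (w x $ j * logistic (b x + \<eta> \<bullet> w x) - w x $ j * logistic (b x)))"
    by (intro Em_sum[symmetric] disc)
  finally show ?thesis unfolding eq .
qed

text \<open>The limit of the score at \<open>0\<close> is the fitted mean minus the label mean in a correctly
specified model; \<open>link\<close> is exactly the statement that the two agree.\<close>

lemma score0_tendsto: "(\<lambda>m. U m 0) \<longlonglongrightarrow> 0"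
proof (rule vec_tendstoI)
  fix j
  have bd: "\<bar>logistic (b x)\<bar> \<le> 1" for x using logistic_pos[of "b x"] logistic_less_1[of "b x"] by simp
  have "(\<lambda>m. Em m (\<lambda>x. h x ^ wexp j * logistic (b x)) - \<rho>1 * stieltjes (Gs m) (\<lambda>x. h x ^ wexp j))
      \<longlonglongrightarrow> E (\<lambda>x. h x ^ wexp j * logistic (b x)) - \<rho>1 * stieltjes G0 (\<lambda>x. h x ^ wexp j)"
    using wexp_le[of j]
    by (intro tendsto_intros Em_tendsto[OF logistic_b_disc bd] G.h_power_tendsto) auto
  moreover have "E (\<lambda>x. h x ^ wexp j * logistic (b x)) - \<rho>1 * stieltjes G0 (\<lambda>x. h x ^ wexp j) = 0"
  proof -
    have "stieltjes G0 (\<lambda>x. (1 - logistic (b x)) * h x ^ wexp j) = stieltjes G0 (\<lambda>x. h x ^ wexp j - h x ^ wexp j * logistic (b x))"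
      by (simp add: algebra_simps)
    also have "\<dots> = stieltjes G0 (\<lambda>x. h x ^ wexp j) - stieltjes G0 (\<lambda>x. h x ^ wexp j * logistic (b x))"
      using wexp_le[of j]
      by (intro stieltjes_diff G.h_power_sintegrable G.sintegrable_weighted[OF logistic_b_disc bd]) auto
    finally have "stieltjes G0 (\<lambda>x. (1 - logistic (b x)) * h x ^ wexp j) =
        stieltjes G0 (\<lambda>x. h x ^ wexp j) - stieltjes G0 (\<lambda>x. h x ^ wexp j * logistic (b x))" .
    with link[of "\<lambda>x. h x ^ wexp j"]
    have "\<rho>1 * (stieltjes G0 (\<lambda>x. h x ^ wexp j) - stieltjes G0 (\<lambda>x. h x ^ wexp j * logistic (b x)))
        = \<rho>0 * stieltjes F0 (\<lambda>x. h x ^ wexp j * logistic (b x))"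
      by (simp add: disc mult.commute)
    then show ?thesis by (simp add: pooled_def right_diff_distrib)
  qed
  ultimately show "(\<lambda>m. U m 0 $ j) \<longlonglongrightarrow> 0 $ j"
    by (simp add: score_def w_power)
qed

text \<open>Monotonicity in quantitative form. At a root, \<open>- \<eta> \<bullet> U m 0\<close> is the mean of
\<open>(\<eta> \<bullet> w x) * (logistic (b x + \<eta> \<bullet> w x) - logistic (b x))\<close>, which the global increment bound
estimates from below by the quadratic form with the weight \<open>logistic' (b x) * exp (- (1 + h x))\<close>,
divided by \<open>max 1 (norm \<eta>)\<close>. That form is uniformly positive definite for large \<open>m\<close>. The estimate
holds for roots of any size and thereby keeps them from escaping to infinity.\<close>

lemma coercive:
  "\<exists>c>0. \<forall>\<^sub>F m in sequentially. \<forall>\<eta>. U m \<eta> = 0 \<longrightarrow> c * min 1 (norm \<eta>) \<le> norm (U m 0)"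
proof -
  let ?g = "\<lambda>x. logistic' (b x) * exp (- (1 + h x))"
  have g: "ctble_disc ?g"
    by (intro disc ctble_disc_compose[where g = "\<lambda>u. exp (- (1 + u))"]) (auto intro!: continuous_intros)
  have gb: "\<bar>?g x\<bar> \<le> 1" "0 < ?g x" if "0 < x" for x
    using logistic'_pos[of "b x"] logistic'_le_1[of "b x"] F.h_nonneg[OF that] by (auto simp: abs_mult intro!: mult_le_one)
  have cv: "(\<lambda>m. (\<chi> i j. Em m (\<lambda>x. ?g x * (w x $ i * w x $ j))) $ i $ j) \<longlonglongrightarrow> (\<chi> i j. E (\<lambda>x. ?g x * (w x $ i * w x $ j))) $ i $ j" for i j
    using Em_tendsto_quadratic[OF g gb(1)] by simp
  have "\<exists>c>0. \<forall>\<^sub>F m in sequentially. \<forall>v. c * (norm v)\<^sup>2 \<le> v \<bullet> ((\<chi> i j. Em m (\<lambda>x. ?g x * (w x $ i * w x $ j))) *v v)"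
    by (rule posdef_limit_lower[OF cv quadratic_pos[OF g gb]])
  then obtain c where c: "c > 0" and ev:
    "\<forall>\<^sub>F m in sequentially. \<forall>v. c * (norm v)\<^sup>2 \<le> Em m (\<lambda>x. (v \<bullet> w x)\<^sup>2 * ?g x)"
    unfolding Em_quadratic_form[OF g, symmetric] by blast
  from ev have "\<forall>\<^sub>F m in sequentially. \<forall>\<eta>. U m \<eta> = 0 \<longrightarrow> c * min 1 (norm \<eta>) \<le> norm (U m 0)"
  proof eventually_elim
    case (elim m)
    show ?case
    proof (intro allI impI)
      fix \<eta> assume \<eta>: "U m \<eta> = 0"
      let ?t = "norm \<eta>"
      show "c * min 1 (norm \<eta>) \<le> norm (U m 0)"
      proof (cases "\<eta> = 0")
        case False
        have "(c / max 1 ?t) * ?t\<^sup>2 \<le> (1 / max 1 ?t) * Em m (\<lambda>x. (\<eta> \<bullet> w x)\<^sup>2 * ?g x)"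
          using elim[rule_format, of \<eta>] by (simp add: divide_right_mono)
        also have "\<dots> = Em m (\<lambda>x. (1 / max 1 ?t) * ((\<eta> \<bullet> w x)\<^sup>2 * ?g x))" by (rule Em_mult[symmetric])
        also have "\<dots> \<le> Em m (\<lambda>x. (\<eta> \<bullet> w x) * (logistic (b x + \<eta> \<bullet> w x) - logistic (b x)))"
        proof (rule Em_mono)
          fix x :: real assume x: "0 < x"
          show "(1 / max 1 ?t) * ((\<eta> \<bullet> w x)\<^sup>2 * ?g x) \<le> (\<eta> \<bullet> w x) * (logistic (b x + \<eta> \<bullet> w x) - logistic (b x))"
            using logistic_increment_lower_global[of ?t "1 + h x" "\<eta> \<bullet> w x" "b x"] F.h_nonneg[OF x] inner_w[OF x, of \<eta>]
            by simp
        qed (intro disc g)+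
        also have "\<dots> = - (\<eta> \<bullet> U m 0)" by (simp add: inner_score_diff[symmetric] \<eta>)
        also have "\<dots> \<le> ?t * norm (U m 0)" using Cauchy_Schwarz_ineq2[of \<eta> "U m 0"] by linarith
        finally have "?t * ((c / max 1 ?t) * ?t) \<le> ?t * norm (U m 0)" by (simp add: power2_eq_square algebra_simps)
        then have "(c / max 1 ?t) * ?t \<le> norm (U m 0)"
          by (rule mult_left_le_imp_le) (use False in simp)
        moreover have "(c / max 1 ?t) * ?t = c * min 1 ?t" by (auto simp: max_def min_def)
        ultimately show ?thesis by simp
      qed simp
    qed
  qed
  with c show ?thesis by blast
qed

lemma cubic_moment_bound: "\<exists>K>0. \<forall>\<^sub>F m in sequentially. Em m (\<lambda>x. (1 + h x) ^ 3) \<le> K"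
proof -
  have eq: "(\<lambda>x. (1 + h x) ^ 3) = (\<lambda>x. h x ^ 0 + (3 * h x ^ 1 + (3 * h x ^ 2 + h x ^ 3)))"
    by (simp add: power3_eq_cube power2_eq_square algebra_simps)
  have "(\<lambda>m. Em m (\<lambda>x. (1 + h x) ^ 3)) = (\<lambda>m. Em m (\<lambda>x. h x ^ 0) + (3 * Em m (\<lambda>x. h x ^ 1) + (3 * Em m (\<lambda>x. h x ^ 2) + Em m (\<lambda>x. h x ^ 3))))"
    unfolding eq by (intro ext) (simp only: Em_add Em_mult disc)
  moreover have T: "(\<lambda>m. Em m (\<lambda>x. h x ^ k)) \<longlonglongrightarrow> E (\<lambda>x. h x ^ k)" if "k \<le> 3" for k
    unfolding pooled_def by (intro tendsto_intros F.h_power_tendsto G.h_power_tendsto that)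
  have "(\<lambda>m. Em m (\<lambda>x. h x ^ 0) + (3 * Em m (\<lambda>x. h x ^ 1) + (3 * Em m (\<lambda>x. h x ^ 2) + Em m (\<lambda>x. h x ^ 3))))
     \<longlonglongrightarrow> E (\<lambda>x. h x ^ 0) + (3 * E (\<lambda>x. h x ^ 1) + (3 * E (\<lambda>x. h x ^ 2) + E (\<lambda>x. h x ^ 3)))"
    by (intro tendsto_add tendsto_mult tendsto_const T) simp_all
  ultimately obtain L where L: "(\<lambda>m. Em m (\<lambda>x. (1 + h x) ^ 3)) \<longlonglongrightarrow> L" by auto
  then have "\<forall>\<^sub>F m in sequentially. Em m (\<lambda>x. (1 + h x) ^ 3) < \<bar>L\<bar> + 1"
    by (rule order_tendstoD(2)) auto
  then show ?thesis by (intro exI[of _ "\<bar>L\<bar> + 1"]) (auto elim: eventually_mono)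
qed

text \<open>The second-order remainder of the logistic function, times one more factor \<open>w x $ j\<close>, is
cubic in \<open>1 + h x\<close>; this is where the third moments enter.\<close>

lemma linearization:
  assumes "U m \<eta> = 0"
  shows "norm (Jm m *v \<eta> + U m 0) \<le> real CARD('q) * (norm \<eta>)\<^sup>2 * Em m (\<lambda>x. (1 + h x) ^ 3)"
proof -
  have "\<bar>(Jm m *v \<eta> + U m 0) $ j\<bar> \<le> (norm \<eta>)\<^sup>2 * Em m (\<lambda>x. (1 + h x) ^ 3)" for j
  proof -
    let ?d = "\<lambda>x. w x $ j * (logistic (b x + \<eta> \<bullet> w x) - logistic (b x))"
    let ?l = "\<lambda>x. w x $ j * ((\<eta> \<bullet> w x) * logistic' (b x))"
    have "(Jm m *v \<eta>) $ j = (\<Sum>k\<in>UNIV. \<eta> $ k * Em m (\<lambda>x. logistic' (b x) * (w x $ j * w x $ k)))"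
      by (simp add: matrix_vector_mult_def information_def mult.commute)
    also have "\<dots> = Em m (\<lambda>x. \<Sum>k\<in>UNIV. \<eta> $ k * (logistic' (b x) * (w x $ j * w x $ k)))"
      by (subst Em_sum) (auto simp: Em_mult intro!: disc)
    also have "(\<lambda>x. \<Sum>k\<in>UNIV. \<eta> $ k * (logistic' (b x) * (w x $ j * w x $ k))) = ?l"
      by (simp add: inner_vec_def sum_distrib_left sum_distrib_right algebra_simps)
    finally have 1: "(Jm m *v \<eta>) $ j = Em m ?l" .
    have "axis j 1 \<bullet> (U m \<eta> - U m 0) = Em m (\<lambda>x. (axis j 1 \<bullet> w x) * (logistic (b x + \<eta> \<bullet> w x) - logistic (b x)))"
      by (rule inner_score_diff)
    then have 2: "U m 0 $ j = - Em m ?d" using assms by (simp add: inner_axis')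
    have "\<bar>(Jm m *v \<eta> + U m 0) $ j\<bar> = \<bar>Em m (\<lambda>x. ?l x - ?d x)\<bar>"
      using 1 2 by (subst Em_diff) (auto intro!: disc)
    also have "\<dots> \<le> Em m (\<lambda>x. (norm \<eta>)\<^sup>2 * (1 + h x) ^ 3)"
    proof (rule Em_abs_le)
      fix x :: real assume x: "0 < x"
      have h0: "0 \<le> h x" by (rule F.h_nonneg[OF x])
      have "\<bar>?l x - ?d x\<bar> = \<bar>w x $ j\<bar> * \<bar>logistic (b x + \<eta> \<bullet> w x) - logistic (b x) - (\<eta> \<bullet> w x) * logistic' (b x)\<bar>"
        unfolding abs_mult[symmetric] by (simp add: abs_minus_commute algebra_simps)
      also have "\<dots> \<le> (1 + h x) * (norm \<eta> * (1 + h x))\<^sup>2"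
      proof (intro mult_mono)
        show "\<bar>w x $ j\<bar> \<le> 1 + h x" using component_le_norm_cart[of "w x" j] norm_w[OF x] by linarith
        have "(\<eta> \<bullet> w x)\<^sup>2 \<le> (norm \<eta> * (1 + h x))\<^sup>2"
          using power_mono[OF inner_w[OF x, of \<eta>], of 2] by simp
        then show "\<bar>logistic (b x + \<eta> \<bullet> w x) - logistic (b x) - (\<eta> \<bullet> w x) * logistic' (b x)\<bar> \<le> (norm \<eta> * (1 + h x))\<^sup>2"
          using logistic_second_order[of "b x" "\<eta> \<bullet> w x"] by linarith
      qed (use h0 in auto)
      also have "\<dots> = (norm \<eta>)\<^sup>2 * (1 + h x) ^ 3" by (simp add: power2_eq_square power3_eq_cube)
      finally show "\<bar>?l x - ?d x\<bar> \<le> (norm \<eta>)\<^sup>2 * (1 + h x) ^ 3" .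
    qed (intro disc)+
    also have "\<dots> = (norm \<eta>)\<^sup>2 * Em m (\<lambda>x. (1 + h x) ^ 3)" by (rule Em_mult)
    finally show ?thesis .
  qed
  then have "(\<Sum>j\<in>UNIV. \<bar>(Jm m *v \<eta> + U m 0) $ j\<bar>) \<le> (\<Sum>j\<in>(UNIV::'q set). (norm \<eta>)\<^sup>2 * Em m (\<lambda>x. (1 + h x) ^ 3))"
    by (intro sum_mono) auto
  then show ?thesis using norm_le_l1_cart[of "Jm m *v \<eta> + U m 0"] by simp
qed

text \<open>Once \<open>norm (U m 0)\<close> is below the constant of the coercivity estimate, the minimum in that estimate is
\<open>norm (\<eta> m)\<close>. So the root is of the order of \<open>U m 0\<close>, which tends to 0, and both the quadratic
remainder and the replacement of the empirical information by its limit cost only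
\<open>o(norm (U m 0))\<close>. An error stated relative to \<open>U m 0\<close> can be established path by path and
still survives the multiplication by \<open>sqrt n\<close>.\<close>

theorem score_root_expansion:
  assumes root: "\<forall>\<^sub>F m in sequentially. U m (\<eta> m) = 0"
  shows "\<eta> \<longlonglongrightarrow> 0"
    and "\<exists>C. \<forall>\<^sub>F m in sequentially. norm (\<eta> m) \<le> C * norm (U m 0)"
    and "\<exists>\<epsilon>. \<epsilon> \<longlonglongrightarrow> 0 \<and> (\<forall>\<^sub>F m in sequentially. norm (J *v \<eta> m + U m 0) \<le> \<epsilon> m * norm (U m 0))"
proof -
  obtain c where c: "c > 0" and co: "\<forall>\<^sub>F m in sequentially. \<forall>\<eta>. U m \<eta> = 0 \<longrightarrow> c * min 1 (norm \<eta>) \<le> norm (U m 0)"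
    using coercive by blast
  have U0: "(\<lambda>m. norm (U m 0)) \<longlonglongrightarrow> 0" using score0_tendsto by (rule tendsto_norm_zero)
  then have "\<forall>\<^sub>F m in sequentially. norm (U m 0) < c" using c by (rule order_tendstoD(2))
  with co root have bnd: "\<forall>\<^sub>F m in sequentially. norm (\<eta> m) \<le> (1 / c) * norm (U m 0)"
  proof eventually_elim
    case (elim m)
    then have le: "c * min 1 (norm (\<eta> m)) \<le> norm (U m 0)" by blast
    then have "c * min 1 (norm (\<eta> m)) < c * 1" using elim(3) by linarith
    then have "min 1 (norm (\<eta> m)) < 1" using c by (simp only: mult_less_cancel_left_pos)
    then have "min 1 (norm (\<eta> m)) = norm (\<eta> m)" by (auto simp: min_def split: if_splits)
    with le c show ?case by (simp add: field_simps)
  qed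
  then show "\<exists>C. \<forall>\<^sub>F m in sequentially. norm (\<eta> m) \<le> C * norm (U m 0)" by blast
  have "(\<lambda>m. (1 / c) * norm (U m 0)) \<longlonglongrightarrow> (1 / c) * 0" by (intro tendsto_intros U0)
  then have "(\<lambda>m. (1 / c) * norm (U m 0)) \<longlonglongrightarrow> 0" by simp
  from Lim_null_comparison[OF bnd this] show \<eta>0: "\<eta> \<longlonglongrightarrow> 0" .
  obtain K where K: "K > 0" and evK: "\<forall>\<^sub>F m in sequentially. Em m (\<lambda>x. (1 + h x) ^ 3) \<le> K"
    using cubic_moment_bound by blast
  let ?D = "\<lambda>m. \<Sum>i\<in>UNIV. \<Sum>j\<in>UNIV. \<bar>J $ i $ j - Jm m $ i $ j\<bar>"
  define \<epsilon> where "\<epsilon> m = (real CARD('q) * norm (\<eta> m) * K + ?D m) * (1 / c)" for m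
  have Jc: "(\<lambda>m. Jm m $ i $ j) \<longlonglongrightarrow> J $ i $ j" for i j
    using Em_tendsto_quadratic[OF logistic'_disc, of 1] logistic'_le_1 logistic'_pos
    by (simp add: information_def less_imp_le)
  have "\<epsilon> \<longlonglongrightarrow> (real CARD('q) * norm (0::real^'q) * K + (\<Sum>i\<in>(UNIV::'q set). \<Sum>j\<in>(UNIV::'q set). \<bar>J $ i $ j - J $ i $ j\<bar>)) * (1 / c)"
    unfolding \<epsilon>_def[abs_def] by (intro tendsto_intros \<eta>0 Jc)
  then have "\<epsilon> \<longlonglongrightarrow> 0" by simp
  moreover have "\<forall>\<^sub>F m in sequentially. norm (J *v \<eta> m + U m 0) \<le> \<epsilon> m * norm (U m 0)"
    using bnd evK root
  proof eventually_elim
    case (elim m)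
    have "norm ((J - Jm m) *v \<eta> m) \<le> ?D m * norm (\<eta> m)"
    proof -
      have "norm ((J - Jm m) *v \<eta> m) \<le> (\<Sum>i\<in>UNIV. \<bar>((J - Jm m) *v \<eta> m) $ i\<bar>)" by (rule norm_le_l1_cart)
      also have "\<dots> \<le> (\<Sum>i\<in>UNIV. \<Sum>j\<in>UNIV. \<bar>J $ i $ j - Jm m $ i $ j\<bar> * norm (\<eta> m))"
      proof (intro sum_mono)
        fix i
        have "\<bar>((J - Jm m) *v \<eta> m) $ i\<bar> \<le> (\<Sum>j\<in>UNIV. \<bar>(J - Jm m) $ i $ j * \<eta> m $ j\<bar>)"
          unfolding matrix_vector_mult_def by simp
        also have "\<dots> \<le> (\<Sum>j\<in>UNIV. \<bar>J $ i $ j - Jm m $ i $ j\<bar> * norm (\<eta> m))"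
          by (intro sum_mono) (auto simp: abs_mult intro!: mult_left_mono component_le_norm_cart)
        finally show "\<bar>((J - Jm m) *v \<eta> m) $ i\<bar> \<le> (\<Sum>j\<in>UNIV. \<bar>J $ i $ j - Jm m $ i $ j\<bar> * norm (\<eta> m))" .
      qed
      finally show ?thesis by (simp add: sum_distrib_right)
    qed
    moreover have split: "J *v \<eta> m + U m 0 = (J - Jm m) *v \<eta> m + (Jm m *v \<eta> m + U m 0)"
      by (simp add: matrix_vector_mult_diff_rdistrib)
    ultimately have "norm (J *v \<eta> m + U m 0) \<le> ?D m * norm (\<eta> m) + real CARD('q) * (norm (\<eta> m))\<^sup>2 * Em m (\<lambda>x. (1 + h x) ^ 3)"
      using linearization[OF elim(3)] unfolding split
      by - (rule order_trans[OF norm_triangle_ineq add_mono], assumption+)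
    also have "\<dots> \<le> ?D m * norm (\<eta> m) + real CARD('q) * (norm (\<eta> m))\<^sup>2 * K"
      using elim(2) by (intro add_left_mono mult_left_mono) auto
    also have "\<dots> = (real CARD('q) * norm (\<eta> m) * K + ?D m) * norm (\<eta> m)"
      by (simp add: power2_eq_square algebra_simps)
    also have "\<dots> \<le> (real CARD('q) * norm (\<eta> m) * K + ?D m) * ((1 / c) * norm (U m 0))"
      using K by (intro mult_left_mono elim(1) add_nonneg_nonneg sum_nonneg) auto
    finally show ?case unfolding \<epsilon>_def by (simp only: mult.assoc)
  qed
  ultimately show "\<exists>\<epsilon>. \<epsilon> \<longlonglongrightarrow> 0 \<and> (\<forall>\<^sub>F m in sequentially. norm (J *v \<eta> m + U m 0) \<le> \<epsilon> m * norm (U m 0))"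
    by blast
qed

definition baseline_df :: "nat \<Rightarrow> real ^ 'q \<Rightarrow> real \<Rightarrow> real" where
  "baseline_df m \<eta> t = Em m (\<lambda>x. indicator {..t} x * (1 - logistic (b x + \<eta> \<bullet> w x))) / \<rho>0"

text \<open>A point at \<open>x\<close> of the pooled sample is weighted with its probability of belonging to the first sample.
This takes the share \<open>logistic (b x)\<close> away from \<open>F0\<close>, and by \<open>link\<close> what is left of \<open>G0\<close> returns
exactly that share.\<close>

lemma baseline_df_limit:
  "E (\<lambda>x. indicator {..t} x * (1 - logistic (b x))) / \<rho>0 = stieltjes F0 (indicator {..t})"
proof -
  have bd: "\<bar>indicator {..t} x * (1 - logistic (b x))\<bar> \<le> 1" "\<bar>indicator {..t} x * logistic (b x)\<bar> \<le> 1" for x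
    by (intro abs_indicator_mult_le_1 logistic_bounds)+
  have "E (\<lambda>x. indicator {..t} x * (1 - logistic (b x))) =
      \<rho>0 * stieltjes F0 (\<lambda>x. indicator {..t} x * (1 - logistic (b x))) + \<rho>1 * stieltjes G0 (\<lambda>x. (1 - logistic (b x)) * indicator {..t} x)"
    unfolding pooled_def by (simp only: mult.commute[of "indicator {..t} _" "1 - logistic _"])
  also have "\<dots> = \<rho>0 * (stieltjes F0 (\<lambda>x. indicator {..t} x * (1 - logistic (b x))) + stieltjes F0 (\<lambda>x. indicator {..t} x * logistic (b x)))"
    unfolding link[OF ctble_disc_atMost] by (simp only: distrib_left mult.commute[of "indicator {..t} _" "logistic _"])
  also have "stieltjes F0 (\<lambda>x. indicator {..t} x * (1 - logistic (b x))) + stieltjes F0 (\<lambda>x. indicator {..t} x * logistic (b x)) = stieltjes F0 (indicator {..t})"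
  proof (subst stieltjes_add[symmetric])
    have "ctble_disc (\<lambda>x. indicator {..t} x * (1 - logistic (b x)))" "ctble_disc (\<lambda>x. indicator {..t} x * logistic (b x))"
      by (intro disc ctble_disc_atMost)+
    from this(1)[THEN F.sintegrable_weighted, OF bd(1), of 0] this(2)[THEN F.sintegrable_weighted, OF bd(2), of 0]
    show "sintegrable F0 (\<lambda>x. indicator {..t} x * (1 - logistic (b x)))" "sintegrable F0 (\<lambda>x. indicator {..t} x * logistic (b x))"
      by simp_all
    show "stieltjes F0 (\<lambda>x. indicator {..t} x * (1 - logistic (b x)) + indicator {..t} x * logistic (b x)) = stieltjes F0 (indicator {..t})"
      by (rule stieltjes_cong) (simp add: algebra_simps)
  qed
  finally show ?thesis using \<rho> by simp
qed

lemma stieltjes_F0_Iic: assumes "0 \<le> t" shows "stieltjes F0 (indicator {..t}) = F0 t"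
proof -
  interpret real_distribution "interval_measure F0" by (rule F.F0_real_distribution)
  have "stieltjes F0 (indicator {..t}) = (LINT x|interval_measure F0. indicator {0<..t} x)"
    unfolding stieltjes_eq by (rule Bochner_Integration.integral_cong) (auto simp: indicator_def)
  also have "\<dots> = measure (interval_measure F0) {0<..t}" by simp
  also have "\<dots> = F0 t - F0 0"
    using assms monoD[OF F.F0_mono] F.F0_cont
    by (intro measure_interval_measure_Ioc) (auto intro: continuous_at_imp_continuous_at_within)
  finally show ?thesis using F.F0_zero[of 0] by simp
qed

text \<open>At \<open>\<eta> = 0\<close> the estimator is monotone in \<open>t\<close> and converges pointwise, so Polya's theorem applies; its
total mass \<open>c m\<close> tends to 1. Passing from \<open>0\<close> to \<open>\<eta> m\<close> costs at most \<open>norm (\<eta> m)\<close> times a moment,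
uniformly in \<open>t\<close>, as the logistic function is Lipschitz.\<close>

theorem baseline_df_uniform:
  assumes \<eta>: "\<eta> \<longlonglongrightarrow> 0" and e: "0 < e"
  shows "\<forall>\<^sub>F m in sequentially. \<forall>t\<ge>0. \<bar>baseline_df m (\<eta> m) t - F0 t\<bar> < e"
proof -
  note l = logistic_bounds
  have bd: "\<bar>indicator {..t} x * (1 - logistic (b x))\<bar> \<le> 1" for x t
    by (intro abs_indicator_mult_le_1 l)
  have 1: "\<forall>\<^sub>F m in sequentially. \<forall>t\<ge>0. \<bar>baseline_df m 0 t - F0 t\<bar> < e / 2"
  proof (rule Polya_uniform[where c = "\<lambda>m. Em m (\<lambda>x. 1 - logistic (b x)) / \<rho>0"])
    show "baseline_df m 0 s \<le> baseline_df m 0 t" if "s \<le> t" for m s t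
      unfolding baseline_df_def using \<rho> that
      by (intro divide_right_mono Em_mono disc ctble_disc_atMost)
         (auto simp: l split: split_indicator)
    show "baseline_df m 0 t \<le> Em m (\<lambda>x. 1 - logistic (b x)) / \<rho>0" for m t
      unfolding baseline_df_def using \<rho> by (intro divide_right_mono Em_mono disc ctble_disc_atMost) (auto simp: l split: split_indicator)
    have "(\<lambda>m. Em m (\<lambda>x. h x ^ 0 * (1 - logistic (b x))) / \<rho>0) \<longlonglongrightarrow> E (\<lambda>x. h x ^ 0 * (1 - logistic (b x))) / \<rho>0"
      using \<rho> l by (intro tendsto_intros Em_tendsto[where B = 1] disc) auto
    moreover have "E (\<lambda>x. 1 - logistic (b x)) / \<rho>0 = 1"
    proof -
      have d: "ctble_disc (\<lambda>x. 1 - logistic (b x))" by (intro disc)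
      have "E (\<lambda>x. 1 - logistic (b x)) = \<rho>0 * stieltjes F0 (\<lambda>x. 1 - logistic (b x)) + \<rho>1 * stieltjes G0 (\<lambda>x. (1 - logistic (b x)) * 1)"
        by (simp add: pooled_def)
      also have "\<dots> = \<rho>0 * (stieltjes F0 (\<lambda>x. 1 - logistic (b x)) + stieltjes F0 (\<lambda>x. logistic (b x)))"
        unfolding link[OF ctble_disc_const] by (simp add: algebra_simps)
      also have "stieltjes F0 (\<lambda>x. 1 - logistic (b x)) + stieltjes F0 (\<lambda>x. logistic (b x)) = stieltjes F0 (\<lambda>x. 1)"
        using F.sintegrable_weighted[OF d, of 1 0] F.sintegrable_weighted[OF logistic_b_disc, of 1 0] l logistic_pos logistic_less_1
        by (subst stieltjes_add[symmetric]) (auto simp: less_imp_le)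
      finally show ?thesis using F.stieltjes_F0_one \<rho> by simp
    qed
    ultimately show "(\<lambda>m. Em m (\<lambda>x. 1 - logistic (b x)) / \<rho>0) \<longlonglongrightarrow> 1" by simp
    show "(\<lambda>m. baseline_df m 0 t) \<longlonglongrightarrow> F0 t" if "0 \<le> t" for t
    proof -
      have "(\<lambda>m. Em m (\<lambda>x. h x ^ 0 * (indicator {..t} x * (1 - logistic (b x)))) / \<rho>0) \<longlonglongrightarrow> E (\<lambda>x. h x ^ 0 * (indicator {..t} x * (1 - logistic (b x)))) / \<rho>0"
        using \<rho> bd by (intro tendsto_intros Em_tendsto[where B = 1] disc ctble_disc_atMost) auto
      then show ?thesis using baseline_df_limit[of t] stieltjes_F0_Iic[OF that] by (simp add: baseline_df_def)
    qed
    show "continuous_on UNIV F0" using F.F0_cont by (simp add: continuous_on_eq_continuous_within)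
  qed (use e F.F0_mono F.F0_one in auto)
  \<comment> \<open>The shift costs a first moment, which the cubic one dominates.\<close>
  obtain K where K: "K > 0" and evK: "\<forall>\<^sub>F m in sequentially. Em m (\<lambda>x. (1 + h x) ^ 3) \<le> K"
    using cubic_moment_bound by blast
  have "(\<lambda>m. norm (\<eta> m) * K / \<rho>0) \<longlonglongrightarrow> norm (0::real^'q) * K / \<rho>0"
    using \<rho> by (intro tendsto_intros \<eta>) auto
  then have "\<forall>\<^sub>F m in sequentially. norm (\<eta> m) * K / \<rho>0 < e / 2"
    by (rule order_tendstoD(2)) (use e in auto)
  with 1 evK show ?thesis
  proof eventually_elim
    case (elim m)
    show ?case
    proof (intro allI impI)
      fix t :: real assume t: "0 \<le> t"
      have "\<bar>baseline_df m (\<eta> m) t - baseline_df m 0 t\<bar> = \<bar>Em m (\<lambda>x. indicator {..t} x * (1 - logistic (b x + \<eta> m \<bullet> w x)) - indicator {..t} x * (1 - logistic (b x)))\<bar> / \<rho>0"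
        using \<rho> by (subst Em_diff) (auto intro!: disc ctble_disc_atMost simp: baseline_df_def diff_divide_distrib[symmetric])
      also have "\<dots> \<le> Em m (\<lambda>x. norm (\<eta> m) * (1 + h x) ^ 3) / \<rho>0"
      proof (intro divide_right_mono Em_abs_le)
        fix x :: real assume x: "0 < x"
        have h0: "0 \<le> h x" by (rule F.h_nonneg[OF x])
        have "\<bar>indicator {..t} x * (1 - logistic (b x + \<eta> m \<bullet> w x)) - indicator {..t} x * (1 - logistic (b x))\<bar> \<le> \<bar>logistic (b x + \<eta> m \<bullet> w x) - logistic (b x)\<bar>"
          by (cases "x \<le> t") auto
        also have "\<dots> \<le> \<bar>\<eta> m \<bullet> w x\<bar>" using logistic_lipschitz[of "b x + \<eta> m \<bullet> w x" "b x"] by simp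
        also have "\<dots> \<le> norm (\<eta> m) * (1 + h x)" by (rule inner_w[OF x])
        also have "\<dots> \<le> norm (\<eta> m) * (1 + h x) ^ 3"
          using self_le_power[of "1 + h x" 3] h0 by (intro mult_left_mono) auto
        finally show "\<bar>indicator {..t} x * (1 - logistic (b x + \<eta> m \<bullet> w x)) - indicator {..t} x * (1 - logistic (b x))\<bar> \<le> norm (\<eta> m) * (1 + h x) ^ 3" .
      qed (use \<rho> in \<open>auto intro!: disc ctble_disc_atMost\<close>)
      also have "\<dots> \<le> norm (\<eta> m) * K / \<rho>0"
        unfolding Em_mult using \<rho> elim by (intro divide_right_mono mult_left_mono) auto
      finally have "\<bar>baseline_df m (\<eta> m) t - baseline_df m 0 t\<bar> < e / 2" using elim by linarith
      moreover have "\<bar>baseline_df m 0 t - F0 t\<bar> < e / 2" using elim t by blast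
      ultimately show "\<bar>baseline_df m (\<eta> m) t - F0 t\<bar> < e" by linarith
    qed
  qed
qed

end

section \<open>Convergence in law\<close>

text \<open>A continuous version of the indicator of the ball of radius \<open>R\<close>. Tightness is expressed through
integrals of \<open>1 - cutoff R\<close>, to which convergence in law applies directly.\<close>

definition cutoff :: "real \<Rightarrow> 'v::real_normed_vector \<Rightarrow> real" where
  "cutoff R x = max 0 (min 1 (R + 1 - norm x))"

lemma cutoff_bounds: "0 \<le> cutoff R x" "cutoff R x \<le> 1"
  by (auto simp: cutoff_def)

lemma abs_one_minus_cutoff: "\<bar>1 - cutoff R x\<bar> \<le> 1"
  using cutoff_bounds[of R x] by simp

lemma cutoff_zero: "R + 1 \<le> norm x \<Longrightarrow> cutoff R x = 0"
  and cutoff_one: "norm x \<le> R \<Longrightarrow> cutoff R x = 1"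
  by (auto simp: cutoff_def)

lemma continuous_cutoff: "continuous_on A (cutoff R)"
  unfolding cutoff_def[abs_def] by (intro continuous_intros)

lemma cutoff_measurable [measurable]: "cutoff R \<in> borel_measurable borel"
  by (rule borel_measurable_continuous_onI[OF continuous_cutoff])

lemma bounded_range_abs:
  fixes f :: "'v \<Rightarrow> real"
  assumes "bounded (range f)"
  obtains B where "0 < B" "\<And>x. \<bar>f x\<bar> \<le> B"
  using assms unfolding bounded_pos by auto

lemma bounded_rangeI: "(\<And>x. \<bar>f x\<bar> \<le> (B::real)) \<Longrightarrow> bounded (range f)"
  by (auto simp: bounded_iff)

lemma (in prob_space) integrable_bounded_comp:
  fixes f :: "'v::topological_space \<Rightarrow> real"
  assumes "f \<in> borel_measurable borel" "A \<in> borel_measurable M" "\<And>x. \<bar>f x\<bar> \<le> B"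
  shows "integrable M (\<lambda>\<omega>. f (A \<omega>))"
  by (rule integrable_const_bound[of _ B]) (use assms in \<open>auto intro: measurable_compose\<close>)

lemma (in prob_space) abs_integral_bounded:
  assumes "integrable M f" "\<And>x. \<bar>f x\<bar> \<le> (B::real)"
  shows "\<bar>\<integral>\<omega>. f \<omega> \<partial>M\<bar> \<le> B"
proof -
  have "\<bar>\<integral>\<omega>. f \<omega> \<partial>M\<bar> \<le> (\<integral>\<omega>. \<bar>f \<omega>\<bar> \<partial>M)" by (rule integral_abs_bound)
  also have "\<dots> \<le> (\<integral>\<omega>. B \<partial>M)" by (rule integral_mono) (use assms in auto)
  finally show ?thesis by (simp add: prob_space)
qed

lemma (in prob_space) abs_integral_le_cutoff_tail:
  assumes D: "integrable M D" and A: "A \<in> borel_measurable M"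
    and le: "\<And>\<omega>. \<bar>D \<omega>\<bar> \<le> c + B * (1 - cutoff R (A \<omega>))"
  shows "\<bar>\<integral>\<omega>. D \<omega> \<partial>M\<bar> \<le> c + B * (\<integral>\<omega>. 1 - cutoff R (A \<omega>) \<partial>M)"
proof -
  have i: "integrable M (\<lambda>\<omega>. 1 - cutoff R (A \<omega>))"
    by (rule integrable_const_bound[of _ 1]) (use A in \<open>auto simp: abs_one_minus_cutoff\<close>)
  have "\<bar>\<integral>\<omega>. D \<omega> \<partial>M\<bar> \<le> (\<integral>\<omega>. \<bar>D \<omega>\<bar> \<partial>M)" by (rule integral_abs_bound)
  also have "\<dots> \<le> (\<integral>\<omega>. c + B * (1 - cutoff R (A \<omega>)) \<partial>M)"
    by (rule integral_mono) (use D i le in auto)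
  also have "\<dots> = c + B * (\<integral>\<omega>. 1 - cutoff R (A \<omega>) \<partial>M)"
    using i by (subst Bochner_Integration.integral_add) (auto simp: prob_space)
  finally show ?thesis .
qed

lemma uniformly_continuous_cutoff:
  fixes f :: "'v::euclidean_space \<Rightarrow> real"
  assumes f: "continuous_on UNIV f"
  shows "uniformly_continuous_on UNIV (\<lambda>x. f x * cutoff R x)"
proof -
  let ?g = "\<lambda>x. f x * cutoff R x"
  \<comment> \<open>The product vanishes beyond radius \<open>R + 1\<close>. Two points at distance less than 1 either both lie
    in the ball of radius \<open>R + 3\<close> or both lie beyond \<open>R + 1\<close>.\<close>
  have "uniformly_continuous_on (cball 0 (R + 3)) ?g"
    by (rule compact_uniformly_continuous)
       (auto intro!: continuous_intros continuous_cutoff continuous_on_subset[OF f])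
  then have u: "\<exists>d>0. \<forall>x\<in>cball 0 (R + 3). \<forall>y\<in>cball 0 (R + 3). dist y x < d \<longrightarrow> dist (?g y) (?g x) < e" if "e > 0" for e
    using that unfolding uniformly_continuous_on_def by blast
  show ?thesis
    unfolding uniformly_continuous_on_def
  proof (intro allI impI)
    fix e :: real assume e: "0 < e"
    obtain d where d: "d > 0" "\<And>x y. x \<in> cball 0 (R + 3) \<Longrightarrow> y \<in> cball 0 (R + 3) \<Longrightarrow> dist y x < d \<Longrightarrow> dist (?g y) (?g x) < e"
      using u[OF e] by blast
    show "\<exists>d>0. \<forall>x\<in>UNIV. \<forall>x'\<in>UNIV. dist x' x < d \<longrightarrow> dist (?g x') (?g x) < e"
    proof (intro exI[of _ "min d 1"] conjI ballI impI)
      fix x y :: 'v assume xy: "dist y x < min d 1"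
      have n: "\<bar>norm y - norm x\<bar> < 1" using xy norm_triangle_ineq3[of y x] by (simp add: dist_norm)
      show "dist (?g y) (?g x) < e"
      proof (cases "norm x \<le> R + 2")
        case True
        then have "x \<in> cball 0 (R + 3)" "y \<in> cball 0 (R + 3)" using n by auto
        then show ?thesis using d(2) xy by auto
      next
        case False
        then have "cutoff R x = 0" "cutoff R y = 0" using n by (auto intro!: cutoff_zero)
        then show ?thesis using e by simp
      qed
    qed (use d in auto)
  qed
qed

lemma prob_cutoff_tail:
  fixes \<nu> :: "'v::euclidean_space measure"
  assumes "prob_space \<nu>" "sets \<nu> = sets borel" and e: "0 < e"
  shows "\<exists>R>0. (\<integral>x. 1 - cutoff R x \<partial>\<nu>) < e"
proof -
  interpret prob_space \<nu> by fact
  note [measurable_cong] = assms(2)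
  have "(\<lambda>n. \<integral>x. 1 - cutoff (real n) x \<partial>\<nu>) \<longlonglongrightarrow> (\<integral>x. 0 \<partial>\<nu>)"
  proof (rule integral_dominated_convergence[where w = "\<lambda>_. 1"])
    show "AE x in \<nu>. (\<lambda>n. 1 - cutoff (real n) x) \<longlonglongrightarrow> 0"
    proof (rule AE_I2)
      fix x :: 'v
      have "\<forall>\<^sub>F n in sequentially. 1 - cutoff (real n) x = 0"
        using eventually_ge_at_top[of "nat \<lceil>norm x\<rceil>"]
        by eventually_elim (auto intro!: cutoff_one simp: nat_le_iff ceiling_le_iff)
      then show "(\<lambda>n. 1 - cutoff (real n) x) \<longlonglongrightarrow> 0" by (rule tendsto_eventually)
    qed
    show "AE x in \<nu>. norm (1 - cutoff (real n) x) \<le> 1" for n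
      by (simp add: abs_one_minus_cutoff)
  qed auto
  then have "\<forall>\<^sub>F n in sequentially. (\<integral>x. 1 - cutoff (real n) x \<partial>\<nu>) < e"
    using e by (intro order_tendstoD(2)) auto
  with eventually_gt_at_top[of 0] have "\<forall>\<^sub>F n in sequentially. 0 < real n \<and> (\<integral>x. 1 - cutoff (real n) x \<partial>\<nu>) < e"
    by eventually_elim auto
  then show ?thesis using eventually_happens'[OF sequentially_bot] by blast
qed

lemma converges_in_lawD:
  assumes "converges_in_law M A \<nu>"
  shows "A m \<in> borel_measurable M"
    and "continuous_on UNIV f \<Longrightarrow> (\<And>x. \<bar>f x\<bar> \<le> (B::real)) \<Longrightarrow> (\<lambda>m. LINT \<omega>|M. f (A m \<omega>)) \<longlonglongrightarrow> (LINT x|\<nu>. f x)"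
  using assms bounded_rangeI[of f B] unfolding converges_in_law_def by blast+

lemma converges_in_law_tight:
  fixes \<nu> :: "'v::euclidean_space measure"
  assumes A: "converges_in_law M A \<nu>" and \<nu>: "prob_space \<nu>" "sets \<nu> = sets borel" and e: "0 < e"
  shows "\<exists>R>0. \<forall>\<^sub>F m in sequentially. (LINT \<omega>|M. 1 - cutoff R (A m \<omega>)) < e"
proof -
  obtain R where R: "R > 0" "(\<integral>x. 1 - cutoff R x \<partial>\<nu>) < e" using prob_cutoff_tail[OF \<nu> e] by blast
  have "(\<lambda>m. LINT \<omega>|M. 1 - cutoff R (A m \<omega>)) \<longlonglongrightarrow> (\<integral>x. 1 - cutoff R x \<partial>\<nu>)"
    by (rule converges_in_lawD(2)[OF A, where B = 1])
       (auto intro!: continuous_intros continuous_cutoff abs_one_minus_cutoff)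
  from order_tendstoD(2)[OF this R(2)] R(1) show ?thesis by blast
qed

text \<open>Uniformly continuous test functions suffice: a continuous function times a cutoff is uniformly
continuous, and the cutoff itself is a test function, so the mass that it ignores is small
along the sequence as well as in the limit.\<close>

lemma (in prob_space) converges_in_law_uniformI:
  fixes \<nu> :: "'v::euclidean_space measure"
  assumes meas: "\<And>m. A m \<in> borel_measurable M" and \<nu>: "prob_space \<nu>" "sets \<nu> = sets borel"
    and conv: "\<And>f B. uniformly_continuous_on UNIV f \<Longrightarrow> (\<And>x. \<bar>f x\<bar> \<le> (B::real)) \<Longrightarrow>
      (\<lambda>m. LINT \<omega>|M. f (A m \<omega>)) \<longlonglongrightarrow> (LINT x|\<nu>. f x)"
  shows "converges_in_law M A \<nu>"
  unfolding converges_in_law_def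
proof (intro conjI allI impI, rule meas)
  fix f :: "'v \<Rightarrow> real" assume "continuous_on UNIV f \<and> bounded (range f)"
  then obtain B where f: "continuous_on UNIV f" and B: "0 < B" "\<And>x. \<bar>f x\<bar> \<le> B"
    using bounded_range_abs by metis
  have fm[measurable]: "f \<in> borel_measurable borel" by (rule borel_measurable_continuous_onI[OF f])
  note [measurable_cong] = \<nu>(2) and [measurable] = meas
  interpret N: prob_space \<nu> by fact
  show "(\<lambda>m. LINT \<omega>|M. f (A m \<omega>)) \<longlonglongrightarrow> (LINT x|\<nu>. f x)"
  proof (rule LIMSEQ_I)
    fix e :: real assume e: "0 < e"
    \<comment> \<open>The tails enter twice, each with weight \<open>B\<close>, and take up half of \<open>e\<close>.\<close>
    define d where "d = e / (4 * B)"
    have d: "d > 0" using e B by (simp add: d_def)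
    obtain R where R: "R > 0" "(\<integral>x. 1 - cutoff R x \<partial>\<nu>) < d" using prob_cutoff_tail[OF \<nu> d] by blast
    let ?g = "\<lambda>x. f x * cutoff R x"
    have gb: "\<bar>?g x\<bar> \<le> B" for x
      using mult_mono[OF B(2) cutoff_bounds(2)[of R x], of x] cutoff_bounds[of R x] B by (simp add: abs_mult)
    have c1: "(\<lambda>m. LINT \<omega>|M. ?g (A m \<omega>)) \<longlonglongrightarrow> (LINT x|\<nu>. ?g x)"
      by (rule conv[OF uniformly_continuous_cutoff[OF f] gb])
    have "uniformly_continuous_on UNIV (\<lambda>x::'v. 1 - 1 * cutoff R x)"
      by (rule uniformly_continuous_on_diff[OF uniformly_continuous_on_const uniformly_continuous_cutoff]) simp
    then have c2: "(\<lambda>m. LINT \<omega>|M. 1 - cutoff R (A m \<omega>)) \<longlonglongrightarrow> (LINT x|\<nu>. 1 - cutoff R x)"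
      using conv[of "\<lambda>x. 1 - cutoff R x" 1] by (simp add: abs_one_minus_cutoff)
    have tail: "\<bar>f x - ?g x\<bar> \<le> B * (1 - cutoff R x)" for x
    proof -
      have "f x - ?g x = f x * (1 - cutoff R x)" by (simp add: algebra_simps)
      then show ?thesis using B(2)[of x] cutoff_bounds[of R x] by (simp add: abs_mult mult_right_mono)
    qed
    have i: "integrable M (\<lambda>\<omega>. f (A m \<omega>))" "integrable M (\<lambda>\<omega>. ?g (A m \<omega>))" for m
      by (intro integrable_bounded_comp[where B = B] B gb; simp)+
    have j: "integrable \<nu> f" "integrable \<nu> ?g"
      by (intro N.integrable_bounded_comp[where B = B and A = "\<lambda>x. x"] B gb; simp)+
    have 1: "\<bar>(LINT \<omega>|M. f (A m \<omega>)) - (LINT \<omega>|M. ?g (A m \<omega>))\<bar> \<le> B * (LINT \<omega>|M. 1 - cutoff R (A m \<omega>))" for m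
      using abs_integral_le_cutoff_tail[of "\<lambda>\<omega>. f (A m \<omega>) - ?g (A m \<omega>)" "A m" 0 B R] i tail by simp
    have 2: "\<bar>(LINT x|\<nu>. f x) - (LINT x|\<nu>. ?g x)\<bar> \<le> B * (LINT x|\<nu>. 1 - cutoff R x)"
      using N.abs_integral_le_cutoff_tail[of "\<lambda>x. f x - ?g x" "\<lambda>x. x" 0 B R] j tail by simp
    have "\<forall>\<^sub>F m in sequentially. dist (LINT \<omega>|M. ?g (A m \<omega>)) (LINT x|\<nu>. ?g x) < e / 2"
      by (rule tendstoD[OF c1]) (use e in simp)
    moreover have "\<forall>\<^sub>F m in sequentially. (LINT \<omega>|M. 1 - cutoff R (A m \<omega>)) < d"
      by (rule order_tendstoD(2)[OF c2 R(2)])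
    ultimately have "\<forall>\<^sub>F m in sequentially. norm ((LINT \<omega>|M. f (A m \<omega>)) - (LINT x|\<nu>. f x)) < e"
    proof eventually_elim
      case (elim m)
      have "B * (LINT \<omega>|M. 1 - cutoff R (A m \<omega>)) < B * d" "B * (LINT x|\<nu>. 1 - cutoff R x) < B * d"
        using elim R B by auto
      moreover have "B * d = e / 4" using B by (simp add: d_def)
      ultimately show ?case using 1[of m] 2 elim unfolding dist_real_def real_norm_def by linarith
    qed
    then show "\<exists>no. \<forall>n\<ge>no. norm ((LINT \<omega>|M. f (A n \<omega>)) - (LINT x|\<nu>. f x)) < e"
      by (simp add: eventually_sequentially)
  qed
qed

lemma converges_in_law_map:
  fixes A :: "nat \<Rightarrow> 'w \<Rightarrow> 'v::euclidean_space" and L :: "'v \<Rightarrow> 'u::euclidean_space"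
  assumes A: "converges_in_law M A \<nu>" and L: "continuous_on UNIV L" and \<nu>: "sets \<nu> = sets borel"
  shows "converges_in_law M (\<lambda>m \<omega>. L (A m \<omega>)) (distr \<nu> borel L)"
  unfolding converges_in_law_def
proof (intro conjI allI impI)
  have Lm[measurable]: "L \<in> borel_measurable borel" by (rule borel_measurable_continuous_onI[OF L])
  note [measurable_cong] = \<nu>
  show "(\<lambda>\<omega>. L (A m \<omega>)) \<in> borel_measurable M" for m
    using converges_in_lawD(1)[OF A, of m] by measurable
  fix f :: "'u \<Rightarrow> real" assume "continuous_on UNIV f \<and> bounded (range f)"
  then obtain B where f: "continuous_on UNIV f" and B: "0 < B" "\<And>x. \<bar>f x\<bar> \<le> B"
    using bounded_range_abs by metis
  have fm[measurable]: "f \<in> borel_measurable borel" by (rule borel_measurable_continuous_onI[OF f])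
  have "(\<lambda>m. LINT \<omega>|M. f (L (A m \<omega>))) \<longlonglongrightarrow> (LINT x|\<nu>. f (L x))"
    by (rule converges_in_lawD(2)[OF A, where B = B]) (use B continuous_on_compose2[OF f L] in auto)
  then show "(\<lambda>m. LINT \<omega>|M. f (L (A m \<omega>))) \<longlonglongrightarrow> (LINT x|distr \<nu> borel L. f x)"
    by (subst integral_distr) auto
qed

lemma converges_in_law_cong_AE:
  assumes A: "converges_in_law M A \<nu>" and B: "\<And>m. B m \<in> borel_measurable M"
    and eq: "\<And>m. AE \<omega> in M. A m \<omega> = B m \<omega>"
  shows "converges_in_law M B \<nu>"
  unfolding converges_in_law_def
proof (intro conjI allI impI B)
  fix f :: "'b \<Rightarrow> real" assume f: "continuous_on UNIV f \<and> bounded (range f)"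
  then have fm[measurable]: "f \<in> borel_measurable borel" by (auto intro: borel_measurable_continuous_onI)
  have "(LINT \<omega>|M. f (A m \<omega>)) = (LINT \<omega>|M. f (B m \<omega>))" for m
    using converges_in_lawD(1)[OF A, of m] B[of m] eq[of m] by (intro integral_cong_AE) auto
  moreover have "(\<lambda>m. LINT \<omega>|M. f (A m \<omega>)) \<longlonglongrightarrow> (LINT x|\<nu>. f x)"
    using A f unfolding converges_in_law_def by blast
  ultimately show "(\<lambda>m. LINT \<omega>|M. f (B m \<omega>)) \<longlonglongrightarrow> (LINT x|\<nu>. f x)" by simp
qed

text \<open>A form of Slutsky's theorem for an error that is small relative to \<open>S m\<close>, almost surely and with
a rate that may depend on \<open>\<omega>\<close>. Where \<open>S m\<close> is bounded the error tends to zero pointwise, and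
dominated convergence applies; elsewhere tightness of \<open>S\<close> applies.\<close>

lemma (in prob_space) converges_in_law_perturb:
  fixes S T :: "nat \<Rightarrow> 'a \<Rightarrow> 'v::euclidean_space"
  assumes S: "converges_in_law M S \<nu>" and \<nu>: "prob_space \<nu>" "sets \<nu> = sets borel"
    and T[measurable]: "\<And>m. T m \<in> borel_measurable M"
    and close: "AE \<omega> in M. \<exists>\<epsilon>. \<epsilon> \<longlonglongrightarrow> 0 \<and> (\<forall>\<^sub>F m in sequentially. norm (T m \<omega> - S m \<omega>) \<le> \<epsilon> m * norm (S m \<omega>))"
  shows "converges_in_law M T \<nu>"
proof (rule converges_in_law_uniformI[OF T \<nu>])
  fix f :: "'v \<Rightarrow> real" and B0 assume f: "uniformly_continuous_on UNIV f" and B0: "\<And>x. \<bar>f x\<bar> \<le> B0"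
  define B where "B = \<bar>B0\<bar> + 1"
  have B: "0 < B" "\<And>x. \<bar>f x\<bar> \<le> B" using B0 by (auto simp: B_def intro: order_trans[OF B0])
  have cf: "continuous_on UNIV f" by (rule uniformly_continuous_imp_continuous[OF f])
  have fm[measurable]: "f \<in> borel_measurable borel" by (rule borel_measurable_continuous_onI[OF cf])
  have Sm[measurable]: "S m \<in> borel_measurable M" for m by (rule converges_in_lawD(1)[OF S])
  have iT: "integrable M (\<lambda>\<omega>. f (T m \<omega>))" and iS: "integrable M (\<lambda>\<omega>. f (S m \<omega>))" for m
    by (rule integrable_bounded_comp[OF _ _ B(2)]; simp)+
  have "(\<lambda>m. (LINT \<omega>|M. f (T m \<omega>)) - (LINT \<omega>|M. f (S m \<omega>))) \<longlonglongrightarrow> 0"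
  proof (rule LIMSEQ_I)
    fix e :: real assume e: "0 < e"
    define d where "d = e / (4 * B)"
    have d: "d > 0" using e B by (simp add: d_def)
    obtain R where R: "R > 0" "\<forall>\<^sub>F m in sequentially. (LINT \<omega>|M. 1 - cutoff R (S m \<omega>)) < d"
      using converges_in_law_tight[OF S \<nu> d] by blast
    define D where "D m \<omega> = (f (T m \<omega>) - f (S m \<omega>)) * cutoff R (S m \<omega>)" for m \<omega>
    have fd: "\<bar>f x - f y\<bar> \<le> 2 * B" for x y using B(2)[of x] B(2)[of y] by linarith
    have Db: "\<bar>D m \<omega>\<bar> \<le> 2 * B" for m \<omega>
      unfolding D_def abs_mult using fd cutoff_bounds[of R "S m \<omega>"] B
      by (metis abs_ge_zero abs_of_nonneg mult.right_neutral mult_mono order_trans)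
    have Dm[measurable]: "D m \<in> borel_measurable M" for m unfolding D_def[abs_def] by measurable
    have iD: "integrable M (D m)" for m by (rule integrable_const_bound[of _ "2 * B"]) (auto simp: Db)
    have "(\<lambda>m. LINT \<omega>|M. D m \<omega>) \<longlonglongrightarrow> (LINT \<omega>|M. 0)"
    proof (rule integral_dominated_convergence[where w = "\<lambda>_. 2 * B"])
      show "AE \<omega> in M. (\<lambda>m. D m \<omega>) \<longlonglongrightarrow> 0"
        using close
      proof eventually_elim
        case (elim \<omega>)
        then obtain \<epsilon> where \<epsilon>: "\<epsilon> \<longlonglongrightarrow> 0" "\<forall>\<^sub>F m in sequentially. norm (T m \<omega> - S m \<omega>) \<le> \<epsilon> m * norm (S m \<omega>)" by blast
        show ?case
        proof (rule LIMSEQ_I)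
          fix r :: real assume r: "0 < r"
          then obtain \<delta> where \<delta>: "\<delta> > 0" "\<And>x y. dist x y < \<delta> \<Longrightarrow> dist (f x) (f y) < r"
            using f unfolding uniformly_continuous_on_def by (metis UNIV_I)
          have "\<forall>\<^sub>F m in sequentially. \<epsilon> m < \<delta> / (R + 1)"
            by (rule order_tendstoD(2)[OF \<epsilon>(1)]) (use \<delta> R in simp)
          with \<epsilon>(2) have "\<forall>\<^sub>F m in sequentially. norm (D m \<omega> - 0) < r"
          proof eventually_elim
            case (elim m)
            show ?case
            proof (cases "norm (S m \<omega>) < R + 1")
              case True
              have "\<epsilon> m * norm (S m \<omega>) < \<delta>"
              proof (cases "S m \<omega> = 0")
                case False
                have "\<epsilon> m * norm (S m \<omega>) < \<delta> / (R + 1) * norm (S m \<omega>)"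
                  using elim False by (intro mult_strict_right_mono) auto
                also have "\<dots> \<le> \<delta> / (R + 1) * (R + 1)" using True \<delta> R by (intro mult_left_mono) auto
                finally show ?thesis using R by simp
              qed (use \<delta> in simp)
              then have "dist (T m \<omega>) (S m \<omega>) < \<delta>" using elim by (simp add: dist_norm)
              then have "\<bar>f (T m \<omega>) - f (S m \<omega>)\<bar> < r" using \<delta>(2) by (simp add: dist_real_def)
              moreover have "\<bar>D m \<omega>\<bar> \<le> \<bar>f (T m \<omega>) - f (S m \<omega>)\<bar>"
                unfolding D_def abs_mult using cutoff_bounds[of R "S m \<omega>"] by (simp add: mult_left_le)
              ultimately show ?thesis by simp
            next
              case False
              then have "cutoff R (S m \<omega>) = 0" by (intro cutoff_zero) simp
              then show ?thesis using r by (simp add: D_def)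
            qed
          qed
          then show "\<exists>no. \<forall>n\<ge>no. norm (D n \<omega> - 0) < r" by (simp add: eventually_sequentially)
        qed
      qed
    qed (use Db in auto)
    then have "\<forall>\<^sub>F m in sequentially. dist (LINT \<omega>|M. D m \<omega>) 0 < e / 2"
      using e by (intro tendstoD) auto
    with R(2) have "\<forall>\<^sub>F m in sequentially. norm ((LINT \<omega>|M. f (T m \<omega>)) - (LINT \<omega>|M. f (S m \<omega>)) - 0) < e"
    proof eventually_elim
      case (elim m)
      have pt: "\<bar>(f (T m \<omega>) - f (S m \<omega>)) - D m \<omega>\<bar> \<le> 0 + 2 * B * (1 - cutoff R (S m \<omega>))" for \<omega>
      proof -
        have "(f (T m \<omega>) - f (S m \<omega>)) - D m \<omega> = (f (T m \<omega>) - f (S m \<omega>)) * (1 - cutoff R (S m \<omega>))"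
          by (simp add: D_def algebra_simps)
        then show ?thesis
          using fd[of "T m \<omega>" "S m \<omega>"] cutoff_bounds[of R "S m \<omega>"] by (simp add: abs_mult mult_right_mono)
      qed
      have "\<bar>(LINT \<omega>|M. (f (T m \<omega>) - f (S m \<omega>)) - D m \<omega>)\<bar> \<le> 0 + 2 * B * (LINT \<omega>|M. 1 - cutoff R (S m \<omega>))"
        by (rule abs_integral_le_cutoff_tail[OF _ Sm pt]) (use iT iS iD in simp)
      also have "\<dots> < 0 + 2 * B * d" using elim B by simp
      also have "0 + 2 * B * d = e / 2" using B by (simp add: d_def)
      finally have "\<bar>(LINT \<omega>|M. (f (T m \<omega>) - f (S m \<omega>)) - D m \<omega>)\<bar> < e / 2" .
      moreover have "(LINT \<omega>|M. (f (T m \<omega>) - f (S m \<omega>)) - D m \<omega>) = (LINT \<omega>|M. f (T m \<omega>)) - (LINT \<omega>|M. f (S m \<omega>)) - (LINT \<omega>|M. D m \<omega>)"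
        using iT iS iD by simp
      ultimately show ?case using elim(2) unfolding dist_real_def real_norm_def by linarith
    qed
    then show "\<exists>no. \<forall>n\<ge>no. norm ((LINT \<omega>|M. f (T n \<omega>)) - (LINT \<omega>|M. f (S n \<omega>)) - 0) < e"
      by (simp add: eventually_sequentially)
  qed
  from tendsto_add[OF this converges_in_lawD(2)[OF S cf B(2)]]
  show "(\<lambda>m. LINT \<omega>|M. f (T m \<omega>)) \<longlonglongrightarrow> (LINT x|\<nu>. f x)" by simp
qed

text \<open>By independence, integrating \<open>A m\<close> out turns the test function into \<open>G m b = E f(A m + b)\<close>, evaluated
at \<open>b = B m\<close>. These functions converge pointwise to \<open>H\<close>, and they are equicontinuous because \<open>f\<close> is
uniformly continuous; hence they converge uniformly on compact sets, and \<open>B\<close> is tight. Finally \<open>H\<close>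
is itself a test function for \<open>B\<close>.\<close>

lemma (in prob_space) converges_in_law_indep_add:
  fixes A B :: "nat \<Rightarrow> 'a \<Rightarrow> 'v::euclidean_space"
  assumes A: "converges_in_law M A \<nu>A" and B: "converges_in_law M B \<nu>B"
    and \<nu>A: "prob_space \<nu>A" "sets \<nu>A = sets borel" and \<nu>B: "prob_space \<nu>B" "sets \<nu>B = sets borel"
    and ind: "\<And>m. indep_var borel (B m) borel (A m)"
  shows "converges_in_law M (\<lambda>m \<omega>. A m \<omega> + B m \<omega>) (distr (\<nu>B \<Otimes>\<^sub>M \<nu>A) borel (\<lambda>(b, a). a + b))"
proof (rule converges_in_law_uniformI)
  have Am[measurable]: "A m \<in> borel_measurable M" and Bm[measurable]: "B m \<in> borel_measurable M" for m
    using A B by (auto dest: converges_in_lawD(1))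
  note [measurable_cong] = \<nu>A(2) \<nu>B(2)
  interpret NA: prob_space \<nu>A by fact
  interpret NB: prob_space \<nu>B by fact
  interpret P: pair_prob_space \<nu>B \<nu>A ..
  show "(\<lambda>\<omega>. A m \<omega> + B m \<omega>) \<in> borel_measurable M" for m by measurable
  show "prob_space (distr (\<nu>B \<Otimes>\<^sub>M \<nu>A) borel (\<lambda>(b, a). a + b))"
    by (rule P.prob_space_distr) measurable
  show "sets (distr (\<nu>B \<Otimes>\<^sub>M \<nu>A) borel (\<lambda>(b, a). a + b)) = sets borel" by simp
  fix f :: "'v \<Rightarrow> real" and K0 assume f: "uniformly_continuous_on UNIV f" and K0: "\<And>x. \<bar>f x\<bar> \<le> K0"
  define K where "K = \<bar>K0\<bar> + 1"
  have K: "0 < K" "\<And>x. \<bar>f x\<bar> \<le> K" using K0 by (auto simp: K_def intro: order_trans[OF K0])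
  have cf: "continuous_on UNIV f" by (rule uniformly_continuous_imp_continuous[OF f])
  have fm[measurable]: "f \<in> borel_measurable borel" by (rule borel_measurable_continuous_onI[OF cf])
  define G where "G m b = (LINT \<omega>|M. f (A m \<omega> + b))" for m b
  define H where "H b = (LINT a|\<nu>A. f (a + b))" for b
  have iA: "integrable M (\<lambda>\<omega>. f (A m \<omega> + b))" for m b
    by (rule integrable_const_bound[of _ K]) (auto simp: K)
  have iN: "integrable \<nu>A (\<lambda>a. f (a + b))" for b
    by (rule NA.integrable_const_bound[of _ K]) (auto simp: K)
  have GH: "(\<lambda>m. G m b) \<longlonglongrightarrow> H b" for b
    unfolding G_def H_def
    by (rule converges_in_lawD(2)[OF A, where B = K])
       (auto simp: K intro!: continuous_on_compose2[OF cf] continuous_intros)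
  have Gb: "\<bar>G m b\<bar> \<le> K" for m b unfolding G_def by (rule abs_integral_bounded[OF iA K(2)])
  have Hb: "\<bar>H b\<bar> \<le> K" for b unfolding H_def by (rule NA.abs_integral_bounded[OF iN K(2)])
  have equi: "\<exists>\<delta>>0. \<forall>b c. dist b c < \<delta> \<longrightarrow> (\<forall>m. \<bar>G m b - G m c\<bar> \<le> r) \<and> \<bar>H b - H c\<bar> \<le> r" if r: "r > 0" for r
  proof -
    obtain \<delta> where \<delta>: "\<delta> > 0" "\<And>x y. dist x y < \<delta> \<Longrightarrow> dist (f x) (f y) < r"
      using f r unfolding uniformly_continuous_on_def by (metis UNIV_I)
    have fd: "\<bar>f (a + b) - f (a + c)\<bar> \<le> r" if "dist b c < \<delta>" for a b c
      using \<delta>(2)[of "a + b" "a + c"] that by (simp add: dist_real_def less_imp_le)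
    show ?thesis
    proof (intro exI[of _ \<delta>] conjI allI impI \<delta>(1))
      fix b c :: 'v and m assume bc: "dist b c < \<delta>"
      have "\<bar>LINT \<omega>|M. f (A m \<omega> + b) - f (A m \<omega> + c)\<bar> \<le> r"
        by (rule abs_integral_bounded) (use iA fd[OF bc] in auto)
      then show "\<bar>G m b - G m c\<bar> \<le> r" using iA by (simp add: G_def)
      have "\<bar>LINT a|\<nu>A. f (a + b) - f (a + c)\<bar> \<le> r"
        by (rule NA.abs_integral_bounded) (use iN fd[OF bc] in auto)
      then show "\<bar>H b - H c\<bar> \<le> r" using iN by (simp add: H_def)
    qed
  qed
  have contH: "continuous_on UNIV H"
  proof (rule uniformly_continuous_imp_continuous, unfold uniformly_continuous_on_def, intro allI impI)
    fix e :: real assume e: "0 < e"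
    obtain \<delta> where "\<delta> > 0" "\<And>b c. dist b c < \<delta> \<Longrightarrow> \<bar>H b - H c\<bar> \<le> e / 2" using equi[of "e / 2"] e by auto
    then show "\<exists>d>0. \<forall>x\<in>UNIV. \<forall>x'\<in>UNIV. dist x' x < d \<longrightarrow> dist (H x') (H x) < e"
      using e by (intro exI[of _ \<delta>]) (fastforce simp: dist_real_def)
  qed
  have contG: "continuous_on UNIV (G m)" for m
  proof (rule uniformly_continuous_imp_continuous, unfold uniformly_continuous_on_def, intro allI impI)
    fix e :: real assume e: "0 < e"
    obtain \<delta> where "\<delta> > 0" "\<And>b c. dist b c < \<delta> \<Longrightarrow> \<bar>G m b - G m c\<bar> \<le> e / 2" using equi[of "e / 2"] e by auto
    then show "\<exists>d>0. \<forall>x\<in>UNIV. \<forall>x'\<in>UNIV. dist x' x < d \<longrightarrow> dist (G m x') (G m x) < e"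
      using e by (intro exI[of _ \<delta>]) (fastforce simp: dist_real_def)
  qed
  have [measurable]: "H \<in> borel_measurable borel" "G m \<in> borel_measurable borel" for m
    by (intro borel_measurable_continuous_onI contH contG)+
  have EG: "(LINT \<omega>|M. f (A m \<omega> + B m \<omega>)) = (LINT \<omega>|M. G m (B m \<omega>))" for m
  proof -
    interpret DA: prob_space "distr M borel (A m)" by (rule prob_space_distr) simp
    interpret DB: prob_space "distr M borel (B m)" by (rule prob_space_distr) simp
    interpret PD: pair_prob_space "distr M borel (B m)" "distr M borel (A m)" ..
    have "(LINT \<omega>|M. f (A m \<omega> + B m \<omega>)) = (LINT z|distr M (borel \<Otimes>\<^sub>M borel) (\<lambda>\<omega>. (B m \<omega>, A m \<omega>)). f (snd z + fst z))"
      by (subst integral_distr) auto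
    also have "distr M (borel \<Otimes>\<^sub>M borel) (\<lambda>\<omega>. (B m \<omega>, A m \<omega>)) = distr M borel (B m) \<Otimes>\<^sub>M distr M borel (A m)"
      using ind[of m] by (simp add: indep_var_distribution_eq)
    also have "(LINT z|(distr M borel (B m) \<Otimes>\<^sub>M distr M borel (A m)). f (snd z + fst z))
        = (LINT b|distr M borel (B m). (LINT a|distr M borel (A m). f (a + b)))"
      by (subst PD.integral_fst'[symmetric])
         (auto intro!: PD.integrable_const_bound[of _ K] simp: K)
    also have "\<dots> = (LINT b|distr M borel (B m). G m b)"
      by (simp add: integral_distr G_def)
    also have "\<dots> = (LINT \<omega>|M. G m (B m \<omega>))" by (subst integral_distr) auto
    finally show ?thesis .
  qed
  have EH: "(LINT x|distr (\<nu>B \<Otimes>\<^sub>M \<nu>A) borel (\<lambda>(b, a). a + b). f x) = (LINT b|\<nu>B. H b)"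
  proof -
    have "(LINT x|distr (\<nu>B \<Otimes>\<^sub>M \<nu>A) borel (\<lambda>(b, a). a + b). f x) = (LINT z|(\<nu>B \<Otimes>\<^sub>M \<nu>A). f (snd z + fst z))"
      by (subst integral_distr) (auto simp: case_prod_beta)
    also have "\<dots> = (LINT b|\<nu>B. H b)"
      unfolding H_def
      by (subst P.integral_fst'[symmetric]) (auto intro!: P.integrable_const_bound[of _ K] simp: K)
    finally show ?thesis .
  qed
  have "(\<lambda>m. (LINT \<omega>|M. G m (B m \<omega>)) - (LINT \<omega>|M. H (B m \<omega>))) \<longlonglongrightarrow> 0"
  proof (rule LIMSEQ_I)
    fix e :: real assume e: "0 < e"
    define d where "d = e / (4 * K)"
    have d: "d > 0" using e K by (simp add: d_def)
    obtain R where R: "R > 0" "\<forall>\<^sub>F m in sequentially. (LINT \<omega>|M. 1 - cutoff R (B m \<omega>)) < d"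
      using converges_in_law_tight[OF B \<nu>B d] by blast
    obtain \<delta> where \<delta>: "\<delta> > 0" "\<And>b c m. dist b c < \<delta> \<Longrightarrow> \<bar>G m b - G m c\<bar> \<le> e / 8 \<and> \<bar>H b - H c\<bar> \<le> e / 8"
      using equi[of "e / 8"] e by auto
    have "compact (cball (0::'v) (R + 1))" by simp
    then obtain C where C: "finite C" "cball (0::'v) (R + 1) \<subseteq> (\<Union>c\<in>C. ball c \<delta>)"
      unfolding compact_eq_totally_bounded using \<delta>(1) by blast
    have "\<forall>\<^sub>F m in sequentially. \<forall>c\<in>C. \<bar>G m c - H c\<bar> < e / 8"
    proof (intro eventually_ball_finite C ballI)
      fix c show "\<forall>\<^sub>F m in sequentially. \<bar>G m c - H c\<bar> < e / 8"
        using tendstoD[OF GH[of c], of "e / 8"] e by (simp add: dist_real_def)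
    qed
    with R(2) have "\<forall>\<^sub>F m in sequentially. norm ((LINT \<omega>|M. G m (B m \<omega>)) - (LINT \<omega>|M. H (B m \<omega>)) - 0) < e"
    proof eventually_elim
      case (elim m)
      have near: "\<bar>G m b - H b\<bar> \<le> 3 * e / 8" if "norm b \<le> R + 1" for b
      proof -
        obtain c where c: "c \<in> C" "dist c b < \<delta>" using C(2) \<open>norm b \<le> R + 1\<close> by force
        have "\<bar>G m c - H c\<bar> < e / 8" using elim(2) c(1) by blast
        then show ?thesis using \<delta>(2)[OF c(2), of m] by linarith
      qed
      have pt: "\<bar>G m b - H b\<bar> \<le> 3 * e / 8 + 2 * K * (1 - cutoff R b)" for b
      proof (cases "norm b \<le> R + 1")
        case True
        have "0 \<le> 2 * K * (1 - cutoff R b)" using K cutoff_bounds[of R b] by simp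
        then show ?thesis using near[OF True] by linarith
      next
        case False
        then have "cutoff R b = 0" by (intro cutoff_zero) simp
        then show ?thesis using Gb[of m b] Hb[of b] e by simp
      qed
      have iG: "integrable M (\<lambda>\<omega>. G m (B m \<omega>))" "integrable M (\<lambda>\<omega>. H (B m \<omega>))"
        by (rule integrable_const_bound[of _ K]; use Gb Hb in auto)+
      have "\<bar>LINT \<omega>|M. G m (B m \<omega>) - H (B m \<omega>)\<bar> \<le> 3 * e / 8 + 2 * K * (LINT \<omega>|M. 1 - cutoff R (B m \<omega>))"
        by (rule abs_integral_le_cutoff_tail[OF _ Bm pt]) (use iG in simp)
      also have "\<dots> < 3 * e / 8 + 2 * K * d"
        using elim K by (intro add_strict_left_mono mult_strict_left_mono) auto
      also have "2 * K * d = e / 2" using K by (simp add: d_def)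
      finally show ?case using iG e by simp
    qed
    then show "\<exists>no. \<forall>n\<ge>no. norm ((LINT \<omega>|M. G n (B n \<omega>)) - (LINT \<omega>|M. H (B n \<omega>)) - 0) < e"
      by (simp add: eventually_sequentially)
  qed
  from tendsto_add[OF this converges_in_lawD(2)[OF B contH Hb]]
  show "(\<lambda>m. LINT \<omega>|M. f (A m \<omega> + B m \<omega>)) \<longlonglongrightarrow> (LINT x|distr (\<nu>B \<Otimes>\<^sub>M \<nu>A) borel (\<lambda>(b, a). a + b). f x)"
    unfolding EG EH by simp
qed

section \<open>Centered normal laws\<close>

lemma char_centered_normal1:
  assumes v: "0 \<le> v"
  shows "real_distribution (centered_normal1 v)"
    and "char (centered_normal1 v) t = complex_of_real (exp (- (v * t\<^sup>2) / 2))"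
proof -
  have "real_distribution (centered_normal1 v) \<and> char (centered_normal1 v) t = complex_of_real (exp (- (v * t\<^sup>2) / 2))"
  proof (cases "v = 0")
    case True
    have "prob_space (return borel (0::real))" by (rule prob_space_return) simp
    then have "real_distribution (return borel (0::real))"
      by (simp add: real_distribution_def real_distribution_axioms_def)
    moreover have "char (return borel 0) t = 1"
      unfolding char_def by (subst integral_return) auto
    ultimately show ?thesis using True by (simp add: centered_normal1_def)
  next
    case False
    define s where "s = sqrt v"
    have s: "s > 0" "s\<^sup>2 = v" using False v by (auto simp: s_def)
    interpret N: real_distribution std_normal_distribution by (rule real_dist_normal_dist)
    have "distributed std_normal_distribution lborel (\<lambda>x. x) (\<lambda>x. ennreal (normal_density 0 1 x))"
      by (auto simp: distributed_def distr_id2)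
    from N.normal_density_affine[OF this, of s 0] s
    have "distributed std_normal_distribution lborel (\<lambda>x. s * x) (\<lambda>x. ennreal (normal_density 0 s x))"
      by simp
    then have d: "distr std_normal_distribution lborel (\<lambda>x. s * x) = density lborel (\<lambda>x. ennreal (normal_density 0 s x))"
      by (rule distributed_distr_eq_density)
    have eq: "centered_normal1 v = distr std_normal_distribution borel (\<lambda>x. s * x)"
      using False d by (simp add: centered_normal1_def s_def cong: distr_cong)
    have "char (distr std_normal_distribution borel (\<lambda>x. s * x)) t = char std_normal_distribution (t * s)"
      unfolding char_def by (subst integral_distr) (auto simp: ac_simps)
    also have "\<dots> = complex_of_real (exp (- (v * t\<^sup>2) / 2))"
      unfolding char_std_normal_distribution using s by (simp add: power_mult_distrib mult.commute)
    finally show ?thesis unfolding eq by simp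
  qed
  then show "real_distribution (centered_normal1 v)"
    and "char (centered_normal1 v) t = complex_of_real (exp (- (v * t\<^sup>2) / 2))" by auto
qed

lemma is_centered_normal_linear:
  fixes \<Lambda> :: "real ^ 'q ^ 'q"
  assumes "is_centered_normal \<Sigma> \<nu>"
  shows "is_centered_normal (\<Lambda> ** \<Sigma> ** transpose \<Lambda>) (distr \<nu> borel (\<lambda>x. \<Lambda> *v x))"
proof -
  have \<nu>: "prob_space \<nu>" "sets \<nu> = sets borel" and n: "\<And>t. distr \<nu> borel (\<lambda>x. t \<bullet> x) = centered_normal1 (t \<bullet> (\<Sigma> *v t))"
    using assms by (auto simp: is_centered_normal_def)
  note [measurable_cong] = \<nu>(2)
  interpret prob_space \<nu> by fact
  have L[measurable]: "(\<lambda>x. \<Lambda> *v x) \<in> borel_measurable borel"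
    by (rule borel_measurable_continuous_onI[OF matrix_vector_mult_linear_continuous_on])
  have "distr (distr \<nu> borel (\<lambda>x. \<Lambda> *v x)) borel (\<lambda>x. t \<bullet> x) = centered_normal1 (t \<bullet> ((\<Lambda> ** \<Sigma> ** transpose \<Lambda>) *v t))" for t
  proof -
    have tr: "t \<bullet> (\<Lambda> *v x) = (transpose \<Lambda> *v t) \<bullet> x" for x
      by (simp add: dot_lmul_matrix)
    have "distr (distr \<nu> borel (\<lambda>x. \<Lambda> *v x)) borel (\<lambda>x. t \<bullet> x) = distr \<nu> borel (\<lambda>x. (transpose \<Lambda> *v t) \<bullet> x)"
      by (subst distr_distr) (auto simp: comp_def tr)
    also have "\<dots> = centered_normal1 ((transpose \<Lambda> *v t) \<bullet> (\<Sigma> *v (transpose \<Lambda> *v t)))" by (rule n)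
    also have "(transpose \<Lambda> *v t) \<bullet> (\<Sigma> *v (transpose \<Lambda> *v t)) = t \<bullet> ((\<Lambda> ** \<Sigma> ** transpose \<Lambda>) *v t)"
      unfolding tr[symmetric] by (simp only: matrix_vector_mul_assoc matrix_mul_assoc)
    finally show ?thesis .
  qed
  then show ?thesis by (auto simp: is_centered_normal_def intro!: prob_space_distr)
qed

lemma covariance_matrix_linear:
  fixes \<Lambda> :: "real ^ 'q ^ 'q"
  assumes "covariance_matrix \<Sigma>"
  shows "covariance_matrix (\<Lambda> ** \<Sigma> ** transpose \<Lambda>)"
proof -
  have "t \<bullet> ((\<Lambda> ** \<Sigma> ** transpose \<Lambda>) *v t) = (transpose \<Lambda> *v t) \<bullet> (\<Sigma> *v (transpose \<Lambda> *v t))" for t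
    by (simp add: dot_lmul_matrix matrix_vector_mul_assoc[symmetric])
  then show ?thesis
    using assms by (auto simp: covariance_matrix_def matrix_transpose_mul transpose_transpose matrix_mul_assoc)
qed

lemma covariance_matrix_add:
  "covariance_matrix \<Sigma>1 \<Longrightarrow> covariance_matrix \<Sigma>2 \<Longrightarrow> covariance_matrix (\<Sigma>1 + \<Sigma>2)"
  by (auto simp: covariance_matrix_def matrix_vector_mult_add_rdistrib inner_add_right transpose_def vec_eq_iff)

text \<open>On a linear functional, the convolution has the product of the two characteristic functions,
and the exponents of centered normal laws add. Uniqueness of characteristic functions identifies
the law.\<close>

lemma is_centered_normal_add:
  fixes \<Sigma>1 \<Sigma>2 :: "real ^ 'q ^ 'q"
  assumes 1: "is_centered_normal \<Sigma>1 \<nu>1" "covariance_matrix \<Sigma>1"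
    and 2: "is_centered_normal \<Sigma>2 \<nu>2" "covariance_matrix \<Sigma>2"
  shows "is_centered_normal (\<Sigma>1 + \<Sigma>2) (distr (\<nu>2 \<Otimes>\<^sub>M \<nu>1) borel (\<lambda>(b, a). a + b))"
proof -
  have p1: "prob_space \<nu>1" "sets \<nu>1 = sets borel" and n1: "\<And>t. distr \<nu>1 borel (\<lambda>x. t \<bullet> x) = centered_normal1 (t \<bullet> (\<Sigma>1 *v t))"
    and c1: "\<And>t. 0 \<le> t \<bullet> (\<Sigma>1 *v t)"
    using 1 by (auto simp: is_centered_normal_def covariance_matrix_def)
  have p2: "prob_space \<nu>2" "sets \<nu>2 = sets borel" and n2: "\<And>t. distr \<nu>2 borel (\<lambda>x. t \<bullet> x) = centered_normal1 (t \<bullet> (\<Sigma>2 *v t))"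
    and c2: "\<And>t. 0 \<le> t \<bullet> (\<Sigma>2 *v t)"
    using 2 by (auto simp: is_centered_normal_def covariance_matrix_def)
  note [measurable_cong] = p1(2) p2(2)
  interpret N1: prob_space \<nu>1 by fact
  interpret N2: prob_space \<nu>2 by fact
  interpret P: pair_prob_space \<nu>2 \<nu>1 ..
  let ?\<nu> = "distr (\<nu>2 \<Otimes>\<^sub>M \<nu>1) borel (\<lambda>(b, a). a + b)"
  have pr: "prob_space ?\<nu>" by (rule P.prob_space_distr) measurable
  have "distr ?\<nu> borel (\<lambda>x. t \<bullet> x) = centered_normal1 (t \<bullet> ((\<Sigma>1 + \<Sigma>2) *v t))" for t
  proof (rule Levy_uniqueness)
    interpret Q: prob_space ?\<nu> by (rule pr)
    have v: "t \<bullet> ((\<Sigma>1 + \<Sigma>2) *v t) = t \<bullet> (\<Sigma>1 *v t) + t \<bullet> (\<Sigma>2 *v t)"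
      by (simp add: matrix_vector_mult_add_rdistrib inner_add_right)
    have v0: "0 \<le> t \<bullet> ((\<Sigma>1 + \<Sigma>2) *v t)" using c1[of t] c2[of t] v by simp
    show "real_distribution (distr ?\<nu> borel (\<lambda>x. t \<bullet> x))" by (rule Q.real_distribution_distr) measurable
    show "real_distribution (centered_normal1 (t \<bullet> ((\<Sigma>1 + \<Sigma>2) *v t)))" by (rule char_centered_normal1[OF v0])
    show "char (distr ?\<nu> borel (\<lambda>x. t \<bullet> x)) = char (centered_normal1 (t \<bullet> ((\<Sigma>1 + \<Sigma>2) *v t)))"
    proof
      fix s :: real
      have i1: "integrable \<nu>1 (\<lambda>a. iexp (s * (t \<bullet> a)))" and i2: "integrable \<nu>2 (\<lambda>b. iexp (s * (t \<bullet> b)))"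
        by (intro N1.integrable_iexp N2.integrable_iexp; simp)+
      have "char (distr ?\<nu> borel (\<lambda>x. t \<bullet> x)) s = (CLINT z|(\<nu>2 \<Otimes>\<^sub>M \<nu>1). iexp (s * (t \<bullet> (snd z + fst z))))"
        unfolding char_def
        by (subst integral_distr, simp, simp, subst integral_distr) (auto simp: case_prod_beta)
      also have "\<dots> = (CLINT b|\<nu>2. (CLINT a|\<nu>1. iexp (s * (t \<bullet> (a + b)))))"
        by (subst P.integral_fst'[symmetric]) (auto intro!: P.integrable_iexp)
      also have "\<dots> = (CLINT b|\<nu>2. (CLINT a|\<nu>1. iexp (s * (t \<bullet> a)) * iexp (s * (t \<bullet> b))))"
        by (simp add: inner_add_right algebra_simps exp_add)
      also have "\<dots> = (CLINT a|\<nu>1. iexp (s * (t \<bullet> a))) * (CLINT b|\<nu>2. iexp (s * (t \<bullet> b)))"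
        by (simp add: mult.commute)
      also have "(CLINT a|\<nu>1. iexp (s * (t \<bullet> a))) = char (distr \<nu>1 borel (\<lambda>x. t \<bullet> x)) s"
        unfolding char_def by (subst integral_distr) auto
      also have "(CLINT b|\<nu>2. iexp (s * (t \<bullet> b))) = char (distr \<nu>2 borel (\<lambda>x. t \<bullet> x)) s"
        unfolding char_def by (subst integral_distr) auto
      finally show "char (distr ?\<nu> borel (\<lambda>x. t \<bullet> x)) s = char (centered_normal1 (t \<bullet> ((\<Sigma>1 + \<Sigma>2) *v t))) s"
        unfolding n1 n2 char_centered_normal1(2)[OF c1] char_centered_normal1(2)[OF c2] char_centered_normal1(2)[OF v0]
        unfolding v of_real_mult[symmetric] exp_add[symmetric] by (simp add: field_simps add_divide_distrib)
    qed
  qed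
  then show ?thesis using pr by (auto simp: is_centered_normal_def)
qed

section \<open>Measurability and independence of integrals against random distribution functions\<close>

text \<open>The estimator is measurable at each point with respect to its own sample, but it is a distribution
function only almost surely, and its Stieltjes integral has no evident measurability on the
exceptional set. The right-continuous regularization of the clipped values at rational points is
nondecreasing, right-continuous and between 0 and 1 for every \<open>\<omega>\<close>, uses only countably many values, and changes nothing where
the estimator is a distribution function. Independence of the two samples thus passes to
integrals against the two estimators.\<close>

definition rc_version :: "(real \<Rightarrow> real) \<Rightarrow> real \<Rightarrow> real" where
  "rc_version F x = (INF q\<in>{q\<in>\<rat>. x < q}. max 0 (min 1 (F q)))"

lemma rc_version_props:
  shows rc_version_mono: "x \<le> y \<Longrightarrow> rc_version F x \<le> rc_version F y"
    and rc_version_bounds: "0 \<le> rc_version F x" "rc_version F x \<le> 1"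
    and rc_version_right_cont: "continuous (at_right x) (rc_version F)"
proof -
  let ?f = "\<lambda>q. max 0 (min 1 (F q))"
  have ne: "{q\<in>\<rat>. x < q} \<noteq> {}" for x :: real using Rats_no_top_le[of "x + 1"] by force
  have bdd: "bdd_below (?f ` A)" for A by (rule bdd_belowI2[of _ 0]) simp
  show mono: "rc_version F x \<le> rc_version F y" if "x \<le> y" for x y
    unfolding rc_version_def by (rule cINF_superset_mono[OF ne bdd]) (use that in auto)
  show "0 \<le> rc_version F x" unfolding rc_version_def by (rule cINF_greatest[OF ne]) simp
  show "rc_version F x \<le> 1"
  proof -
    obtain q where q: "q \<in> {q\<in>\<rat>. x < q}" using ne[of x] by blast
    have "rc_version F x \<le> ?f q" unfolding rc_version_def by (rule cINF_lower[OF bdd q])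
    then show ?thesis by simp
  qed
  show "continuous (at_right x) (rc_version F)"
    unfolding continuous_within
  proof (rule order_tendstoI)
    fix a assume "a < rc_version F x"
    have "\<forall>\<^sub>F y in at_right x. x < y" by (rule eventually_at_right_less)
    then show "\<forall>\<^sub>F y in at_right x. a < rc_version F y"
    proof eventually_elim
      case (elim y)
      then show ?case using mono[of x y] \<open>a < rc_version F x\<close> by simp
    qed
  next
    fix a assume "rc_version F x < a"
    then obtain q where q: "q \<in> \<rat>" "x < q" "?f q < a"
      unfolding rc_version_def using cINF_less_iff[OF ne bdd] by auto
    have "rc_version F y < a" if "y < q" for y
      using cINF_lower[OF bdd, of q "{q\<in>\<rat>. y < q}"] q that unfolding rc_version_def by force
    then show "\<forall>\<^sub>F y in at_right x. rc_version F y < a"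
      using q(2) by (auto simp: eventually_at_right_field)
  qed
qed

lemma rc_version_eq:
  assumes "sub_df F" shows "rc_version F = F"
proof
  fix x
  have m: "mono F" and rc: "continuous (at_right x) F" and z: "\<And>x. x \<le> 0 \<Longrightarrow> F x = 0" and o: "\<And>x. F x \<le> 1"
    using assms by (auto simp: sub_df_def)
  have nn: "0 \<le> F x" for x using z[of "min x 0"] monoD[OF m, of "min x 0" x] by simp
  have clip: "max 0 (min 1 (F q)) = F q" for q using nn[of q] o[of q] by simp
  have ne: "{q\<in>\<rat>. x < q} \<noteq> {}" using Rats_no_top_le[of "x + 1"] by force
  have bdd: "bdd_below (F ` A)" for A by (rule bdd_belowI2[of _ 0]) (simp add: nn)
  have "(INF q\<in>{q\<in>\<rat>. x < q}. F q) \<le> F x"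
  proof (rule field_le_epsilon)
    fix e :: real assume e: "0 < e"
    have "\<forall>\<^sub>F y in at_right x. F y < F x + e"
      using rc e unfolding continuous_within by (intro order_tendstoD(2)) auto
    then obtain d where d: "d > x" "\<And>y. x < y \<Longrightarrow> y < d \<Longrightarrow> F y < F x + e"
      by (auto simp: eventually_at_right_field)
    obtain q where q: "q \<in> \<rat>" "x < q" "q < d" using Rats_dense_in_real[OF d(1)] by auto
    have "(INF q\<in>{q\<in>\<rat>. x < q}. F q) \<le> F q" by (rule cINF_lower[OF bdd]) (use q in auto)
    then show "(INF q\<in>{q\<in>\<rat>. x < q}. F q) \<le> F x + e" using d(2)[of q] q by simp
  qed
  moreover have "F x \<le> (INF q\<in>{q\<in>\<rat>. x < q}. F q)"
    by (rule cINF_greatest[OF ne]) (use monoD[OF m] in auto)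
  ultimately show "rc_version F x = F x" by (simp add: rc_version_def clip)
qed

lemma rc_version_measurable:
  assumes "\<And>x. (\<lambda>\<omega>. Fh \<omega> x) \<in> borel_measurable N"
  shows "(\<lambda>\<omega>. rc_version (Fh \<omega>) x) \<in> borel_measurable N"
  unfolding rc_version_def
proof (rule borel_measurable_cINF)
  show "countable {q \<in> \<rat>. x < q}" by (rule countable_subset[OF _ countable_rat]) auto
  show "bdd_below ((\<lambda>q. max 0 (min 1 (Fh \<omega> q))) ` {q \<in> \<rat>. x < q})" for \<omega> by (rule bdd_belowI2[of _ 0]) simp
qed (use assms in measurable)

text \<open>Half-open intervals generate the Borel sets, and their measures are differences of measurable
functions.\<close>

lemma rc_version_kernel:
  assumes "\<And>x. (\<lambda>\<omega>. Fh \<omega> x) \<in> borel_measurable N"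
  shows "(\<lambda>\<omega>. interval_measure (rc_version (Fh \<omega>))) \<in> measurable N (subprob_algebra borel)"
proof (rule measurable_subprob_algebra_generated[where \<Omega> = UNIV and G = "range (\<lambda>(a, b). {a<..b::real})"])
  have Ioc: "emeasure (interval_measure (rc_version (Fh \<omega>))) {a<..b} = (if a \<le> b then ennreal (rc_version (Fh \<omega>) b - rc_version (Fh \<omega>) a) else 0)" for \<omega> a b
    by (simp add: emeasure_interval_measure_Ioc_eq[OF rc_version_mono rc_version_right_cont])
  have U: "emeasure (interval_measure (rc_version (Fh \<omega>))) UNIV = (SUP i. emeasure (interval_measure (rc_version (Fh \<omega>))) {- real i<..real i})" for \<omega>
    by (subst SUP_emeasure_incseq) (auto simp: incseq_def UN_Ioc_eq_UNIV)
  show "sets borel = sigma_sets UNIV (range (\<lambda>(a, b). {a<..b::real}))"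
    by (subst borel_sigma_sets_Ioc) (rule sets_measure_of, simp)
  show "Int_stable (range (\<lambda>(a, b). {a<..b::real}))" by (auto simp: Int_stable_def)
  show "subprob_space (interval_measure (rc_version (Fh \<omega>)))" for \<omega>
  proof (rule subprob_spaceI)
    show "emeasure (interval_measure (rc_version (Fh \<omega>))) (space (interval_measure (rc_version (Fh \<omega>)))) \<le> 1"
      unfolding space_interval_measure U Ioc
    proof (rule SUP_least)
      fix i
      have "rc_version (Fh \<omega>) (real i) - rc_version (Fh \<omega>) (- real i) \<le> 1"
        using rc_version_bounds(2)[of "Fh \<omega>" "real i"] rc_version_bounds(1)[of "Fh \<omega>" "- real i"] by linarith
      then show "(if - real i \<le> real i then ennreal (rc_version (Fh \<omega>) (real i) - rc_version (Fh \<omega>) (- real i)) else 0) \<le> 1"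
        by (auto simp: ennreal_le_1)
    qed
  qed simp
  have m: "(\<lambda>\<omega>. emeasure (interval_measure (rc_version (Fh \<omega>))) {a<..b}) \<in> borel_measurable N" for a b
    unfolding Ioc using rc_version_measurable[OF assms] by measurable
  then show "(\<lambda>\<omega>. emeasure (interval_measure (rc_version (Fh \<omega>))) A) \<in> borel_measurable N" if "A \<in> range (\<lambda>(a, b). {a<..b})" for A
    using that by auto
  show "(\<lambda>\<omega>. emeasure (interval_measure (rc_version (Fh \<omega>))) UNIV) \<in> borel_measurable N"
    unfolding U using m by measurable
qed auto

lemma stieltjes_measurable_version:
  fixes f :: "real \<Rightarrow> real"
  assumes Fh: "\<And>x. (\<lambda>\<omega>. Fh \<omega> x) \<in> borel_measurable N"
    and f: "(\<lambda>x. indicator {0<..} x * f x) \<in> borel_measurable borel"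
  shows "(\<lambda>\<omega>. stieltjes (rc_version (Fh \<omega>)) f) \<in> borel_measurable N"
proof -
  note k = rc_version_kernel[OF Fh]
  have "(\<lambda>\<omega>. LINT x|interval_measure (rc_version (Fh \<omega>)). indicator {0<..} x * f x) \<in> borel_measurable N"
    by (rule measurable_compose[OF k integral_measurable_subprob_algebra[OF f]])
  then show ?thesis by (simp add: stieltjes_def set_lebesgue_integral_def)
qed

lemma borel_measurable_vec_lambda:
  fixes g :: "'w \<Rightarrow> 'q::finite \<Rightarrow> real"
  assumes "\<And>k. (\<lambda>\<omega>. g \<omega> k) \<in> borel_measurable N"
  shows "(\<lambda>\<omega>. \<chi> k. g \<omega> k) \<in> borel_measurable N"
  by (subst borel_measurable_euclidean_space) (auto simp: Basis_vec_def inner_axis assms)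

text \<open>Preimages under a function that is measurable for the sigma-algebra generated by \<open>U\<close> are preimages
under \<open>U\<close>.\<close>

lemma (in prob_space) indep_var_of_indep_elements:
  assumes ind: "indep_elements M U V"
    and A: "A \<in> borel_measurable (vimage_algebra (space M) U borel)"
    and B: "B \<in> borel_measurable (vimage_algebra (space M) V borel)"
  shows "indep_var borel A borel B"
proof -
  have UM: "U \<in> borel_measurable M" and VM: "V \<in> borel_measurable M"
    and iset: "indep_set {U -` A \<inter> space M |A. A \<in> sets borel} {V -` B \<inter> space M |B. B \<in> sets borel}"
    using ind by (auto simp: indep_elements_def)
  have sub: "sigma_sets (space M) {A -` S \<inter> space M | S. S \<in> sets borel} \<subseteq> {U -` S \<inter> space M |S. S \<in> sets borel}"
    if A: "A \<in> borel_measurable (vimage_algebra (space M) U borel)" for A :: "'a \<Rightarrow> 'd::topological_space" and U :: "'a \<Rightarrow> 'e::topological_space"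
  proof -
    have v: "sets (vimage_algebra (space M) U borel) = {U -` S \<inter> space M |S. S \<in> sets borel}"
      by (rule sets_vimage_algebra2) simp
    have "A -` S \<inter> space M \<in> sets (vimage_algebra (space M) U borel)" if "S \<in> sets borel" for S
      using measurable_sets[OF A that] by simp
    then have "sigma_sets (space M) {A -` S \<inter> space M | S. S \<in> sets borel} \<subseteq> sets (vimage_algebra (space M) U borel)"
      using sets.sigma_sets_subset[of "{A -` S \<inter> space M | S. S \<in> sets borel}" "vimage_algebra (space M) U borel"] by auto
    then show ?thesis by (simp add: v)
  qed
  have meas: "A \<in> borel_measurable M" if A: "A \<in> borel_measurable (vimage_algebra (space M) U borel)" and U: "U \<in> borel_measurable M"
    for A :: "'a \<Rightarrow> 'd::topological_space" and U :: "'a \<Rightarrow> 'e::topological_space"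
    using measurable_compose[OF _ A, of "\<lambda>x. x" M] U
    by (simp add: measurable_vimage_algebra2)
  have "indep_set (sigma_sets (space M) {A -` S \<inter> space M | S. S \<in> sets borel}) (sigma_sets (space M) {B -` S \<inter> space M | S. S \<in> sets borel})"
    using iset sub[OF A] sub[OF B] unfolding indep_set_def
    by (rule_tac indep_sets_mono_sets) (auto split: bool.split)
  then show ?thesis using meas[OF A UM] meas[OF B VM] by (simp add: indep_var_eq)
qed

section \<open>The density ratio as an exponential tilt\<close>

lemma GDERIV_along_curve:
  fixes f :: "'v::euclidean_space \<Rightarrow> real"
  assumes "GDERIV f (\<gamma> t) :> D" "(\<gamma> has_vector_derivative v) (at t)"
  shows "((\<lambda>s. f (\<gamma> s)) has_field_derivative (v \<bullet> D)) (at t)"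
proof -
  have "((\<lambda>s. f (\<gamma> s)) has_derivative (\<lambda>d. (d *\<^sub>R v) \<bullet> D)) (at t)"
    using assms unfolding gderiv_def has_vector_derivative_def by (rule has_derivative_compose[rotated])
  moreover have "(\<lambda>d. (d *\<^sub>R v) \<bullet> D) = (*) (v \<bullet> D)" by (auto simp: fun_eq_iff)
  ultimately show ?thesis unfolding has_field_derivative_def by simp
qed

lemma constant_along_segment:
  fixes f :: "'v::euclidean_space \<Rightarrow> real"
  assumes S: "convex S" "p \<in> S" "q \<in> S"
    and D: "\<And>x. x \<in> S \<Longrightarrow> GDERIV f x :> D x" and z: "\<And>x. x \<in> S \<Longrightarrow> (q - p) \<bullet> D x = 0"
  shows "f p = f q"
proof -
  let ?\<gamma> = "\<lambda>t. p + t *\<^sub>R (q - p)"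
  have mem: "?\<gamma> t \<in> S" if "t \<in> {0..1}" for t
    using convexD_alt[OF S(1) S(2) S(3), of t] that by (simp add: algebra_simps)
  have "\<exists>c. \<forall>t\<in>{0..1}. f (?\<gamma> t) = c"
  proof (rule has_field_derivative_zero_constant)
    fix t :: real assume t: "t \<in> {0..1}"
    have v: "(?\<gamma> has_vector_derivative (q - p)) (at t)"
      by (auto intro!: derivative_eq_intros)
    have "((\<lambda>t. f (?\<gamma> t)) has_field_derivative ((q - p) \<bullet> D (?\<gamma> t))) (at t)"
      by (rule GDERIV_along_curve[OF D[OF mem[OF t]] v])
    then show "((\<lambda>t. f (?\<gamma> t)) has_field_derivative 0) (at t within {0..1})"
      using z[OF mem[OF t]] by (simp add: has_field_derivative_at_within)
  qed simp
  then obtain c where "\<And>t. t \<in> {0..1} \<Longrightarrow> f (?\<gamma> t) = c" by blast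
  from this[of 0] this[of 1] show ?thesis by simp
qed

lemma convex_param_space:
  fixes a :: "'q::finite \<Rightarrow> ereal"
  shows "convex (param_space a)"
proof -
  have "convex {\<theta>::real^'q. a j < ereal (\<theta> $ j)}" for j
  proof (cases "a j")
    case (real r)
    have "{\<theta>::real^'q. a j < ereal (\<theta> $ j)} = {\<theta>. axis j 1 \<bullet> \<theta> > r}" by (auto simp: real inner_axis')
    then show ?thesis by (simp add: convex_halfspace_gt)
  qed auto
  moreover have "param_space a = (\<Inter>j. {\<theta>. a j < ereal (\<theta> $ j)})" by (auto simp: param_space_def)
  ultimately show ?thesis by (auto intro: convex_INT)
qed

lemma update_coord_nth:
  "update_coord \<theta> i s $ j = (if j = i then s else \<theta> $ j)"
  by (simp add: update_coord_def)

lemma update_coord_eq: "update_coord \<theta> i s = \<theta> + (s - \<theta> $ i) *\<^sub>R axis i 1"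
  by (auto simp: update_coord_def vec_eq_iff axis_def)

lemma update_coord_vector_derivative: "(update_coord \<theta> i has_vector_derivative axis i 1) (at s)"
  unfolding update_coord_eq[abs_def] by (auto intro!: derivative_eq_intros)

lemma update_coord_in: "\<theta> \<in> param_space a \<Longrightarrow> a i < ereal s \<Longrightarrow> update_coord \<theta> i s \<in> param_space a"
  by (auto simp: param_space_def update_coord_def)

text \<open>A solution of \<open>g' = k g\<close> that vanishes at \<open>z\<close> vanishes from \<open>z\<close> on: with \<open>K\<close> a bound for \<open>k\<close>, the
function \<open>(g u)\<^sup>2 * exp (- 2 * K * u)\<close> is nonincreasing and nonnegative.\<close>

lemma linear_ode_positive:
  fixes g k :: "real \<Rightarrow> real"
  assumes st: "s \<le> t" and g: "\<And>u. s \<le> u \<Longrightarrow> u \<le> t \<Longrightarrow> (g has_real_derivative g u * k u) (at u)"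
    and k: "continuous_on {s..t} k" and pos: "0 < g t"
  shows "0 < g s"
proof (rule ccontr)
  assume "\<not> 0 < g s"
  then have "g s \<le> 0" by simp
  moreover have "\<forall>u. s \<le> u \<and> u \<le> t \<longrightarrow> isCont g u" using g DERIV_isCont by blast
  ultimately obtain z where z: "s \<le> z" "z \<le> t" "g z = 0"
    using IVT[of g s 0 t] pos st by auto
  have "bounded (k ` {s..t})" by (rule compact_imp_bounded[OF compact_continuous_image[OF k]]) simp
  then obtain K where "\<forall>y\<in>k ` {s..t}. norm y \<le> K" unfolding bounded_iff by blast
  then have K: "\<And>u. s \<le> u \<Longrightarrow> u \<le> t \<Longrightarrow> \<bar>k u\<bar> \<le> K" by auto
  let ?P = "\<lambda>u. (g u)\<^sup>2 * exp (- (2 * K * u))"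
  have "?P t \<le> ?P z"
  proof (rule DERIV_nonpos_imp_nonincreasing[OF z(2)])
    fix u assume u: "z \<le> u" "u \<le> t"
    have "(?P has_real_derivative (2 * (g u * (g u * k u)) * exp (- (2 * K * u)) + (g u)\<^sup>2 * (exp (- (2 * K * u)) * (- (2 * K))))) (at u)"
      using z u by (auto intro!: derivative_eq_intros g simp: power2_eq_square)
    moreover have "2 * (g u * (g u * k u)) * exp (- (2 * K * u)) + (g u)\<^sup>2 * (exp (- (2 * K * u)) * (- (2 * K)))
        = 2 * ((g u)\<^sup>2 * exp (- (2 * K * u))) * (k u - K)"
      by (simp add: power2_eq_square algebra_simps)
    moreover have "2 * ((g u)\<^sup>2 * exp (- (2 * K * u))) * (k u - K) \<le> 0"
      using K[of u] z u by (intro mult_nonneg_nonpos) auto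
    ultimately show "\<exists>y. (?P has_real_derivative y) (at u) \<and> y \<le> 0" by metis
  qed
  then show False using z pos by (simp add: mult_le_0_iff)
qed

text \<open>The gradient identity says that the gradient of \<open>ln \<phi>\<close> has the direction \<open>(1, h2 x)\<close> and a factor
\<open>h1\<close> that is common to all \<open>x\<close>. The assumption \<open>upper\<close> serves to make \<open>\<phi>\<close> positive, so that
the logarithm may be taken.\<close>

locale exponential_tilt =
  fixes a :: "'q::finite \<Rightarrow> ereal" and i1 :: 'q and \<phi> :: "real \<Rightarrow> real ^ 'q \<Rightarrow> real"
    and h1 :: "real ^ 'q \<Rightarrow> real" and h2 :: "real \<Rightarrow> real" and \<theta>0 :: "real ^ 'q"
  assumes q: "CARD('q) = 1 \<or> CARD('q) = 2"
    and \<theta>0: "\<theta>0 \<in> param_space a"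
    and h1_pos: "\<And>\<theta>. \<theta> \<in> param_space a \<Longrightarrow> 0 < h1 \<theta>"
    and h1_cont: "continuous_on (param_space a) h1"
    and gradient: "\<And>x \<theta>. 0 \<le> x \<Longrightarrow> \<theta> \<in> param_space a \<Longrightarrow>
          GDERIV (\<phi> x) \<theta> :> (\<phi> x \<theta> * h1 \<theta>) *\<^sub>R weight i1 h2 x"
    and upper: "\<And>x \<theta>. 0 < x \<Longrightarrow> \<theta> \<in> param_space a \<Longrightarrow>
          filterlim (\<lambda>s. \<phi> x (update_coord \<theta> i1 s)) at_top at_top"
    and h2_nonconstant: "CARD('q) = 2 \<Longrightarrow> \<exists>x>0. \<exists>y>0. h2 x \<noteq> h2 y"
begin

abbreviation "\<Theta> \<equiv> param_space a"
abbreviation "w \<equiv> weight i1 h2 :: real \<Rightarrow> real ^ 'q"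

text \<open>Along the first coordinate the gradient identity is the linear equation \<open>g' = h1 g\<close>. Its solution is
positive for large arguments, hence also before.\<close>

lemma \<phi>_pos:
  assumes x: "0 < x" and \<theta>: "\<theta> \<in> \<Theta>" shows "0 < \<phi> x \<theta>"
proof -
  let ?u = "update_coord \<theta> i1"
  have "\<forall>\<^sub>F s in at_top. 0 < \<phi> x (?u s)" using upper[OF x \<theta>] by (simp add: filterlim_at_top_dense)
  with eventually_ge_at_top[of "\<theta> $ i1"] have "\<forall>\<^sub>F s in at_top. \<theta> $ i1 \<le> s \<and> 0 < \<phi> x (?u s)" by eventually_elim auto
  then obtain t where t: "\<theta> $ i1 \<le> t" "0 < \<phi> x (?u t)" by (auto simp: eventually_at_top_linorder)
  have mem: "?u s \<in> \<Theta>" if "\<theta> $ i1 \<le> s" for s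
  proof (rule update_coord_in[OF \<theta>])
    have "a i1 < ereal (\<theta> $ i1)" using \<theta> by (simp add: param_space_def)
    also have "\<dots> \<le> ereal s" using that by simp
    finally show "a i1 < ereal s" .
  qed
  have "0 < \<phi> x (?u (\<theta> $ i1))"
  proof (rule linear_ode_positive[where g = "\<lambda>s. \<phi> x (?u s)" and k = "\<lambda>s. h1 (?u s)" and t = t])
    fix s assume s: "\<theta> $ i1 \<le> s"
    have "((\<lambda>s. \<phi> x (?u s)) has_field_derivative (axis i1 1 \<bullet> ((\<phi> x (?u s) * h1 (?u s)) *\<^sub>R w x))) (at s)"
      by (rule GDERIV_along_curve[where \<gamma> = ?u, OF gradient[OF less_imp_le[OF x] mem[OF s]] update_coord_vector_derivative])
    then show "((\<lambda>s. \<phi> x (?u s)) has_real_derivative \<phi> x (?u s) * h1 (?u s)) (at s)"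
      by (simp add: inner_axis' weight_def)
  next
    have "continuous_on {\<theta> $ i1..t} ?u"
      by (rule continuous_at_imp_continuous_on) (auto intro: has_vector_derivative_continuous update_coord_vector_derivative)
    then show "continuous_on {\<theta> $ i1..t} (\<lambda>s. h1 (?u s))"
      by (rule continuous_on_compose2[OF h1_cont]) (auto intro: mem)
  qed (rule t)+
  moreover have "?u (\<theta> $ i1) = \<theta>" by (simp add: update_coord_eq)
  ultimately show ?thesis by simp
qed

lemma ln_gradient:
  assumes "0 < x" "\<theta> \<in> \<Theta>"
  shows "GDERIV (\<lambda>\<theta>. ln (\<phi> x \<theta>)) \<theta> :> h1 \<theta> *\<^sub>R w x"
proof -
  have "(\<phi> x has_derivative (\<lambda>v. v \<bullet> ((\<phi> x \<theta> * h1 \<theta>) *\<^sub>R w x))) (at \<theta>)"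
    using gradient[of x \<theta>] assms by (simp add: gderiv_def)
  from has_derivative_ln[OF \<phi>_pos[OF assms] this]
  have "((\<lambda>\<theta>. ln (\<phi> x \<theta>)) has_derivative (\<lambda>v. v \<bullet> ((\<phi> x \<theta> * h1 \<theta>) *\<^sub>R w x) * inverse (\<phi> x \<theta>))) (at \<theta>)" .
  moreover have "(\<lambda>v. v \<bullet> ((\<phi> x \<theta> * h1 \<theta>) *\<^sub>R w x) * inverse (\<phi> x \<theta>)) = (\<lambda>v. v \<bullet> (h1 \<theta> *\<^sub>R w x))"
    using \<phi>_pos[OF assms] by (simp add: fun_eq_iff field_simps)
  ultimately show ?thesis by (simp add: gderiv_def)
qed

lemma GDERIV_linear_combination:
  assumes "GDERIV f \<theta> :> D" "GDERIV g \<theta> :> E"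
  shows "GDERIV (\<lambda>\<theta>. c * f \<theta> + d * g \<theta>) \<theta> :> c *\<^sub>R D + d *\<^sub>R E"
  using assms unfolding gderiv_def by (auto intro!: derivative_eq_intros simp: inner_add_right)

lemma zero_gradient_constant:
  assumes "\<And>\<theta>. \<theta> \<in> \<Theta> \<Longrightarrow> GDERIV f \<theta> :> 0" "\<theta> \<in> \<Theta>" "\<theta>' \<in> \<Theta>"
  shows "f \<theta> = f \<theta>'"
  by (rule constant_along_segment[OF convex_param_space assms(2,3,1)]) auto

text \<open>A potential whose gradient is a multiple of one coordinate vector depends on that coordinate only, and
then so does its derivative \<open>h1\<close>.\<close>

lemma h1_coordinate:
  assumes f: "\<And>\<theta>. \<theta> \<in> \<Theta> \<Longrightarrow> GDERIV f \<theta> :> h1 \<theta> *\<^sub>R axis i 1"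
    and \<theta>: "\<theta> \<in> \<Theta>" "\<theta>' \<in> \<Theta>" and eq: "\<theta> $ i = \<theta>' $ i"
  shows "h1 \<theta> = h1 \<theta>'"
proof -
  have d: "((\<lambda>s. f (update_coord \<theta> i s)) has_field_derivative h1 \<theta>) (at (\<theta> $ i))" if "\<theta> \<in> \<Theta>" for \<theta>
  proof -
    have "GDERIV f (update_coord \<theta> i (\<theta> $ i)) :> h1 \<theta> *\<^sub>R axis i 1"
      using f[OF that] by (simp add: update_coord_eq)
    from GDERIV_along_curve[where f = f and \<gamma> = "update_coord \<theta> i" and t = "\<theta> $ i", OF this update_coord_vector_derivative]
    have "((\<lambda>s. f (update_coord \<theta> i s)) has_field_derivative (axis i (1::real) \<bullet> (h1 \<theta> *\<^sub>R axis i 1))) (at (\<theta> $ i))" .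
    then show ?thesis by (simp add: inner_axis_axis)
  qed
  have o: "open {s. a i < ereal s}" by (intro open_Collect_less continuous_intros)
  have m: "\<theta> $ i \<in> {s. a i < ereal s}" using \<theta> by (simp add: param_space_def)
  have e: "f (update_coord \<theta> i s) = f (update_coord \<theta>' i s)" if "s \<in> {s. a i < ereal s}" for s
  proof (rule constant_along_segment[OF convex_param_space _ _ f])
    show "update_coord \<theta> i s \<in> \<Theta>" "update_coord \<theta>' i s \<in> \<Theta>" using that \<theta> by (auto intro: update_coord_in)
    show "(update_coord \<theta>' i s - update_coord \<theta> i s) \<bullet> (h1 x *\<^sub>R axis i 1) = 0" for x
      by (simp add: inner_axis update_coord_def)
  qed
  have "((\<lambda>s. f (update_coord \<theta>' i s)) has_field_derivative h1 \<theta>) (at (\<theta> $ i))"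
    by (rule has_field_derivative_transform_within_open[OF d[OF \<theta>(1)] o m e])
  from DERIV_unique[OF this d[OF \<theta>(2), folded eq]] show ?thesis .
qed

text \<open>With two points \<open>x\<close> and \<open>y\<close> at which \<open>h2\<close> differs, linear combinations of \<open>ln (\<phi> x \<theta>)\<close> and \<open>ln (\<phi> y \<theta>)\<close>
have the gradients \<open>h1 \<theta>\<close> times the first and times the second coordinate vector. So \<open>h1\<close> depends on
the first coordinate alone and also on the second alone. This is the integrability condition for
the gradient identity, and it is why two-parameter models leave no freedom in \<open>h1\<close>.\<close>

lemma h1_constant:
  assumes q2: "CARD('q) = 2" and \<theta>: "\<theta> \<in> \<Theta>"
  shows "h1 \<theta> = h1 \<theta>0"
proof -
  obtain x y where xy: "0 < x" "0 < y" "h2 x \<noteq> h2 y" using h2_nonconstant[OF q2] by blast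
  obtain u v :: 'q where uv: "UNIV = {u, v}" "u \<noteq> v" using q2 unfolding card_2_iff by blast
  then have "i1 = u \<or> i1 = v" by blast
  with uv obtain i2 where i2: "UNIV = {i1, i2}" "i2 \<noteq> i1" by (metis insert_commute)
  have w: "w x = axis i1 1 + h2 x *\<^sub>R axis i2 1" for x
    using i2 by (auto simp: vec_eq_iff weight_def axis_def)
  let ?l = "\<lambda>x \<theta>. ln (\<phi> x \<theta>)"
  let ?c = "h2 x - h2 y"
  have c: "?c \<noteq> 0" using xy by simp
  have g2: "GDERIV (\<lambda>\<theta>. (1 / ?c) * ?l x \<theta> + (- 1 / ?c) * ?l y \<theta>) \<theta> :> h1 \<theta> *\<^sub>R axis i2 1" if "\<theta> \<in> \<Theta>" for \<theta>
  proof -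
    have "(1 / ?c) *\<^sub>R (h1 \<theta> *\<^sub>R w x) + (- 1 / ?c) *\<^sub>R (h1 \<theta> *\<^sub>R w y) = h1 \<theta> *\<^sub>R axis i2 1"
      using c by (simp add: w algebra_simps scaleR_left_diff_distrib[symmetric] diff_divide_distrib[symmetric])
        (simp add: field_simps)?
    then show ?thesis using GDERIV_linear_combination[OF ln_gradient[OF xy(1) that] ln_gradient[OF xy(2) that], of "1 / ?c" "- 1 / ?c"] by simp
  qed
  have g1: "GDERIV (\<lambda>\<theta>. (- h2 y / ?c) * ?l x \<theta> + (h2 x / ?c) * ?l y \<theta>) \<theta> :> h1 \<theta> *\<^sub>R axis i1 1" if "\<theta> \<in> \<Theta>" for \<theta>
  proof -
    have "(- h2 y / ?c) *\<^sub>R (h1 \<theta> *\<^sub>R w x) + (h2 x / ?c) *\<^sub>R (h1 \<theta> *\<^sub>R w y) = h1 \<theta> *\<^sub>R axis i1 1"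
      using c by (simp add: w algebra_simps scaleR_left_diff_distrib[symmetric] diff_divide_distrib[symmetric])
        (simp add: field_simps)?
    then show ?thesis using GDERIV_linear_combination[OF ln_gradient[OF xy(1) that] ln_gradient[OF xy(2) that], of "- h2 y / ?c" "h2 x / ?c"] by simp
  qed
  \<comment> \<open>From \<open>\<theta>\<close> to \<open>\<theta>0\<close> in two steps, each of which keeps one coordinate.\<close>
  let ?m = "update_coord \<theta> i1 (\<theta>0 $ i1)"
  have m: "?m \<in> \<Theta>" by (rule update_coord_in[OF \<theta>]) (use \<theta>0 in \<open>simp add: param_space_def\<close>)
  have "\<theta> $ i2 = ?m $ i2" using i2(2) by (simp add: update_coord_nth)
  have "h1 \<theta> = h1 ?m"
  proof (rule h1_coordinate[where i = i2])
    show "\<theta> $ i2 = ?m $ i2" by fact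
  qed (rule g2 \<theta> m, assumption?)+
  also have "\<dots> = h1 \<theta>0"
  proof (rule h1_coordinate[where i = i1])
    show "?m $ i1 = \<theta>0 $ i1" by (simp add: update_coord_nth)
  qed (rule g1 m \<theta>0, assumption?)+
  finally show ?thesis .
qed

text \<open>With two parameters \<open>h1\<close> is constant and \<open>\<eta>\<close> is a multiple of \<open>\<theta> - \<theta>0\<close>. With one parameter all
\<open>ln (\<phi> x \<theta>)\<close> have the same derivative, so their increments agree with the one at \<open>x = 1\<close>, which serves as
\<open>\<eta>\<close>; it is strictly increasing in \<open>\<theta>\<close>, and this gives the inverse continuity at \<open>\<theta>0\<close>. The three
properties of \<open>\<eta>\<close> transfer roots, consistency and the first-order expansion between \<open>\<theta>\<close> and the
regression parameter.\<close>

theorem tilt_structure: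
  "\<exists>\<eta>. \<eta> \<theta>0 = (0::real^'q) \<and>
     (\<eta> has_derivative (\<lambda>v. h1 \<theta>0 *\<^sub>R v)) (at \<theta>0) \<and>
     (\<forall>e>0. \<exists>d>0. \<forall>\<theta>\<in>\<Theta>. norm (\<eta> \<theta>) < d \<longrightarrow> norm (\<theta> - \<theta>0) < e) \<and>
     (\<forall>x>0. \<forall>\<theta>\<in>\<Theta>. \<phi> x \<theta> = \<phi> x \<theta>0 * exp (\<eta> \<theta> \<bullet> w x))"
  using q
proof
  assume q1: "CARD('q) = 1"
  then have all: "j = i1" for j by (metis card_1_singletonE UNIV_I singletonD)
  have v: "v = v $ i1 *\<^sub>R axis i1 1" for v :: "real^'q"
    by (simp add: vec_eq_iff axis_def) (metis all)
  have wx: "w x = axis i1 1" for x by (simp add: vec_eq_iff weight_def axis_def) (metis all)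
  define \<eta> :: "real^'q \<Rightarrow> real^'q" where "\<eta> \<theta> = (ln (\<phi> 1 \<theta>) - ln (\<phi> 1 \<theta>0)) *\<^sub>R axis i1 1" for \<theta>
  have exp: "\<phi> x \<theta> = \<phi> x \<theta>0 * exp (\<eta> \<theta> \<bullet> w x)" if x: "0 < x" and \<theta>: "\<theta> \<in> \<Theta>" for x \<theta>
  proof -
    have "GDERIV (\<lambda>\<theta>. 1 * ln (\<phi> x \<theta>) + (-1) * ln (\<phi> 1 \<theta>)) \<theta> :> 0" if "\<theta> \<in> \<Theta>" for \<theta>
      using GDERIV_linear_combination[OF ln_gradient[OF x that] ln_gradient[OF zero_less_one that], of 1 "-1"]
      by (simp add: wx)
    from zero_gradient_constant[OF this \<theta> \<theta>0]
    have "ln (\<phi> x \<theta>) = ln (\<phi> x \<theta>0) + \<eta> \<theta> \<bullet> w x" by (simp add: \<eta>_def wx inner_axis_axis)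
    then have "exp (ln (\<phi> x \<theta>)) = exp (ln (\<phi> x \<theta>0)) * exp (\<eta> \<theta> \<bullet> w x)" by (simp add: exp_add)
    then show ?thesis using \<phi>_pos[OF x \<theta>] \<phi>_pos[OF x \<theta>0] by simp
  qed
  have deriv: "(\<eta> has_derivative (\<lambda>v. h1 \<theta>0 *\<^sub>R v)) (at \<theta>0)"
  proof -
    have "((\<lambda>\<theta>. ln (\<phi> 1 \<theta>)) has_derivative (\<lambda>v. v \<bullet> (h1 \<theta>0 *\<^sub>R w 1))) (at \<theta>0)"
      using ln_gradient[OF zero_less_one \<theta>0] by (simp add: gderiv_def)
    from has_derivative_scaleR_left[OF has_derivative_diff[OF this has_derivative_const]]
    have "(\<eta> has_derivative (\<lambda>u. (u \<bullet> (h1 \<theta>0 *\<^sub>R w 1) - 0) *\<^sub>R axis i1 1)) (at \<theta>0)"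
      unfolding \<eta>_def[abs_def] .
    moreover have "(u \<bullet> (h1 \<theta>0 *\<^sub>R w 1)) *\<^sub>R axis i1 1 = h1 \<theta>0 *\<^sub>R u" for u
      by (subst (2) v) (simp add: wx inner_axis)
    ultimately show ?thesis by simp
  qed
  let ?G = "\<lambda>s. ln (\<phi> 1 (update_coord \<theta>0 i1 s))"
  have up: "\<theta> = update_coord \<theta>0 i1 (\<theta> $ i1)" for \<theta>
    by (simp add: vec_eq_iff update_coord_def) (metis all)
  have mono: "?G s < ?G t" if st: "s < t" and s: "a i1 < ereal s" for s t
  proof (rule DERIV_pos_imp_increasing[OF st])
    fix u assume "s \<le> u" "u \<le> t"
    then have "a i1 < ereal u" using s by (metis ereal_less_eq(3) order_less_le_trans)
    then have m: "update_coord \<theta>0 i1 u \<in> \<Theta>" by (rule update_coord_in[OF \<theta>0])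
    have "(?G has_field_derivative (axis i1 1 \<bullet> (h1 (update_coord \<theta>0 i1 u) *\<^sub>R w 1))) (at u)"
      by (rule GDERIV_along_curve[where \<gamma> = "update_coord \<theta>0 i1", OF ln_gradient[OF zero_less_one m] update_coord_vector_derivative])
    then show "\<exists>y. (?G has_real_derivative y) (at u) \<and> 0 < y"
      using h1_pos[OF m] by (auto simp: wx inner_axis_axis)
  qed
  have inv: "\<exists>d>0. \<forall>\<theta>\<in>\<Theta>. norm (\<eta> \<theta>) < d \<longrightarrow> norm (\<theta> - \<theta>0) < e" if e: "e > 0" for e
  proof -
    let ?t = "\<theta>0 $ i1"
    have "open {s. a i1 < ereal s}" by (intro open_Collect_less continuous_intros)
    moreover have "?t \<in> {s. a i1 < ereal s}" using \<theta>0 by (simp add: param_space_def)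
    ultimately obtain r where r: "r > 0" "ball ?t r \<subseteq> {s. a i1 < ereal s}" by (metis openE)
    define d where "d = min e r / 2"
    have d: "d > 0" "d < e" "d < r" using e r by (auto simp: d_def)
    have "?t - d \<in> ball ?t r" using d by (simp add: dist_real_def)
    then have ad: "a i1 < ereal (?t - d)" using r by blast
    have up0: "update_coord \<theta>0 i1 ?t = \<theta>0" using up[of \<theta>0] by simp
    define \<delta> where "\<delta> = min (?G (?t + d) - ?G ?t) (?G ?t - ?G (?t - d))"
    have at: "a i1 < ereal ?t" using \<theta>0 by (simp add: param_space_def)
    have \<delta>: "\<delta> > 0" using mono[of ?t "?t + d"] mono[of "?t - d" ?t] at ad d by (simp add: \<delta>_def)
    have "norm (\<theta> - \<theta>0) < e" if \<theta>: "\<theta> \<in> \<Theta>" "norm (\<eta> \<theta>) < \<delta>" for \<theta>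
    proof -
      have "norm (\<eta> \<theta>) = \<bar>?G (\<theta> $ i1) - ?G ?t\<bar>"
        using up[of \<theta>] by (simp add: \<eta>_def norm_axis_1 up0)
      then have b: "?G (\<theta> $ i1) < ?G (?t + d)" "?G (?t - d) < ?G (\<theta> $ i1)"
        using \<theta>(2) by (auto simp: \<delta>_def)
      have 1: "\<theta> $ i1 < ?t + d"
      proof (rule ccontr)
        assume "\<not> \<theta> $ i1 < ?t + d"
        then have "?G (?t + d) \<le> ?G (\<theta> $ i1)"
          using mono[of "?t + d" "\<theta> $ i1"] less_trans[OF at, of "ereal (?t + d)"] d
          by (cases "\<theta> $ i1 = ?t + d") auto
        with b show False by simp
      qed
      have 2: "?t - d < \<theta> $ i1"
      proof (rule ccontr)
        assume "\<not> ?t - d < \<theta> $ i1"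
        moreover have "a i1 < ereal (\<theta> $ i1)" using \<theta>(1) by (simp add: param_space_def)
        ultimately have "?G (\<theta> $ i1) \<le> ?G (?t - d)"
          using mono[of "\<theta> $ i1" "?t - d"] by (cases "\<theta> $ i1 = ?t - d") auto
        with b show False by simp
      qed
      have "norm (\<theta> - \<theta>0) = \<bar>\<theta> $ i1 - ?t\<bar>" by (subst v) (simp add: norm_axis_1)
      then show ?thesis using 1 2 d by linarith
    qed
    then show ?thesis using \<delta> by blast
  qed
  have "\<eta> \<theta>0 = 0" by (simp add: \<eta>_def)
  then show ?thesis using exp deriv inv by blast
next
  assume q2: "CARD('q) = 2"
  let ?h = "h1 \<theta>0"
  have h: "?h > 0" by (rule h1_pos[OF \<theta>0])
  define \<eta> :: "real^'q \<Rightarrow> real^'q" where "\<eta> \<theta> = ?h *\<^sub>R (\<theta> - \<theta>0)" for \<theta>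
  have exp: "\<phi> x \<theta> = \<phi> x \<theta>0 * exp (\<eta> \<theta> \<bullet> w x)" if x: "0 < x" and \<theta>: "\<theta> \<in> \<Theta>" for x \<theta>
  proof -
    have lin: "GDERIV (\<lambda>\<theta>. \<theta> \<bullet> (?h *\<^sub>R w x)) \<theta> :> ?h *\<^sub>R w x" for \<theta>
      unfolding gderiv_def by (auto intro!: derivative_eq_intros)
    have "GDERIV (\<lambda>\<theta>. 1 * ln (\<phi> x \<theta>) + (-1) * (\<theta> \<bullet> (?h *\<^sub>R w x))) \<theta> :> 0" if "\<theta> \<in> \<Theta>" for \<theta>
      using GDERIV_linear_combination[OF ln_gradient[OF x that] lin, of 1 "-1"]
      by (simp add: h1_constant[OF q2 that])
    from zero_gradient_constant[OF this \<theta> \<theta>0]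
    have "ln (\<phi> x \<theta>) = ln (\<phi> x \<theta>0) + \<eta> \<theta> \<bullet> w x" by (simp add: \<eta>_def inner_diff_left algebra_simps)
    then have "exp (ln (\<phi> x \<theta>)) = exp (ln (\<phi> x \<theta>0)) * exp (\<eta> \<theta> \<bullet> w x)" by (simp add: exp_add)
    then show ?thesis using \<phi>_pos[OF x \<theta>] \<phi>_pos[OF x \<theta>0] by simp
  qed
  have "(\<eta> has_derivative (\<lambda>v. ?h *\<^sub>R v)) (at \<theta>0)"
    unfolding \<eta>_def[abs_def] by (auto intro!: derivative_eq_intros)
  moreover have "\<exists>d>0. \<forall>\<theta>\<in>\<Theta>. norm (\<eta> \<theta>) < d \<longrightarrow> norm (\<theta> - \<theta>0) < e" if "e > 0" for e
    using h that by (intro exI[of _ "?h * e"]) (auto simp: \<eta>_def)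
  moreover have "\<eta> \<theta>0 = 0" by (simp add: \<eta>_def)
  ultimately show ?thesis using exp by blast
qed

end

section \<open>Distribution functions with a density and the supremum norm\<close>

lemma (in prob_space) sample_df:
  assumes d: "distributed M lborel X (\<lambda>x. ennreal (f x))" and nonneg: "AE \<omega> in M. 0 \<le> X \<omega>"
    and F: "F = cdf (density lborel (\<lambda>x. ennreal (f x)))"
  shows "mono F" "\<And>x. isCont F x" "\<And>x. x \<le> 0 \<Longrightarrow> F x = 0" "(F \<longlongrightarrow> 1) at_top"
    and "interval_measure F = density lborel (\<lambda>x. ennreal (f x))"
proof -
  let ?N = "density lborel (\<lambda>x. ennreal (f x))"
  have fm[measurable]: "(\<lambda>x. ennreal (f x)) \<in> borel_measurable lborel"
    by (rule distributed_borel_measurable[OF d])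
  have Xm[measurable]: "X \<in> measurable M lborel" by (rule distributed_measurable[OF d])
  have N: "distr M lborel X = ?N" by (rule distributed_distr_eq_density[OF d])
  have "prob_space ?N" unfolding N[symmetric] by (rule prob_space_distr) (rule Xm)
  then interpret N: real_distribution ?N
    by (simp add: real_distribution_def real_distribution_axioms_def)
  have pt: "measure ?N {x} = 0" for x
  proof -
    have "emeasure ?N {x} = (\<integral>\<^sup>+y. ennreal (f y) * indicator {x} y \<partial>lborel)"
      by (rule emeasure_density) auto
    also have "\<dots> = (\<integral>\<^sup>+y. 0 \<partial>(lborel :: real measure))"
      by (rule nn_integral_cong_AE) (use AE_lborel_singleton[of x] in \<open>auto elim!: eventually_mono\<close>)
    finally show ?thesis by (simp add: measure_def)
  qed
  show m: "mono F" unfolding F by (rule monoI) (rule N.cdf_nondecreasing)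
  show c: "isCont F x" for x unfolding F by (simp add: N.isCont_cdf pt)
  show t: "(F \<longlongrightarrow> 1) at_top" unfolding F by (rule N.cdf_lim_at_top_prob)
  have "measure ?N {..<0} = prob (X -` {..<0} \<inter> space M)"
    unfolding N[symmetric] by (rule measure_distr[OF Xm]) simp
  also have "\<dots> = 0"
  proof -
    have "AE \<omega> in M. \<omega> \<notin> X -` {..<0} \<inter> space M" using nonneg by eventually_elim auto
    then show ?thesis by (subst prob_eq_0) auto
  qed
  finally have "measure ?N {..<0} = 0" .
  moreover have "measure ?N ({..<0} \<union> {0}) = measure ?N {..<0} + measure ?N {0}"
    by (rule N.finite_measure_Union) auto
  moreover have "{..<0} \<union> {0} = {..0::real}" by auto
  ultimately have "measure ?N {..0} = 0" by (simp only: pt)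
  then have F0: "F 0 = 0" by (simp add: F cdf_def)
  show z: "F x = 0" if "x \<le> 0" for x
    using monoD[OF m that] N.cdf_nonneg[of x] F0 by (simp add: F)
  have rc: "continuous (at_right a) F" for a using c by (rule continuous_at_imp_continuous_at_within)
  have b: "(F \<longlongrightarrow> 0) at_bot"
    by (rule tendsto_eventually) (use z in \<open>auto simp: eventually_at_bot_linorder\<close>)
  show "interval_measure F = ?N"
  proof (rule cdf_unique)
    show "real_distribution (interval_measure F)"
      using monoD[OF m] rc b t by (rule real_distribution_interval_measure)
    show "cdf (interval_measure F) = cdf ?N"
      unfolding F[symmetric] using monoD[OF m] rc b by (rule cdf_interval_measure)
  qed (rule N.real_distribution_axioms)
qed

text \<open>The truncation at 0 matches the conversion of the density to extended nonnegative values.\<close>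

lemma stieltjes_density:
  assumes F: "interval_measure F = density lborel (\<lambda>x. ennreal (f x))"
    and f: "(\<lambda>x. ennreal (f x)) \<in> borel_measurable lborel" and u: "ctble_disc u"
  shows "stieltjes F u = (LINT x|lborel. max 0 (f x) * (indicator {0<..} x * u x))"
proof -
  have "(\<lambda>x. enn2real (ennreal (f x))) \<in> borel_measurable lborel" using f by measurable
  moreover have "enn2real (ennreal y) = max 0 y" for y
    by (cases "0 \<le> y") (auto simp: ennreal_neg)
  ultimately have fm: "(\<lambda>x. max 0 (f x)) \<in> borel_measurable lborel" by simp
  have "(\<lambda>x. ennreal (f x)) = (\<lambda>x. ennreal (max 0 (f x)))"
    by (intro ext) (auto simp: max_def ennreal_neg)
  then show ?thesis
    unfolding stieltjes_eq F using ctble_disc_measurable[OF u] fm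
    by (simp add: integral_density del: ennreal_max_0)
qed

text \<open>Boundedness is what makes \<open>sup_norm0\<close> a genuine supremum.\<close>

lemma sup_norm0_bound:
  assumes "\<And>t. 0 \<le> t \<Longrightarrow> \<bar>f t\<bar> \<le> B"
  shows "0 \<le> t \<Longrightarrow> \<bar>f t\<bar> \<le> sup_norm0 f" "0 \<le> sup_norm0 f" "sup_norm0 f \<le> B"
proof -
  have bdd: "bdd_above ((\<lambda>x. \<bar>f x\<bar>) ` {0..})" using assms by (intro bdd_aboveI2[of _ _ B]) auto
  show up: "\<bar>f t\<bar> \<le> sup_norm0 f" if "0 \<le> t" for t
    unfolding sup_norm0_def by (rule cSUP_upper[OF _ bdd]) (use that in simp)
  show "0 \<le> sup_norm0 f" using up[of 0] by simp
  show "sup_norm0 f \<le> B" unfolding sup_norm0_def by (rule cSUP_least) (use assms in auto)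
qed

lemma sub_df_bounds: assumes "sub_df F" shows "0 \<le> F x" "F x \<le> 1"
proof -
  have "mono F" and "F (min x 0) = 0" "F x \<le> 1" using assms by (auto simp: sub_df_def)
  moreover have "F (min x 0) \<le> F x" using \<open>mono F\<close> by (rule monoD) simp
  ultimately show "0 \<le> F x" "F x \<le> 1" by auto
qed

lemma sup_norm0_pointwise:
  assumes Fs: "\<And>m. sub_df (Fs m)" and F0: "\<And>x. 0 \<le> F0 x" "\<And>x. F0 x \<le> (1::real)" "\<And>x. x \<le> 0 \<Longrightarrow> F0 x = 0"
    and lim: "(\<lambda>m. sup_norm0 (\<lambda>x. Fs m x - F0 x)) \<longlonglongrightarrow> 0"
  shows "(\<lambda>m. Fs m x) \<longlonglongrightarrow> F0 x"
proof (cases "0 \<le> x")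
  case True
  have "\<bar>Fs m t - F0 t\<bar> \<le> 1" for m t
    using sub_df_bounds[OF Fs[of m], of t] F0(1,2)[of t] by (auto simp: abs_le_iff)
  then have "\<bar>Fs m x - F0 x\<bar> \<le> sup_norm0 (\<lambda>x. Fs m x - F0 x)" for m
    by (rule sup_norm0_bound(1)) (rule True)
  then have "(\<lambda>m. Fs m x - F0 x) \<longlonglongrightarrow> 0"
    by (intro Lim_null_comparison[OF _ lim] always_eventually) auto
  then show ?thesis by (rule LIM_zero_cancel)
next
  case False
  then have "Fs m x = 0" for m using Fs[of m] by (simp add: sub_df_def)
  then show ?thesis using F0(3)[of x] False by simp
qed

lemma sup_norm0_tendsto_0:
  assumes "\<And>e. 0 < e \<Longrightarrow> \<forall>\<^sub>F m in sequentially. \<forall>t\<ge>0. \<bar>f m t\<bar> < e"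
  shows "(\<lambda>m. sup_norm0 (f m)) \<longlonglongrightarrow> 0"
proof (rule tendstoI)
  fix e :: real assume e: "0 < e"
  have "\<forall>\<^sub>F m in sequentially. \<forall>t\<ge>0. \<bar>f m t\<bar> < e / 2" by (rule assms) (use e in simp)
  then show "\<forall>\<^sub>F m in sequentially. dist (sup_norm0 (f m)) 0 < e"
  proof eventually_elim
    case (elim m)
    then have "\<And>t. 0 \<le> t \<Longrightarrow> \<bar>f m t\<bar> \<le> e / 2" by (simp add: less_imp_le)
    from sup_norm0_bound(2,3)[of "f m" "e / 2", OF this] show ?case using e by simp
  qed
qed

section \<open>Estimating equations as score equations\<close>

text \<open>With the offset \<open>ln (\<rho>1 * r / \<rho>0)\<close> the odds are \<open>\<rho>1 * r * exp s / \<rho>0\<close>, so the logistic function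
produces the two fractions in the estimating equations.\<close>

lemma logistic_ln_ratio:
  assumes "0 < \<rho>0" "0 < \<rho>1" "0 < r"
  shows "logistic (ln (\<rho>1 * r / \<rho>0) + s) = \<rho>1 * (r * exp s) / (\<rho>0 + \<rho>1 * (r * exp s))"
    and "1 - logistic (ln (\<rho>1 * r / \<rho>0) + s) = \<rho>0 / (\<rho>0 + \<rho>1 * (r * exp s))"
proof -
  have p: "0 < \<rho>0 + \<rho>1 * (r * exp s)" using assms by (simp add: add_pos_pos)
  have e: "exp (- (ln (\<rho>1 * r / \<rho>0) + s)) = \<rho>0 / (\<rho>1 * (r * exp s))"
    using assms by (simp add: exp_minus exp_add exp_diff field_simps)
  show 1: "logistic (ln (\<rho>1 * r / \<rho>0) + s) = \<rho>1 * (r * exp s) / (\<rho>0 + \<rho>1 * (r * exp s))"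
    unfolding logistic_def e using assms p by (simp add: divide_simps add.commute)
  show "1 - logistic (ln (\<rho>1 * r / \<rho>0) + s) = \<rho>0 / (\<rho>0 + \<rho>1 * (r * exp s))"
    unfolding 1 using p by (simp add: divide_simps)
qed

lemma ctble_disc_weight:
  "ctble_disc h \<Longrightarrow> ctble_disc (\<lambda>x. weight i1 h x $ j)"
  by (cases "j = i1") (simp_all add: weight_def)

lemma ctble_disc_log_ratio:
  assumes "0 < \<rho>0" "0 < \<rho>1" "\<And>x. 0 < x \<Longrightarrow> 0 < r x" "ctble_disc r"
  shows "ctble_disc (\<lambda>x. ln (\<rho>1 * r x / \<rho>0))"
proof (rule ctble_disc_compose[OF assms(4), of "\<lambda>u. ln (\<rho>1 * u / \<rho>0)"])
  fix x :: real assume "0 < x"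
  then have "\<rho>1 * r x / \<rho>0 \<noteq> 0" using assms(1,2) assms(3)[of x] by simp
  then have "isCont ln (\<rho>1 * r x / \<rho>0)" by (rule isCont_ln)
  moreover have "isCont (\<lambda>u. \<rho>1 * u / \<rho>0) (r x)"
    by (rule continuous_divide) (use assms(1) in \<open>auto intro!: continuous_mult\<close>)
  ultimately show "isCont (\<lambda>u. ln (\<rho>1 * u / \<rho>0)) (r x)"
    using isCont_o2[of "r x" "\<lambda>u. \<rho>1 * u / \<rho>0" ln] by simp
qed

lemma ctble_disc_logistic_predictor:
  assumes "0 < \<rho>0" "0 < \<rho>1" "\<And>x. 0 < x \<Longrightarrow> 0 < r x" "ctble_disc r" "ctble_disc h"
  shows "ctble_disc (\<lambda>x. logistic (ln (\<rho>1 * r x / \<rho>0) + \<eta> \<bullet> weight i1 h x))"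
proof -
  have "ctble_disc (\<lambda>x. \<eta> \<bullet> weight i1 h x)"
    unfolding inner_vec_def inner_real_def
    by (intro ctble_disc_sum ctble_disc_mult ctble_disc_const ctble_disc_weight assms(5))
  from ctble_disc_compose[where g = logistic, OF ctble_disc_add[OF ctble_disc_log_ratio[OF assms(1-4)] this]]
  show ?thesis by (simp add: isCont_logistic)
qed

text \<open>The estimating equations of the semiparametric model are, up to the factor \<open>\<rho>0 * \<rho>1\<close>, the score
equations of the logistic regression. The fitted mean over the second sample is combined
with the label mean, which turns the fitted probability into its complement.\<close>

lemma score_eq_estimating_function:
  fixes i1 :: "'q::finite"
  assumes F: "fin_df F" and G: "fin_df G" and \<rho>: "0 < \<rho>0" "0 < \<rho>1"
    and h: "ctble_disc h" and r: "\<And>x. 0 < x \<Longrightarrow> 0 < r x" "ctble_disc r"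
    and p: "\<And>x. 0 < x \<Longrightarrow> p x = r x * exp (\<eta> \<bullet> weight i1 h x)"
  shows "score \<rho>0 \<rho>1 F G h i1 (\<lambda>x. ln (\<rho>1 * r x / \<rho>0)) \<eta> $ j =
    \<rho>0 * \<rho>1 * (stieltjes F (\<lambda>x. p x * weight i1 h x $ j / (\<rho>0 + \<rho>1 * p x))
      - stieltjes G (\<lambda>x. weight i1 h x $ j / (\<rho>0 + \<rho>1 * p x)))"
proof -
  let ?w = "weight i1 h :: real \<Rightarrow> real^'q" and ?b = "\<lambda>x. ln (\<rho>1 * r x / \<rho>0)"
  let ?l = "\<lambda>x. logistic (?b x + \<eta> \<bullet> ?w x)"
  note wd = ctble_disc_weight[OF h, of i1] and ld = ctble_disc_logistic_predictor[OF \<rho> r h, of \<eta> i1]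
  have iG: "sintegrable G (\<lambda>x. ?w x $ j * ?l x)"
    by (rule fin_df_sintegrable[OF G ctble_disc_mult[OF wd ld]])
  have iGw: "sintegrable G (\<lambda>x. ?w x $ j)" by (rule fin_df_sintegrable[OF G wd])
  have 1: "stieltjes F (\<lambda>x. ?w x $ j * ?l x) = \<rho>1 * stieltjes F (\<lambda>x. p x * ?w x $ j / (\<rho>0 + \<rho>1 * p x))"
    unfolding stieltjes_mult[symmetric]
    by (rule stieltjes_cong) (simp add: logistic_ln_ratio(1)[OF \<rho> r(1)] p)
  have "stieltjes G (\<lambda>x. ?w x $ j) - stieltjes G (\<lambda>x. ?w x $ j * ?l x) = stieltjes G (\<lambda>x. ?w x $ j - ?w x $ j * ?l x)"
    by (rule stieltjes_diff[symmetric, OF iGw iG])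
  also have "\<dots> = stieltjes G (\<lambda>x. \<rho>0 * (?w x $ j / (\<rho>0 + \<rho>1 * p x)))"
  proof (rule stieltjes_cong)
    fix x :: real assume x: "0 < x"
    have "?w x $ j - ?w x $ j * ?l x = ?w x $ j * (1 - ?l x)" by (simp add: algebra_simps)
    also have "1 - ?l x = \<rho>0 / (\<rho>0 + \<rho>1 * p x)"
      by (simp add: logistic_ln_ratio(2)[OF \<rho> r(1)[OF x]] p[OF x])
    finally show "?w x $ j - ?w x $ j * ?l x = \<rho>0 * (?w x $ j / (\<rho>0 + \<rho>1 * p x))" by simp
  qed
  also have "\<dots> = \<rho>0 * stieltjes G (\<lambda>x. ?w x $ j / (\<rho>0 + \<rho>1 * p x))" by (rule stieltjes_mult)
  finally have 2: "stieltjes G (\<lambda>x. ?w x $ j * ?l x) = stieltjes G (\<lambda>x. ?w x $ j) - \<rho>0 * stieltjes G (\<lambda>x. ?w x $ j / (\<rho>0 + \<rho>1 * p x))"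
    by simp
  show ?thesis
    unfolding score_def pooled_def vec_lambda_beta 1 2 by (simp add: algebra_simps)
qed

lemma semiparametric_df_eq:
  fixes i1 :: "'q::finite"
  assumes F: "fin_df F" and G: "fin_df G" and \<rho>: "0 < \<rho>0" "0 < \<rho>1"
    and h: "ctble_disc h" and r: "\<And>x. 0 < x \<Longrightarrow> 0 < r x" "ctble_disc r"
    and p: "\<And>x. 0 < x \<Longrightarrow> \<phi> x \<theta> = r x * exp (\<eta> \<bullet> weight i1 h x)"
  shows "semiparametric_df \<phi> \<rho>0 \<rho>1 F G \<theta> t =
    pooled \<rho>0 \<rho>1 F G (\<lambda>x. indicator {..t} x * (1 - logistic (ln (\<rho>1 * r x / \<rho>0) + \<eta> \<bullet> weight i1 h x))) / \<rho>0"
proof -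
  let ?w = "weight i1 h :: real \<Rightarrow> real^'q" and ?b = "\<lambda>x. ln (\<rho>1 * r x / \<rho>0)"
  let ?l = "\<lambda>x. logistic (?b x + \<eta> \<bullet> ?w x)"
  note wd = ctble_disc_weight[OF h, of i1] and ld = ctble_disc_logistic_predictor[OF \<rho> r h, of \<eta> i1]
  let ?g = "\<lambda>x. indicator {..t} x * (1 - ?l x)"
  have gm: "(\<lambda>x. indicator {0<..} x * ?g x) \<in> borel_measurable borel"
    by (rule ctble_disc_measurable) (intro ctble_disc_intros ctble_disc_atMost ld)
  have "semiparametric_df \<phi> \<rho>0 \<rho>1 F G \<theta> t
      = (LINT x|interval_measure (\<lambda>x. \<rho>0 * F x + \<rho>1 * G x). (indicator {0<..} x * ?g x) / \<rho>0)"
    unfolding semiparametric_df_def set_lebesgue_integral_def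
  proof (rule Bochner_Integration.integral_cong[OF refl])
    fix x :: real
    show "indicat_real {0<..t} x *\<^sub>R (1 / (\<rho>0 + \<rho>1 * \<phi> x \<theta>)) = indicator {0<..} x * ?g x / \<rho>0"
    proof (cases "0 < x \<and> x \<le> t")
      case True
      then show ?thesis using \<rho> by (simp add: p logistic_ln_ratio(2)[OF \<rho> r(1)])
    qed (auto simp: indicator_def)
  qed
  also have "\<dots> = (\<rho>0 * stieltjes F ?g + \<rho>1 * stieltjes G ?g) / \<rho>0"
    using integral_fin_df_comb[OF F G less_imp_le[OF \<rho>(1)] less_imp_le[OF \<rho>(2)] gm] by (simp add: stieltjes_eq)
  finally show ?thesis by (simp add: pooled_def)
qed

text \<open>Since \<open>\<eta> \<theta>\<close> is \<open>h *\<^sub>R (\<theta> - \<theta>0)\<close> up to a relative error \<open>\<delta> m\<close> that tends to 0, and \<open>K\<close> inverts \<open>J\<close>,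
the expansion of \<open>\<eta> (\<theta> m)\<close> becomes one of \<open>\<theta> m - \<theta>0\<close>, again with an error relative to its leading term.\<close>

lemma delta_method:
  fixes \<eta> :: "real^'q \<Rightarrow> real^'q" and J K :: "real^'q^'q"
  assumes h: "0 < h" and \<eta>': "(\<eta> has_derivative (\<lambda>v. h *\<^sub>R v)) (at \<theta>0)" and \<eta>0: "\<eta> \<theta>0 = 0"
    and \<theta>: "\<theta> \<longlonglongrightarrow> \<theta>0" and KJ: "K ** J = mat 1" and JK: "J ** K = mat 1"
    and C: "\<forall>\<^sub>F m in sequentially. norm (\<eta> (\<theta> m)) \<le> C * norm (u m)"
    and \<epsilon>: "\<epsilon> \<longlonglongrightarrow> (0::real)" "\<forall>\<^sub>F m in sequentially. norm (J *v \<eta> (\<theta> m) + u m) \<le> \<epsilon> m * norm (u m)"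
  shows "\<exists>\<epsilon>'. \<epsilon>' \<longlonglongrightarrow> 0 \<and> (\<forall>\<^sub>F m in sequentially.
    norm (h *\<^sub>R (\<theta> m - \<theta>0) + K *v u m) \<le> \<epsilon>' m * norm (K *v u m))"
proof -
  obtain kK where kK: "kK > 0" "\<And>v. norm (K *v v) \<le> norm v * kK"
    using bounded_linear.pos_bounded[OF matrix_vector_mul_bounded_linear, of K] that by metis
  obtain kJ where kJ: "kJ > 0" "\<And>v. norm (J *v v) \<le> norm v * kJ"
    using bounded_linear.pos_bounded[OF matrix_vector_mul_bounded_linear, of J] that by metis
  define d where "d m = \<theta> m - \<theta>0" for m
  define \<delta> where "\<delta> m = (if d m = 0 then 0 else norm (\<eta> (\<theta> m) - h *\<^sub>R d m) / norm (d m))" for m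
  have \<delta>eq: "norm (\<eta> (\<theta> m) - h *\<^sub>R d m) = \<delta> m * norm (d m)" for m
  proof (cases "d m = 0")
    case True
    then have "\<theta> m = \<theta>0" by (simp add: d_def)
    then show ?thesis using True \<eta>0 by simp
  qed (simp add: \<delta>_def)
  have \<delta>nn: "0 \<le> \<delta> m" for m by (simp add: \<delta>_def)
  have \<delta>0: "\<delta> \<longlonglongrightarrow> 0"
  proof (rule tendstoI)
    fix e :: real assume e: "0 < e"
    obtain r where r: "r > 0" "\<And>y. norm (y - \<theta>0) < r \<Longrightarrow> norm (\<eta> y - \<eta> \<theta>0 - h *\<^sub>R (y - \<theta>0)) \<le> (e / 2) * norm (y - \<theta>0)"
      using \<eta>' half_gt_zero[OF e] unfolding has_derivative_at_alt by blast
    have "\<forall>\<^sub>F m in sequentially. norm (\<theta> m - \<theta>0) < r" using tendstoD[OF \<theta> r(1)] by (simp add: dist_norm)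
    then show "\<forall>\<^sub>F m in sequentially. dist (\<delta> m) 0 < e"
    proof eventually_elim
      case (elim m)
      have "\<delta> m \<le> e / 2"
      proof (cases "d m = 0")
        case False
        then show ?thesis using r(2)[OF elim] \<eta>0 by (simp add: \<delta>_def d_def divide_le_eq)
      qed (use e in \<open>simp add: \<delta>_def\<close>)
      then show ?case using \<delta>nn[of m] e by simp
    qed
  qed
  \<comment> \<open>The factor \<open>2 / h * \<bar>C\<bar>\<close> bounds \<open>norm (d m) / norm (u m)\<close> once \<open>\<delta> m < h / 2\<close>; the factors \<open>kK\<close> and
    \<open>kJ\<close> pass through \<open>K\<close> and back.\<close>
  define \<epsilon>' where "\<epsilon>' m = (\<delta> m * (2 / h * \<bar>C\<bar>) + kK * \<epsilon> m) * kJ" for m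
  have e1: "(\<lambda>m. (\<delta> m * (2 / h * \<bar>C\<bar>) + kK * \<epsilon> m) * kJ) \<longlonglongrightarrow> (0 * (2 / h * \<bar>C\<bar>) + kK * 0) * kJ"
    by (intro tendsto_intros \<delta>0 \<epsilon>(1))
  have "\<forall>\<^sub>F m in sequentially. \<delta> m < h / 2" by (rule order_tendstoD(2)[OF \<delta>0]) (use h in simp)
  with C \<epsilon>(2) have "\<forall>\<^sub>F m in sequentially. norm (h *\<^sub>R d m + K *v u m) \<le> \<epsilon>' m * norm (K *v u m)"
  proof eventually_elim
    case (elim m)
    have "h * norm (d m) = norm (h *\<^sub>R d m)" using h by simp
    also have "\<dots> \<le> norm (\<eta> (\<theta> m)) + norm (\<eta> (\<theta> m) - h *\<^sub>R d m)"
      using norm_triangle_sub[of "h *\<^sub>R d m" "\<eta> (\<theta> m)"] by (simp add: norm_minus_commute)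
    also have "\<dots> \<le> \<bar>C\<bar> * norm (u m) + (h / 2) * norm (d m)"
    proof (rule add_mono)
      show "norm (\<eta> (\<theta> m)) \<le> \<bar>C\<bar> * norm (u m)"
        by (rule order_trans[OF elim(1)]) (intro mult_right_mono, auto)
      show "norm (\<eta> (\<theta> m) - h *\<^sub>R d m) \<le> (h / 2) * norm (d m)"
        unfolding \<delta>eq using elim by (intro mult_right_mono) auto
    qed
    finally have dn: "norm (d m) \<le> (2 / h * \<bar>C\<bar>) * norm (u m)"
      using h by (simp add: field_simps)
    have "K *v (J *v \<eta> (\<theta> m) + u m) = \<eta> (\<theta> m) + K *v u m"
      by (simp add: matrix_vector_right_distrib matrix_vector_mul_assoc KJ)
    then have "norm (\<eta> (\<theta> m) + K *v u m) \<le> norm (J *v \<eta> (\<theta> m) + u m) * kK"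
      using kK(2)[of "J *v \<eta> (\<theta> m) + u m"] by simp
    also have "\<dots> \<le> (\<epsilon> m * norm (u m)) * kK" by (rule mult_right_mono[OF elim(2)]) (use kK in simp)
    finally have 1: "norm (\<eta> (\<theta> m) + K *v u m) \<le> kK * (\<epsilon> m * norm (u m))" by (simp only: mult.commute)
    have "u m = J *v (K *v u m)" by (simp add: matrix_vector_mul_assoc JK)
    then have un: "norm (u m) \<le> norm (K *v u m) * kJ" using kJ(2)[of "K *v u m"] by simp
    have \<epsilon>n: "0 \<le> \<epsilon> m \<or> u m = 0" using elim(2) norm_ge_zero[of "J *v \<eta> (\<theta> m) + u m"]
      by (metis mult_neg_pos not_le order_trans zero_less_norm_iff)
    have "norm (h *\<^sub>R d m + K *v u m) \<le> norm (\<eta> (\<theta> m) - h *\<^sub>R d m) + norm (\<eta> (\<theta> m) + K *v u m)"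
      using norm_triangle_ineq4[of "\<eta> (\<theta> m) + K *v u m" "\<eta> (\<theta> m) - h *\<^sub>R d m"] by (simp add: algebra_simps)
    also have "\<dots> \<le> \<delta> m * ((2 / h * \<bar>C\<bar>) * norm (u m)) + kK * (\<epsilon> m * norm (u m))"
      unfolding \<delta>eq using 1 mult_left_mono[OF dn \<delta>nn[of m]] by simp
    also have "\<dots> = (\<delta> m * (2 / h * \<bar>C\<bar>) + kK * \<epsilon> m) * norm (u m)" by (simp add: algebra_simps)
    also have "\<dots> \<le> (\<delta> m * (2 / h * \<bar>C\<bar>) + kK * \<epsilon> m) * (norm (K *v u m) * kJ)"
      using \<epsilon>n
    proof
      assume "0 \<le> \<epsilon> m"
      then show ?thesis using un \<delta>nn[of m] kK h by (intro mult_left_mono add_nonneg_nonneg mult_nonneg_nonneg) auto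
    qed simp
    finally show ?case by (simp add: \<epsilon>'_def mult.assoc mult.left_commute mult.commute)
  qed
  then show ?thesis using e1 unfolding \<epsilon>'_def d_def by (intro exI[of _ "\<lambda>m. (\<delta> m * (2 / h * \<bar>C\<bar>) + kK * \<epsilon> m) * kJ"]) simp
qed

lemma positive_definite_invertible:
  fixes J :: "real^'q^'q"
  assumes "\<And>v. v \<noteq> 0 \<Longrightarrow> 0 < v \<bullet> (J *v v)"
  shows "\<exists>K. K ** J = mat 1 \<and> J ** K = mat 1"
proof -
  have "\<forall>x. J *v x = 0 \<longrightarrow> x = 0" using assms by (metis inner_zero_right less_irrefl)
  then obtain K where "K ** J = mat 1" using matrix_left_invertible_ker by blast
  then show ?thesis using matrix_left_right_inverse by blast
qed

section \<open>Identifiability\<close>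

text \<open>With two parameters, \<open>v $ i1 + v $ i2 * h x = 0\<close> almost everywhere would pin \<open>h\<close> to one value
unless \<open>v $ i2 = 0\<close>. A strictly monotone function takes that value at most once on the support, and a
single point has no mass.\<close>

lemma (in df_limit) nondegenerate_weight:
  fixes v :: "real^'q" and i1 :: 'q and h :: "real \<Rightarrow> real"
  assumes q: "CARD('q) = 1 \<or> CARD('q) = 2"
    and strict: "CARD('q) = 2 \<Longrightarrow>
          strict_mono_on (df_support F0) h \<or> strict_antimono_on (df_support F0) h"
    and z: "AE x in interval_measure F0. v \<bullet> weight i1 h x = 0"
  shows "v = 0"
proof -
  interpret N: real_distribution "interval_measure F0" by (rule F0_real_distribution)
  have "\<exists>x. v \<bullet> weight i1 h x = 0"
  proof (rule ccontr)
    assume none: "\<nexists>x. v \<bullet> weight i1 h x = 0"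
    have "AE x in interval_measure F0. False" using z by eventually_elim (use none in blast)
    then show False by (simp add: N.AE_False)
  qed
  then obtain x0 where x0: "v \<bullet> weight i1 h x0 = 0" by blast
  have single: "v $ i1 = 0 \<Longrightarrow> (\<And>j. j \<noteq> i1 \<Longrightarrow> v $ j = 0) \<Longrightarrow> v = 0"
    by (simp add: vec_eq_iff) metis
  from q show ?thesis
  proof
    assume "CARD('q) = 1"
    then have all: "j = i1" for j :: 'q by (metis card_1_singletonE UNIV_I singletonD)
    then have U: "(UNIV :: 'q set) = {i1}" by auto
    have "v $ i1 = 0" using x0 by (simp add: inner_vec_def U weight_def)
    then show ?thesis using all by (intro single) auto
  next
    assume q2: "CARD('q) = 2"
    obtain u u' :: 'q where uv: "UNIV = {u, u'}" "u \<noteq> u'" using q2 unfolding card_2_iff by blast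
    then have "i1 = u \<or> i1 = u'" by blast
    with uv obtain i2 where i2: "UNIV = {i1, i2}" "i2 \<noteq> i1" by (metis insert_commute)
    have w: "v \<bullet> weight i1 h x = v $ i1 + v $ i2 * h x" for x
      using i2(2) by (simp add: inner_vec_def i2(1) weight_def)
    have "v $ i2 = 0"
    proof (rule ccontr)
      assume nz: "v $ i2 \<noteq> 0"
      define A where "A = {x \<in> df_support F0. h x = - (v $ i1) / v $ i2}"
      have "x = y" if "x \<in> A" "y \<in> A" for x y
      proof (rule ccontr)
        assume "x \<noteq> y"
        then have "x < y \<or> y < x" by auto
        moreover have "x \<in> df_support F0" "y \<in> df_support F0" "h x = h y" using that by (auto simp: A_def)
        ultimately show False using strict[OF q2] unfolding monotone_on_def by force
      qed
      then have "A = {} \<or> (\<exists>x. A = {x})" by blast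
      then have "countable A" by auto
      then have "emeasure (interval_measure F0) A = 0" by (rule F0_countable_null)
      moreover have "A \<in> sets borel" using \<open>A = {} \<or> (\<exists>x. A = {x})\<close> by auto
      ultimately have "A \<in> null_sets (interval_measure F0)" by (simp add: null_sets_def)
      from AE_not_in[OF this] have n: "AE x in interval_measure F0. x \<notin> A" .
      have s: "AE x in interval_measure F0. x \<in> df_support F0"
        by (rule AE_interval_measure_df_support[OF F0_mono])
           (rule continuous_at_imp_continuous_at_within[OF F0_cont])
      have "AE x in interval_measure F0. False"
        using n s z
      proof eventually_elim
        case (elim x)
        have "h x = - (v $ i1) / v $ i2" using elim(3) nz unfolding w by (simp add: field_simps)
        then show ?case using elim(1,2) by (simp add: A_def)
      qed
      then show False by (simp add: N.AE_False)
    qed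
    moreover from this have "v $ i1 = 0" using x0 by (simp add: w)
    ultimately show ?thesis using i2 by (intro single) auto
  qed
qed

text \<open>Were \<open>h\<close> constant, the vector with the coordinates \<open>- h 1\<close> and 1 would be orthogonal to the weight.\<close>

lemma (in df_limit) weight_nonconstant:
  fixes h :: "real \<Rightarrow> real"
  assumes q2: "CARD('q::finite) = 2"
    and strict: "strict_mono_on (df_support F0) h \<or> strict_antimono_on (df_support F0) h"
  shows "\<exists>x>0. \<exists>y>0. h x \<noteq> h y"
proof (rule ccontr)
  assume "\<not> ?thesis"
  then have c: "h x = h 1" if "0 < x" for x using that zero_less_one by blast
  obtain i1 i2 :: 'q where i: "UNIV = {i1, i2}" "i1 \<noteq> i2" using q2 unfolding card_2_iff by blast
  define v :: "real^'q" where "v = (\<chi> j. if j = i1 then - h 1 else 1)"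
  have w: "v \<bullet> weight i1 h x = - h 1 + h x" for x
    using i by (simp add: inner_vec_def i(1) weight_def v_def)
  have "AE x in interval_measure F0. v \<bullet> weight i1 h x = 0"
    using F0_AE_pos
  proof eventually_elim
    case (elim x) then show ?case unfolding w using c[OF elim] by simp
  qed
  then have "v = 0" by (rule nondegenerate_weight[rotated 2]) (use q2 strict in auto)
  then have "v $ i2 = 0" by simp
  then show False using i by (simp add: v_def)
qed

lemma npmle_df_limit_moments:
  assumes np: "\<And>m. is_npmle (os m) (Fs m)"
    and F0: "mono F0" "\<And>x. isCont F0 x" "\<And>x. x \<le> 0 \<Longrightarrow> F0 x = 0" "(F0 \<longlongrightarrow> 1) at_top"
    and lim: "(\<lambda>m. sup_norm0 (\<lambda>x. Fs m x - F0 x)) \<longlonglongrightarrow> 0"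
    and h: "\<And>x. 0 < x \<Longrightarrow> 0 \<le> h x" "ctble_disc h"
    and moments: "\<And>k. k \<in> {1,2,3::nat} \<Longrightarrow> sintegrable F0 (\<lambda>x. h x ^ k)"
      "\<And>k. k \<in> {1,2,3::nat} \<Longrightarrow> (\<lambda>m. stieltjes (Fs m) (\<lambda>x. h x ^ k) - stieltjes F0 (\<lambda>x. h x ^ k)) \<longlonglongrightarrow> 0"
  shows "df_limit_moments Fs F0 h"
proof -
  have sub: "sub_df (Fs m)" for m using np by (auto simp: is_npmle_def)
  have b: "0 \<le> F0 x" "F0 x \<le> 1" for x
  proof -
    have "F0 (min x 0) = 0" "F0 (min x 0) \<le> F0 x" using F0(3) monoD[OF F0(1), of "min x 0" x] by auto
    then show "0 \<le> F0 x" by simp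
    show "F0 x \<le> 1"
      by (rule tendsto_lowerbound[OF F0(4)])
         (auto simp: eventually_at_top_linorder intro!: exI[of _ x] monoD[OF F0(1)])
  qed
  show ?thesis
  proof (unfold_locales)
    show "fin_df (Fs m)" for m by (rule npmle_fin_df[OF np])
    show "Fs m x \<le> 1" for m x by (rule sub_df_bounds(2)[OF sub])
    show "(\<lambda>m. Fs m x) \<longlonglongrightarrow> F0 x" for x by (rule sup_norm0_pointwise[OF sub b F0(3) lim])
  qed (use h F0 moments in auto)
qed

section \<open>Consistency and asymptotic normality\<close>

theorem theorem1:
  fixes M :: "'w measure"
    and X Y :: "nat \<Rightarrow> 'w \<Rightarrow> real"
    and CX CY :: "nat \<Rightarrow> 'w \<Rightarrow> nat \<Rightarrow> real"
    and sX sY :: scheme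
    and f0 g0 F0 G0 :: "real \<Rightarrow> real"
    and a :: "'q::finite \<Rightarrow> ereal"
    and i1 :: 'q
    and \<phi> :: "real \<Rightarrow> real ^ 'q \<Rightarrow> real"
    and \<theta>0 :: "real ^ 'q"
    and h1 :: "real ^ 'q \<Rightarrow> real"
    and h2 :: "real \<Rightarrow> real"
    and n0 n1 :: "nat \<Rightarrow> nat"
    and \<rho>0 \<rho>1 :: real
    and Fhat Ghat :: "nat \<Rightarrow> 'w \<Rightarrow> real \<Rightarrow> real"
    and \<theta>t :: "nat \<Rightarrow> 'w \<Rightarrow> real ^ 'q"
    and \<Sigma>F \<Sigma>G :: "real ^ 'q ^ 'q"
  defines "\<Theta> \<equiv> param_space a"
  assumes q: "CARD('q) = 1 \<or> CARD('q) = 2"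
    and prob: "prob_space M"
    and f0_nonneg: "\<And>x. 0 \<le> f0 x"
    and g0: "\<And>x. g0 x = \<phi> x \<theta>0 * f0 x"
    and \<theta>0: "\<theta>0 \<in> \<Theta>"
    and \<theta>0_unique: "\<And>\<theta>. \<theta> \<in> \<Theta> \<Longrightarrow> (AE x in lborel. g0 x = \<phi> x \<theta> * f0 x) \<Longrightarrow> \<theta> = \<theta>0"
    and F0: "F0 = cdf (density lborel (\<lambda>x. ennreal (f0 x)))"
    and G0: "G0 = cdf (density lborel (\<lambda>x. ennreal (g0 x)))"
    and X_sample: "censored_sample M f0 sX X CX"
    and Y_sample: "censored_sample M g0 sY Y CY"
    and samples_indep: "indep_elements M (latent X CX) (latent Y CY)"
    and censored: "sX \<noteq> Uncensored \<or> sY \<noteq> Uncensored"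
    and Fhat: "npmle_sequence M sX X CX n0 Fhat"
    and Ghat: "npmle_sequence M sY Y CY n1 Ghat"
    and \<theta>t_measurable: "\<And>m. \<theta>t m \<in> borel_measurable M"
    and \<theta>t: "AE \<omega> in M. \<forall>\<^sub>F m in sequentially.
               is_spmle a \<phi> i1 h2 \<rho>0 \<rho>1 (Fhat m \<omega>) (Ghat m \<omega>) (\<theta>t m \<omega>)"
    and h1_pos: "\<And>\<theta>. \<theta> \<in> \<Theta> \<Longrightarrow> 0 < h1 \<theta>"
    and h1_diff: "twice_differentiable_on h1 \<Theta>"
    and h2_nonneg: "\<And>x. 0 \<le> x \<Longrightarrow> 0 \<le> h2 x"
    and h2_monotone: "mono_on {0..} h2 \<or> antimono_on {0..} h2"
    and \<phi>_gradient: "\<And>x \<theta>. 0 \<le> x \<Longrightarrow> \<theta> \<in> \<Theta> \<Longrightarrow>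
          GDERIV (\<phi> x) \<theta> :> (\<phi> x \<theta> * h1 \<theta>) *\<^sub>R weight i1 h2 x"
    and h2_zero: "\<And>x. CARD('q) = 1 \<Longrightarrow> 0 \<le> x \<Longrightarrow> h2 x = 0"
    and h2_strict: "CARD('q) = 2 \<Longrightarrow>
          strict_mono_on (df_support F0) h2 \<or> strict_antimono_on (df_support F0) h2"
    and a_finite: "\<And>j. a j < \<infinity>"
    and \<phi>_monotone: "\<And>\<theta>. \<theta> \<in> \<Theta> \<Longrightarrow>
          mono_on {0..} (\<lambda>x. \<phi> x \<theta>) \<or> antimono_on {0..} (\<lambda>x. \<phi> x \<theta>)"
    and \<phi>_increasing: "\<And>x \<theta> j s. 0 < x \<Longrightarrow> \<theta> \<in> \<Theta> \<Longrightarrow> \<theta> $ j \<le> s \<Longrightarrow>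
          \<phi> x \<theta> \<le> \<phi> x (update_coord \<theta> j s)"
    and \<phi>_upper: "\<And>x \<theta>. 0 < x \<Longrightarrow> \<theta> \<in> \<Theta> \<Longrightarrow>
          filterlim (\<lambda>s. \<phi> x (update_coord \<theta> i1 s)) at_top at_top"
    and \<phi>_lower: "\<And>x \<theta>. 0 < x \<Longrightarrow> \<theta> \<in> \<Theta> \<Longrightarrow>
          ((\<lambda>s. \<phi> x (update_coord \<theta> i1 s)) \<longlongrightarrow> 0) (to_lower_end (a i1))"
    and \<phi>_diag_upper: "\<And>x \<gamma> i2 t. CARD('q) = 2 \<Longrightarrow> i2 \<noteq> i1 \<Longrightarrow> 0 < x \<Longrightarrow> 0 \<le> (\<gamma>::ereal) \<Longrightarrow>
          (\<And>m::nat. t m \<in> \<Theta>) \<Longrightarrow>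
          (\<lambda>m. ereal (- (t m $ i1) / t m $ i2)) \<longlonglongrightarrow> \<gamma> \<Longrightarrow>
          filterlim (\<lambda>m. t m $ i2) at_top sequentially \<Longrightarrow>
          (ereal x < \<gamma> \<longrightarrow> (\<lambda>m. \<phi> x (t m)) \<longlonglongrightarrow> 0) \<and>
          (\<gamma> < ereal x \<longrightarrow> filterlim (\<lambda>m. \<phi> x (t m)) at_top sequentially)"
    and \<phi>_diag_lower: "\<And>x \<gamma> i2 t. CARD('q) = 2 \<Longrightarrow> i2 \<noteq> i1 \<Longrightarrow> 0 < x \<Longrightarrow> 0 \<le> (\<gamma>::ereal) \<Longrightarrow>
          (\<And>m::nat. t m \<in> \<Theta>) \<Longrightarrow>
          (\<lambda>m. ereal (- (t m $ i1) / t m $ i2)) \<longlonglongrightarrow> \<gamma> \<Longrightarrow>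
          filterlim (\<lambda>m. t m $ i2) (to_lower_end (a i2)) sequentially \<Longrightarrow>
          (\<gamma> < ereal x \<longrightarrow> (\<lambda>m. \<phi> x (t m)) \<longlonglongrightarrow> 0) \<and>
          (ereal x < \<gamma> \<longrightarrow> filterlim (\<lambda>m. \<phi> x (t m)) at_top sequentially)"
    and sizes_pos: "\<And>m. 0 < n0 m" "\<And>m. 0 < n1 m"
    and size_inf: "filterlim (\<lambda>m. n0 m + n1 m) at_top sequentially"
    and \<rho>0: "\<And>m. real (n0 m) / real (n0 m + n1 m) = \<rho>0"
    and \<rho>1: "\<And>m. real (n1 m) / real (n0 m + n1 m) = \<rho>1"
    \<comment> \<open>joint convergence in the components; the marginal variances are the diagonal entries\<close>
    and clt_F: "asymptotically_normal M
          (\<lambda>m \<omega>. sqrt (real (n0 m)) *\<^sub>R (\<chi> k.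
             stieltjes (Fhat m \<omega>) (\<lambda>x. weight i1 h2 x $ k * \<phi> x \<theta>0 / (\<rho>0 + \<rho>1 * \<phi> x \<theta>0))
             - stieltjes F0 (\<lambda>x. weight i1 h2 x $ k * \<phi> x \<theta>0 / (\<rho>0 + \<rho>1 * \<phi> x \<theta>0)))) \<Sigma>F"
    and clt_G: "asymptotically_normal M
          (\<lambda>m \<omega>. sqrt (real (n1 m)) *\<^sub>R (\<chi> k.
             stieltjes (Ghat m \<omega>) (\<lambda>x. weight i1 h2 x $ k / (\<rho>0 + \<rho>1 * \<phi> x \<theta>0))
             - stieltjes G0 (\<lambda>x. weight i1 h2 x $ k / (\<rho>0 + \<rho>1 * \<phi> x \<theta>0)))) \<Sigma>G"
    and consistent_F: "AE \<omega> in M. (\<lambda>m. sup_norm0 (\<lambda>x. Fhat m \<omega> x - F0 x)) \<longlonglongrightarrow> 0"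
    and consistent_G: "AE \<omega> in M. (\<lambda>m. sup_norm0 (\<lambda>x. Ghat m \<omega> x - G0 x)) \<longlonglongrightarrow> 0"
    and moments_F0: "\<And>k. k \<in> {1,2,3::nat} \<Longrightarrow>
          set_integrable (interval_measure F0) {0<..} (\<lambda>x. h2 x ^ k)"
    and moments_G0: "\<And>k. k \<in> {1,2,3::nat} \<Longrightarrow>
          set_integrable (interval_measure G0) {0<..} (\<lambda>x. h2 x ^ k)"
    and moments_F: "\<And>k. k \<in> {1,2,3::nat} \<Longrightarrow> AE \<omega> in M.
          (\<lambda>m. stieltjes (Fhat m \<omega>) (\<lambda>x. h2 x ^ k) - stieltjes F0 (\<lambda>x. h2 x ^ k)) \<longlonglongrightarrow> 0"
    and moments_G: "\<And>k. k \<in> {1,2,3::nat} \<Longrightarrow> AE \<omega> in M.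
          (\<lambda>m. stieltjes (Ghat m \<omega>) (\<lambda>x. h2 x ^ k) - stieltjes G0 (\<lambda>x. h2 x ^ k)) \<longlonglongrightarrow> 0"
  shows "(AE \<omega> in M. (\<lambda>m. \<theta>t m \<omega>) \<longlonglongrightarrow> \<theta>0) \<and>
         (\<exists>\<Sigma>0. asymptotically_normal M
            (\<lambda>m \<omega>. sqrt (real (n0 m + n1 m)) *\<^sub>R (\<theta>t m \<omega> - \<theta>0)) \<Sigma>0) \<and>
         (AE \<omega> in M. (\<lambda>m. sup_norm0 (\<lambda>t.
            semiparametric_df \<phi> \<rho>0 \<rho>1 (Fhat m \<omega>) (Ghat m \<omega>) (\<theta>t m \<omega>) t - F0 t)) \<longlonglongrightarrow> 0)"
proof -
  interpret M: prob_space M by (rule prob)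
  let ?w = "weight i1 h2 :: real \<Rightarrow> real^'q"
  let ?r = "\<lambda>x. \<phi> x \<theta>0"
  let ?b = "\<lambda>x. ln (\<rho>1 * ?r x / \<rho>0)"
  let ?n = "\<lambda>m. real (n0 m + n1 m)"
  have \<theta>0': "\<theta>0 \<in> param_space a" using \<theta>0 by (simp add: \<Theta>_def)
  have npos: "0 < ?n m" for m using sizes_pos(1)[of m] by simp
  have \<rho>: "0 < \<rho>0" "0 < \<rho>1"
    using \<rho>0[of 0] \<rho>1[of 0] sizes_pos[of 0] by (metis divide_pos_pos npos of_nat_0_less_iff)+
  have n0: "real (n0 m) = \<rho>0 * ?n m" and n1: "real (n1 m) = \<rho>1 * ?n m" for m
    using \<rho>0[of m] \<rho>1[of m] npos[of m] by (auto simp: field_simps)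

  have dX: "distributed M lborel (X 0) (\<lambda>x. ennreal (f0 x))" and nX: "AE \<omega> in M. 0 \<le> X 0 \<omega>"
    using X_sample by (auto simp: censored_sample_def)
  have dY: "distributed M lborel (Y 0) (\<lambda>x. ennreal (g0 x))" and nY: "AE \<omega> in M. 0 \<le> Y 0 \<omega>"
    using Y_sample by (auto simp: censored_sample_def)
  note FX = M.sample_df[OF dX nX F0] and GY = M.sample_df[OF dY nY G0]
  have h2d: "ctble_disc h2" by (rule ctble_disc_monotone[OF h2_monotone])
  have rd: "ctble_disc ?r" by (rule ctble_disc_monotone[OF \<phi>_monotone[OF \<theta>0]])

  \<comment> \<open>All pathwise arguments take place on one event of probability 1.\<close>
  define good where "good \<omega> \<longleftrightarrow>
      (\<forall>m. is_npmle (observed_sample sX (n0 m) (\<lambda>i. X i \<omega>) (\<lambda>i. CX i \<omega>)) (Fhat m \<omega>)) \<and>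
      (\<forall>m. is_npmle (observed_sample sY (n1 m) (\<lambda>i. Y i \<omega>) (\<lambda>i. CY i \<omega>)) (Ghat m \<omega>)) \<and>
      (\<forall>\<^sub>F m in sequentially. is_spmle a \<phi> i1 h2 \<rho>0 \<rho>1 (Fhat m \<omega>) (Ghat m \<omega>) (\<theta>t m \<omega>)) \<and>
      (\<lambda>m. sup_norm0 (\<lambda>x. Fhat m \<omega> x - F0 x)) \<longlonglongrightarrow> 0 \<and>
      (\<lambda>m. sup_norm0 (\<lambda>x. Ghat m \<omega> x - G0 x)) \<longlonglongrightarrow> 0 \<and>
      (\<forall>k\<in>{1,2,3}. (\<lambda>m. stieltjes (Fhat m \<omega>) (\<lambda>x. h2 x ^ k) - stieltjes F0 (\<lambda>x. h2 x ^ k)) \<longlonglongrightarrow> 0) \<and>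
      (\<forall>k\<in>{1,2,3}. (\<lambda>m. stieltjes (Ghat m \<omega>) (\<lambda>x. h2 x ^ k) - stieltjes G0 (\<lambda>x. h2 x ^ k)) \<longlonglongrightarrow> 0)" for \<omega>
  have AE_good: "AE \<omega> in M. good \<omega>"
    unfolding good_def
    by (intro AE_conjI AE_finite_allI moments_F moments_G consistent_F consistent_G \<theta>t)
       (use Fhat Ghat in \<open>simp_all add: npmle_sequence_def\<close>)
  have limF: "df_limit_moments (\<lambda>m. Fhat m \<omega>) F0 h2" if "good \<omega>" for \<omega>
    by (rule npmle_df_limit_moments[OF _ FX(1-4) _ _ h2d moments_F0])
       (use that h2_nonneg in \<open>auto simp: good_def\<close>)
  have limG: "df_limit_moments (\<lambda>m. Ghat m \<omega>) G0 h2" if "good \<omega>" for \<omega>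
    by (rule npmle_df_limit_moments[OF _ GY(1-4) _ _ h2d moments_G0])
       (use that h2_nonneg in \<open>auto simp: good_def\<close>)
  \<comment> \<open>Facts on the limits alone, such as identifiability and positive definiteness of the information,
    are read off from one arbitrary realization.\<close>
  have "\<exists>\<omega>. good \<omega>"
  proof (rule ccontr)
    assume none: "\<nexists>\<omega>. good \<omega>"
    have "AE \<omega> in M. False" using AE_good by eventually_elim (use none in blast)
    then show False by (simp add: M.AE_False)
  qed
  then obtain \<omega>0 where \<omega>0: "good \<omega>0" by blast
  interpret L: df_limit_moments "\<lambda>m. Fhat m \<omega>0" F0 h2 by (rule limF[OF \<omega>0])
  have nondeg: "v = 0" if "AE x in interval_measure F0. v \<bullet> ?w x = 0" for v
    by (rule L.nondegenerate_weight[OF q h2_strict that])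

  have tilt: "exponential_tilt a i1 \<phi> h1 h2 \<theta>0"
  proof
    show "continuous_on (param_space a) h1"
      using h1_diff unfolding twice_differentiable_on_def \<Theta>_def gderiv_def
      by (metis continuous_at_imp_continuous_on has_derivative_continuous)
    show "\<exists>x>0. \<exists>y>0. h2 x \<noteq> h2 y" if "CARD('q) = 2"
      by (rule L.weight_nonconstant[OF that h2_strict[OF that]])
  qed (use q \<theta>0 h1_pos \<phi>_gradient \<phi>_upper in \<open>auto simp: \<Theta>_def\<close>)
  note rpos = exponential_tilt.\<phi>_pos[OF tilt _ \<theta>0']
  obtain \<eta> where \<eta>0: "\<eta> \<theta>0 = (0::real^'q)"
    and \<eta>': "(\<eta> has_derivative (\<lambda>v. h1 \<theta>0 *\<^sub>R v)) (at \<theta>0)"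
    and \<eta>inv: "\<And>e. e > 0 \<Longrightarrow> \<exists>d>0. \<forall>\<theta>\<in>param_space a. norm (\<eta> \<theta>) < d \<longrightarrow> norm (\<theta> - \<theta>0) < e"
    and \<eta>: "\<And>x \<theta>. 0 < x \<Longrightarrow> \<theta> \<in> param_space a \<Longrightarrow> \<phi> x \<theta> = \<phi> x \<theta>0 * exp (\<eta> \<theta> \<bullet> ?w x)"
    using exponential_tilt.tilt_structure[OF tilt] by blast
  have hpos: "0 < h1 \<theta>0" by (rule h1_pos[OF \<theta>0])
  have bd: "ctble_disc ?b" by (rule ctble_disc_log_ratio[OF \<rho> rpos rd])
  have lb: "logistic (?b x) = \<rho>1 * ?r x / (\<rho>0 + \<rho>1 * ?r x)" "1 - logistic (?b x) = \<rho>0 / (\<rho>0 + \<rho>1 * ?r x)" if "0 < x" for x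
    using logistic_ln_ratio[OF \<rho> rpos[OF that], of 0] by simp_all
  \<comment> \<open>The density ratio \<open>g0 = \<phi>(\<cdot>; \<theta>0) f0\<close>, seen by the logistic regression.\<close>
  have link: "\<rho>1 * stieltjes G0 (\<lambda>x. (1 - logistic (?b x)) * f x) = \<rho>0 * stieltjes F0 (\<lambda>x. logistic (?b x) * f x)"
    if f: "ctble_disc f" for f
  proof -
    have l: "ctble_disc (\<lambda>x. logistic (?b x))" by (rule ctble_disc_compose[OF bd isCont_logistic])
    have d: "ctble_disc (\<lambda>x. (1 - logistic (?b x)) * f x)" "ctble_disc (\<lambda>x. logistic (?b x) * f x)"
      by (intro ctble_disc_mult ctble_disc_diff ctble_disc_const l f)+
    have "\<rho>1 * stieltjes G0 (\<lambda>x. (1 - logistic (?b x)) * f x)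
        = (LINT x|lborel. \<rho>1 * (max 0 (g0 x) * (indicator {0<..} x * ((1 - logistic (?b x)) * f x))))"
      by (simp add: stieltjes_density[OF GY(5) distributed_borel_measurable[OF dY] d(1)])
    also have "\<dots> = (LINT x|lborel. \<rho>0 * (max 0 (f0 x) * (indicator {0<..} x * (logistic (?b x) * f x))))"
    proof (rule Bochner_Integration.integral_cong[OF refl])
      fix x :: real
      show "\<rho>1 * (max 0 (g0 x) * (indicator {0<..} x * ((1 - logistic (?b x)) * f x)))
          = \<rho>0 * (max 0 (f0 x) * (indicator {0<..} x * (logistic (?b x) * f x)))"
      proof (cases "0 < x")
        case True
        have "0 \<le> ?r x * f0 x" using rpos[OF True] f0_nonneg[of x] by simp
        then have "max 0 (g0 x) = ?r x * f0 x" "max 0 (f0 x) = f0 x" using f0_nonneg[of x] by (simp_all add: g0)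
        then show ?thesis unfolding lb(2)[OF True] unfolding lb(1)[OF True] by (simp add: mult_ac)
      qed simp
    qed
    also have "\<dots> = \<rho>0 * stieltjes F0 (\<lambda>x. logistic (?b x) * f x)"
      by (simp add: stieltjes_density[OF FX(5) distributed_borel_measurable[OF dX] d(2)])
    finally show ?thesis .
  qed
  have tsl: "two_sample_limit (\<lambda>m. Fhat m \<omega>) F0 (\<lambda>m. Ghat m \<omega>) G0 h2 ?b \<rho>0 \<rho>1 i1" if "good \<omega>" for \<omega>
    unfolding two_sample_limit_def two_sample_limit_axioms_def
    using limF[OF that] limG[OF that] q bd \<rho> link nondeg by blast
  have fin: "fin_df (Fhat m \<omega>)" "fin_df (Ghat m \<omega>)" if "good \<omega>" for m \<omega>
    using that npmle_fin_df unfolding good_def by blast+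
  let ?U = "\<lambda>\<omega> m. score \<rho>0 \<rho>1 (Fhat m \<omega>) (Ghat m \<omega>) h2 i1 ?b"
  let ?J = "information \<rho>0 \<rho>1 F0 G0 h2 i1 ?b"
  have root: "\<forall>\<^sub>F m in sequentially. \<theta>t m \<omega> \<in> param_space a \<and> ?U \<omega> m (\<eta> (\<theta>t m \<omega>)) = 0" if "good \<omega>" for \<omega>
  proof -
    have "\<forall>\<^sub>F m in sequentially. is_spmle a \<phi> i1 h2 \<rho>0 \<rho>1 (Fhat m \<omega>) (Ghat m \<omega>) (\<theta>t m \<omega>)"
      using that by (simp add: good_def)
    then show ?thesis
    proof eventually_elim
      case (elim m)
      then have mem: "\<theta>t m \<omega> \<in> param_space a" by (simp add: is_spmle_def)
      have "?U \<omega> m (\<eta> (\<theta>t m \<omega>)) $ j = 0" for j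
        using elim by (subst score_eq_estimating_function[OF fin[OF that] \<rho> h2d rpos rd \<eta>[OF _ mem]])
          (auto simp: is_spmle_def)
      then show ?case using mem by (simp add: vec_eq_iff)
    qed
  qed
  have \<eta>lim: "(\<lambda>m. \<eta> (\<theta>t m \<omega>)) \<longlonglongrightarrow> 0" if "good \<omega>" for \<omega>
    by (rule two_sample_limit.score_root_expansion(1)[OF tsl[OF that]])
       (use root[OF that] in \<open>auto elim: eventually_mono\<close>)
  have consistent: "(\<lambda>m. \<theta>t m \<omega>) \<longlonglongrightarrow> \<theta>0" if g: "good \<omega>" for \<omega>
  proof (rule tendstoI)
    fix e :: real assume "0 < e"
    then obtain d where d: "d > 0" "\<And>\<theta>. \<theta> \<in> param_space a \<Longrightarrow> norm (\<eta> \<theta>) < d \<Longrightarrow> norm (\<theta> - \<theta>0) < e"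
      using \<eta>inv by blast
    have "\<forall>\<^sub>F m in sequentially. norm (\<eta> (\<theta>t m \<omega>)) < d" using tendstoD[OF \<eta>lim[OF g] d(1)] by simp
    with root[OF g] show "\<forall>\<^sub>F m in sequentially. dist (\<theta>t m \<omega>) \<theta>0 < e"
    proof eventually_elim
      case (elim m) then show ?case using d(2) by (simp add: dist_norm)
    qed
  qed

  have part3: "(\<lambda>m. sup_norm0 (\<lambda>t. semiparametric_df \<phi> \<rho>0 \<rho>1 (Fhat m \<omega>) (Ghat m \<omega>) (\<theta>t m \<omega>) t - F0 t)) \<longlonglongrightarrow> 0"
    if g: "good \<omega>" for \<omega>
  proof (rule sup_norm0_tendsto_0)
    fix e :: real assume e: "0 < e"
    interpret T: two_sample_limit "\<lambda>m. Fhat m \<omega>" F0 "\<lambda>m. Ghat m \<omega>" G0 h2 ?b \<rho>0 \<rho>1 i1 by (rule tsl[OF g])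
    show "\<forall>\<^sub>F m in sequentially. \<forall>t\<ge>0. \<bar>semiparametric_df \<phi> \<rho>0 \<rho>1 (Fhat m \<omega>) (Ghat m \<omega>) (\<theta>t m \<omega>) t - F0 t\<bar> < e"
      using T.baseline_df_uniform[OF \<eta>lim[OF g] e] root[OF g]
    proof eventually_elim
      case (elim m)
      have "semiparametric_df \<phi> \<rho>0 \<rho>1 (Fhat m \<omega>) (Ghat m \<omega>) (\<theta>t m \<omega>) t = T.baseline_df m (\<eta> (\<theta>t m \<omega>)) t" for t
        unfolding T.baseline_df_def
        by (rule semiparametric_df_eq[OF fin[OF g] \<rho> h2d rpos rd \<eta>]) (use elim in auto)
      then show ?case using elim(1) by simp
    qed
  qed

  obtain K where K: "K ** ?J = mat 1" "?J ** K = mat 1"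
    using positive_definite_invertible[OF two_sample_limit.J_pos[OF tsl[OF \<omega>0]]] by blast
  obtain \<nu>F where \<Sigma>F: "covariance_matrix \<Sigma>F" and \<nu>F: "is_centered_normal \<Sigma>F \<nu>F"
    and lawF: "converges_in_law M (\<lambda>m \<omega>. sqrt (real (n0 m)) *\<^sub>R (\<chi> k.
             stieltjes (Fhat m \<omega>) (\<lambda>x. ?w x $ k * \<phi> x \<theta>0 / (\<rho>0 + \<rho>1 * \<phi> x \<theta>0))
             - stieltjes F0 (\<lambda>x. ?w x $ k * \<phi> x \<theta>0 / (\<rho>0 + \<rho>1 * \<phi> x \<theta>0)))) \<nu>F"
    using clt_F by (auto simp: asymptotically_normal_def)
  obtain \<nu>G where \<Sigma>G: "covariance_matrix \<Sigma>G" and \<nu>G: "is_centered_normal \<Sigma>G \<nu>G"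
    and lawG: "converges_in_law M (\<lambda>m \<omega>. sqrt (real (n1 m)) *\<^sub>R (\<chi> k.
             stieltjes (Ghat m \<omega>) (\<lambda>x. ?w x $ k / (\<rho>0 + \<rho>1 * \<phi> x \<theta>0))
             - stieltjes G0 (\<lambda>x. ?w x $ k / (\<rho>0 + \<rho>1 * \<phi> x \<theta>0)))) \<nu>G"
    using clt_G by (auto simp: asymptotically_normal_def)
  let ?fF = "\<lambda>k x. ?w x $ k * \<phi> x \<theta>0 / (\<rho>0 + \<rho>1 * \<phi> x \<theta>0)"
  let ?fG = "\<lambda>k x. ?w x $ k / (\<rho>0 + \<rho>1 * \<phi> x \<theta>0)"
  define VF where "VF F m = sqrt (real (n0 m)) *\<^sub>R (\<chi> k. stieltjes F (?fF k) - stieltjes F0 (?fF k))" for F m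
  define VG where "VG G m = sqrt (real (n1 m)) *\<^sub>R (\<chi> k. stieltjes G (?fG k) - stieltjes G0 (?fG k))" for G m
  have rq: "ctble_disc (\<lambda>x. ?r x / (\<rho>0 + \<rho>1 * ?r x))" "ctble_disc (\<lambda>x. 1 / (\<rho>0 + \<rho>1 * ?r x))"
  proof -
    have nz: "\<rho>0 + \<rho>1 * ?r x \<noteq> 0" if "0 < x" for x
      using rpos[OF that] \<rho> by (metis add_pos_pos less_irrefl mult_pos_pos)
    show "ctble_disc (\<lambda>x. ?r x / (\<rho>0 + \<rho>1 * ?r x))" "ctble_disc (\<lambda>x. 1 / (\<rho>0 + \<rho>1 * ?r x))"
      by (rule ctble_disc_combine[OF rd rd], intro continuous_intros, assumption, assumption, rule nz, assumption)
         (rule ctble_disc_combine[OF rd rd], intro continuous_intros, assumption, rule nz, assumption)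
  qed
  have fFd: "ctble_disc (?fF k)" for k
    using ctble_disc_mult[OF ctble_disc_weight[OF h2d, of i1 k] rq(1)] by simp
  have fGd: "ctble_disc (?fG k)" for k
    using ctble_disc_mult[OF ctble_disc_weight[OF h2d, of i1 k] rq(2)] by simp
  \<comment> \<open>Replacing each estimator by its everywhere measurable version makes the two normalized errors
    independent, at the cost of a null set.\<close>
  let ?NX = "vimage_algebra (space M) (latent X CX) borel" and ?NY = "vimage_algebra (space M) (latent Y CY) borel"
  have mX: "(\<lambda>\<omega>. VF (rc_version (Fhat m \<omega>)) m) \<in> borel_measurable ?NX" for m
    unfolding VF_def using Fhat
    by (intro borel_measurable_scaleR borel_measurable_const borel_measurable_vec_lambda borel_measurable_diff
          stieltjes_measurable_version ctble_disc_measurable fFd) (simp_all add: npmle_sequence_def)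
  have mY: "(\<lambda>\<omega>. VG (rc_version (Ghat m \<omega>)) m) \<in> borel_measurable ?NY" for m
    unfolding VG_def using Ghat
    by (intro borel_measurable_scaleR borel_measurable_const borel_measurable_vec_lambda borel_measurable_diff
          stieltjes_measurable_version ctble_disc_measurable fGd) (simp_all add: npmle_sequence_def)
  have subs: "sub_df (Fhat m \<omega>)" "sub_df (Ghat m \<omega>)" if "good \<omega>" for m \<omega>
    using that by (auto simp: good_def is_npmle_def)
  have ind: "M.indep_var borel (\<lambda>\<omega>. VF (rc_version (Fhat m \<omega>)) m) borel (\<lambda>\<omega>. VG (rc_version (Ghat m \<omega>)) m)" for m
    by (rule M.indep_var_of_indep_elements[OF samples_indep mX mY])
  have lawF': "converges_in_law M (\<lambda>m \<omega>. VF (rc_version (Fhat m \<omega>)) m) \<nu>F"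
  proof (rule converges_in_law_cong_AE[OF lawF[folded VF_def]])
    show "(\<lambda>\<omega>. VF (rc_version (Fhat m \<omega>)) m) \<in> borel_measurable M" for m using ind by (rule M.indep_var_rv1)
    show "AE \<omega> in M. VF (Fhat m \<omega>) m = VF (rc_version (Fhat m \<omega>)) m" for m
      using AE_good by eventually_elim (simp add: rc_version_eq subs)
  qed
  have lawG': "converges_in_law M (\<lambda>m \<omega>. VG (rc_version (Ghat m \<omega>)) m) \<nu>G"
  proof (rule converges_in_law_cong_AE[OF lawG[folded VG_def]])
    show "(\<lambda>\<omega>. VG (rc_version (Ghat m \<omega>)) m) \<in> borel_measurable M" for m using ind by (rule M.indep_var_rv2)
    show "AE \<omega> in M. VG (Ghat m \<omega>) m = VG (rc_version (Ghat m \<omega>)) m" for m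
      using AE_good by eventually_elim (simp add: rc_version_eq subs)
  qed
  \<comment> \<open>The leading term of the expansion is \<open>- J\<^sup>-\<^sup>1 U(0) / h1(\<theta>0)\<close>, and \<open>U(0)\<close> is \<open>\<rho>0 * \<rho>1\<close> times the
    difference of the two errors. The roots of \<open>\<rho>0\<close> and \<open>\<rho>1\<close> convert the normalizations by \<open>n0\<close> and \<open>n1\<close>
    into the one by \<open>n\<close>.\<close>
  define \<Lambda>F where "\<Lambda>F = (- (\<rho>0 * \<rho>1 / h1 \<theta>0) / sqrt \<rho>0) *\<^sub>R K"
  define \<Lambda>G where "\<Lambda>G = ((\<rho>0 * \<rho>1 / h1 \<theta>0) / sqrt \<rho>1) *\<^sub>R K"
  define \<Sigma>1 where "\<Sigma>1 = \<Lambda>F ** \<Sigma>F ** transpose \<Lambda>F"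
  define \<Sigma>2 where "\<Sigma>2 = \<Lambda>G ** \<Sigma>G ** transpose \<Lambda>G"
  define \<nu>1 where "\<nu>1 = distr \<nu>F borel (\<lambda>x. \<Lambda>F *v x)"
  define \<nu>2 where "\<nu>2 = distr \<nu>G borel (\<lambda>x. \<Lambda>G *v x)"
  have norm1: "is_centered_normal \<Sigma>1 \<nu>1" "covariance_matrix \<Sigma>1"
    unfolding \<Sigma>1_def \<nu>1_def by (rule is_centered_normal_linear[OF \<nu>F], rule covariance_matrix_linear[OF \<Sigma>F])
  have norm2: "is_centered_normal \<Sigma>2 \<nu>2" "covariance_matrix \<Sigma>2"
    unfolding \<Sigma>2_def \<nu>2_def by (rule is_centered_normal_linear[OF \<nu>G], rule covariance_matrix_linear[OF \<Sigma>G])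
  let ?ZF = "\<lambda>m \<omega>. \<Lambda>F *v VF (rc_version (Fhat m \<omega>)) m" and ?ZG = "\<lambda>m \<omega>. \<Lambda>G *v VG (rc_version (Ghat m \<omega>)) m"
  have mv: "continuous_on UNIV (\<lambda>x. \<Lambda> *v x)" for \<Lambda> :: "real^'q^'q"
    by (rule matrix_vector_mult_linear_continuous_on)
  have mvm: "(\<lambda>x. \<Lambda> *v x) \<in> borel_measurable borel" for \<Lambda> :: "real^'q^'q"
    by (rule borel_measurable_continuous_onI[OF mv])
  have law1: "converges_in_law M ?ZF \<nu>1"
    unfolding \<nu>1_def by (rule converges_in_law_map[OF lawF' mv]) (use \<nu>F in \<open>simp add: is_centered_normal_def\<close>)
  have law2: "converges_in_law M ?ZG \<nu>2"
    unfolding \<nu>2_def by (rule converges_in_law_map[OF lawG' mv]) (use \<nu>G in \<open>simp add: is_centered_normal_def\<close>)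
  have ind': "M.indep_var borel (?ZF m) borel (?ZG m)" for m
    by (rule M.indep_var_of_indep_elements[OF samples_indep measurable_compose[OF mX mvm] measurable_compose[OF mY mvm]])
  define \<nu> where "\<nu> = distr (\<nu>1 \<Otimes>\<^sub>M \<nu>2) borel (\<lambda>(b, a). a + b)"
  have pr: "prob_space \<nu>1" "sets \<nu>1 = sets borel" "prob_space \<nu>2" "sets \<nu>2 = sets borel"
    using norm1 norm2 by (auto simp: is_centered_normal_def)
  have lawZ: "converges_in_law M (\<lambda>m \<omega>. ?ZG m \<omega> + ?ZF m \<omega>) \<nu>"
    unfolding \<nu>_def by (rule M.converges_in_law_indep_add[OF law2 law1 pr(3,4,1,2) ind'])
  have normal: "is_centered_normal (\<Sigma>2 + \<Sigma>1) \<nu>" "covariance_matrix (\<Sigma>2 + \<Sigma>1)"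
    unfolding \<nu>_def by (rule is_centered_normal_add[OF norm2 norm1], rule covariance_matrix_add[OF norm2(2) norm1(2)])
  \<comment> \<open>The two centerings cancel in the score.\<close>
  have lim_eq: "stieltjes F0 (?fF k) = stieltjes G0 (?fG k)" for k
  proof -
    have "\<rho>1 * stieltjes F0 (?fF k) = stieltjes F0 (\<lambda>x. logistic (?b x) * ?w x $ k)"
      unfolding stieltjes_mult[symmetric] by (intro stieltjes_cong) (simp add: lb(1))
    then have "\<rho>0 * (\<rho>1 * stieltjes F0 (?fF k)) = \<rho>0 * stieltjes F0 (\<lambda>x. logistic (?b x) * ?w x $ k)" by simp
    also have "\<dots> = \<rho>1 * stieltjes G0 (\<lambda>x. (1 - logistic (?b x)) * ?w x $ k)"
      by (rule link[symmetric, OF ctble_disc_weight[OF h2d]])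
    also have "stieltjes G0 (\<lambda>x. (1 - logistic (?b x)) * ?w x $ k) = \<rho>0 * stieltjes G0 (?fG k)"
      unfolding stieltjes_mult[symmetric] by (intro stieltjes_cong) (simp add: lb(2))
    also have "\<rho>1 * (\<rho>0 * stieltjes G0 (?fG k)) = \<rho>0 * (\<rho>1 * stieltjes G0 (?fG k))" by simp
    finally show ?thesis using \<rho> by simp
  qed
  have score0: "sqrt (?n m) *\<^sub>R ?U \<omega> m 0 = (\<rho>0 * \<rho>1) *\<^sub>R ((1 / sqrt \<rho>0) *\<^sub>R VF (Fhat m \<omega>) m - (1 / sqrt \<rho>1) *\<^sub>R VG (Ghat m \<omega>) m)"
    if g: "good \<omega>" for m \<omega>
  proof -
    have "?U \<omega> m 0 $ k = \<rho>0 * \<rho>1 * (stieltjes (Fhat m \<omega>) (?fF k) - stieltjes (Ghat m \<omega>) (?fG k))" for k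
      using score_eq_estimating_function[OF fin[OF g] \<rho> h2d rpos rd, of ?r 0] by (simp add: mult.commute)
    moreover have "sqrt (real (n0 m)) = sqrt \<rho>0 * sqrt (?n m)" "sqrt (real (n1 m)) = sqrt \<rho>1 * sqrt (?n m)"
      unfolding n0 n1 by (simp_all only: real_sqrt_mult)
    ultimately show ?thesis
      using \<rho> by (simp add: vec_eq_iff VF_def VG_def lim_eq right_diff_distrib)
  qed
  have Z_eq: "?ZG m \<omega> + ?ZF m \<omega> = (- sqrt (?n m) / h1 \<theta>0) *\<^sub>R (K *v ?U \<omega> m 0)" if g: "good \<omega>" for m \<omega>
  proof -
    have "(- sqrt (?n m) / h1 \<theta>0) *\<^sub>R (K *v ?U \<omega> m 0) = (- 1 / h1 \<theta>0) *\<^sub>R (K *v (sqrt (?n m) *\<^sub>R ?U \<omega> m 0))"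
      by (simp add: matrix_vector_mult_scaleR)
    also have "\<dots> = ?ZG m \<omega> + ?ZF m \<omega>"
      unfolding score0[OF g] rc_version_eq[OF subs(1)[OF g]] rc_version_eq[OF subs(2)[OF g]]
        \<Lambda>F_def \<Lambda>G_def scaleR_matrix_vector_assoc[symmetric]
      by (simp add: matrix_vector_mult_scaleR matrix_vector_mult_diff_distrib scaleR_diff_right)
    finally show ?thesis by simp
  qed
  let ?T = "\<lambda>m \<omega>. sqrt (?n m) *\<^sub>R (\<theta>t m \<omega> - \<theta>0)"
  have "converges_in_law M ?T \<nu>"
  proof (rule M.converges_in_law_perturb[OF lawZ])
    show "prob_space \<nu>" "sets \<nu> = sets borel" using normal by (auto simp: is_centered_normal_def)
    show "?T m \<in> borel_measurable M" for m using \<theta>t_measurable[of m] by measurable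
    show "AE \<omega> in M. \<exists>\<epsilon>. \<epsilon> \<longlonglongrightarrow> 0 \<and> (\<forall>\<^sub>F m in sequentially.
        norm (?T m \<omega> - (?ZG m \<omega> + ?ZF m \<omega>)) \<le> \<epsilon> m * norm (?ZG m \<omega> + ?ZF m \<omega>))"
      using AE_good
    proof eventually_elim
      case (elim \<omega>)
      have r: "\<forall>\<^sub>F m in sequentially. ?U \<omega> m (\<eta> (\<theta>t m \<omega>)) = 0"
        using root[OF elim] by (auto elim: eventually_mono)
      obtain C where C: "\<forall>\<^sub>F m in sequentially. norm (\<eta> (\<theta>t m \<omega>)) \<le> C * norm (?U \<omega> m 0)"
        using two_sample_limit.score_root_expansion(2)[OF tsl[OF elim] r] by blast
      obtain \<epsilon> where \<epsilon>: "\<epsilon> \<longlonglongrightarrow> 0" "\<forall>\<^sub>F m in sequentially. norm (?J *v \<eta> (\<theta>t m \<omega>) + ?U \<omega> m 0) \<le> \<epsilon> m * norm (?U \<omega> m 0)"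
        using two_sample_limit.score_root_expansion(3)[OF tsl[OF elim] r] by blast
      obtain \<epsilon>' where \<epsilon>': "\<epsilon>' \<longlonglongrightarrow> 0"
        "\<forall>\<^sub>F m in sequentially. norm (h1 \<theta>0 *\<^sub>R (\<theta>t m \<omega> - \<theta>0) + K *v ?U \<omega> m 0) \<le> \<epsilon>' m * norm (K *v ?U \<omega> m 0)"
        using delta_method[OF hpos \<eta>' \<eta>0 consistent[OF elim] K C \<epsilon>] by blast
      from \<epsilon>'(2) have "\<forall>\<^sub>F m in sequentially. norm (?T m \<omega> - (?ZG m \<omega> + ?ZF m \<omega>)) \<le> \<epsilon>' m * norm (?ZG m \<omega> + ?ZF m \<omega>)"
      proof eventually_elim
        case m: (elim m)
        let ?c = "sqrt (?n m) / h1 \<theta>0"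
        have c: "0 \<le> ?c" using hpos by simp
        have "?T m \<omega> - (?ZG m \<omega> + ?ZF m \<omega>) = ?c *\<^sub>R (h1 \<theta>0 *\<^sub>R (\<theta>t m \<omega> - \<theta>0) + K *v ?U \<omega> m 0)"
          unfolding Z_eq[OF elim] using hpos by (simp add: scaleR_add_right)
        then have "norm (?T m \<omega> - (?ZG m \<omega> + ?ZF m \<omega>)) = ?c * norm (h1 \<theta>0 *\<^sub>R (\<theta>t m \<omega> - \<theta>0) + K *v ?U \<omega> m 0)"
          using c by (simp only: norm_scaleR abs_of_nonneg)
        also have "\<dots> \<le> ?c * (\<epsilon>' m * norm (K *v ?U \<omega> m 0))" by (rule mult_left_mono[OF m c])
        also have "\<dots> = \<epsilon>' m * norm (?ZG m \<omega> + ?ZF m \<omega>)"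
          unfolding Z_eq[OF elim] using hpos by simp
        finally show ?case .
      qed
      with \<epsilon>'(1) show ?case by blast
    qed
  qed
  with normal have part2: "\<exists>\<Sigma>0. asymptotically_normal M ?T \<Sigma>0"
    unfolding asymptotically_normal_def by blast
  have part1: "AE \<omega> in M. (\<lambda>m. \<theta>t m \<omega>) \<longlonglongrightarrow> \<theta>0" using AE_good by eventually_elim (rule consistent)
  have part3': "AE \<omega> in M. (\<lambda>m. sup_norm0 (\<lambda>t.
      semiparametric_df \<phi> \<rho>0 \<rho>1 (Fhat m \<omega>) (Ghat m \<omega>) (\<theta>t m \<omega>) t - F0 t)) \<longlonglongrightarrow> 0"
    using AE_good by eventually_elim (rule part3)
  from part1 part2 part3' show ?thesis by blast
qed

end
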